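(* Let $n\in\mathbb{N}$, $n>1$. Let $\lambda_{1,L,(n)}(\mathcal{A})$ be the first eigenvalue of the Laplace operator (with vanishing Dirichlet traces) and $\lambda_{1,S,(n)}(\mathcal{A})$ the first eigenvalue of the Stokes operator on $\Omega_{(n),\mathcal{A}}$, $\mathcal{A}\in(0,\infty)$. Then $$\lim_{\mathcal{A}\to\infty}\lambda_{1,L,(n)}(\mathcal{A})=\pi^2\qquad\text{and}\qquad\lim_{\mathcal{A}\to\infty}\lambda_{1,S,(n)}(\mathcal{A})=\pi^2.$$
   Context: $\|\cdot\|$ is the Euclidean norm on $\mathbb{R}^n$. For $\mathcal{A}\in(0,\infty)$, $\Omega_{(n),\mathcal{A}}:=\{x\in\mathbb{R}^n:\ \mathcal{A}/2<\|x\|<1+\mathcal{A}/2\}$. The Laplace operator on $\Omega$ is the Friedrichs extension in $L_2(\Omega)$ of $-\Delta$ on $C_c^\infty(\Omega)$ (positive Dirichlet Laplacian). For a domain $\Omega\subset\mathbb{R}^n$, let $\mathcal{V}(\Omega)$ be the set of divergence-free fields in $(C_c^\infty(\Omega))^n$, $\mathbb{H}(\Omega)$ its closure in $(L_2(\Omega))^n$ and $\mathbb{V}(\Omega)$ its closure in $(W_2^1(\Omega))^n$; the Stokes operator is $-\Upsilon\Delta$ in $\mathbb{H}(\Omega)$ with domain $(W_2^2(\Omega))^n\cap\mathbb{V}(\Omega)$, where $\Upsilon$ is the orthogonal projection of $(L_2(\Omega))^n$ onto $\mathbb{H}(\Omega)$. First eigenvalue means smallest eigenvalue. *)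

theory Defs
  imports "HOL-Analysis.Analysis"
begin

text \<open>
  An element of \<open>L\<^sub>2(\<Omega>)\<close> is represented by a function on the whole space of which only the
  restriction to \<open>\<Omega>\<close> matters, up to null sets. The codomain is an arbitrary Euclidean space, so
  that \<open>real\<close> gives \<open>L\<^sub>2(\<Omega>)\<close> and \<^typ>\<open>real ^ 'n\<close> gives the fields \<open>(L\<^sub>2(\<Omega>))\<^sup>n\<close>.
\<close>

definition L2 :: "(real ^ 'n) set \<Rightarrow> (real ^ 'n \<Rightarrow> 'b::euclidean_space) set" where
  "L2 \<Omega> = {u. u \<in> borel_measurable (lebesgue_on \<Omega>) \<and>
                integrable (lebesgue_on \<Omega>) (\<lambda>x. (norm (u x))\<^sup>2)}"

definition L2_inner ::
  "(real ^ 'n) set \<Rightarrow> (real ^ 'n \<Rightarrow> 'b::euclidean_space) \<Rightarrow> (real ^ 'n \<Rightarrow> 'b) \<Rightarrow> real" where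
  "L2_inner \<Omega> u v = (LINT x|lebesgue_on \<Omega>. u x \<bullet> v x)"

definition L2_norm :: "(real ^ 'n) set \<Rightarrow> (real ^ 'n \<Rightarrow> 'b::euclidean_space) \<Rightarrow> real" where
  "L2_norm \<Omega> u = sqrt (L2_inner \<Omega> u u)"

definition partial ::
  "'n \<Rightarrow> (real ^ 'n \<Rightarrow> 'b::real_normed_vector) \<Rightarrow> real ^ 'n \<Rightarrow> 'b" where
  "partial i f x = frechet_derivative f (at x) (axis i 1)"

primrec partials ::
  "'n list \<Rightarrow> (real ^ 'n \<Rightarrow> 'b::real_normed_vector) \<Rightarrow> real ^ 'n \<Rightarrow> 'b" where
  "partials [] f = f"
| "partials (i # is) f = partial i (partials is f)"

definition smooth :: "(real ^ 'n \<Rightarrow> 'b::real_normed_vector) \<Rightarrow> bool" where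
  "smooth f \<longleftrightarrow> (\<forall>is x. partials is f differentiable (at x))"

text \<open>\<open>C\<^sub>c\<^sup>\<infinity>(\<Omega>)\<close>, its elements being extended by zero outside \<open>\<Omega>\<close>.\<close>

definition test_functions ::
  "(real ^ 'n) set \<Rightarrow> (real ^ 'n \<Rightarrow> 'b::real_normed_vector) set" where
  "test_functions \<Omega> =
     {\<phi>. smooth \<phi> \<and> compact (closure {x. \<phi> x \<noteq> 0}) \<and> closure {x. \<phi> x \<noteq> 0} \<subseteq> \<Omega>}"

definition laplacian ::
  "(real ^ 'n \<Rightarrow> 'b::real_normed_vector) \<Rightarrow> real ^ 'n \<Rightarrow> 'b" where
  "laplacian f x = (\<Sum>i\<in>UNIV. partials [i, i] f x)"

definition divergence :: "(real ^ 'n \<Rightarrow> real ^ 'n) \<Rightarrow> real ^ 'n \<Rightarrow> real" where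
  "divergence v x = (\<Sum>i\<in>UNIV. partial i v x $ i)"

text \<open>
  Sobolev spaces \<open>W\<^sub>2\<^sup>k(\<Omega>)\<close>. A multi-index \<open>\<alpha>\<close> is encoded by a list of coordinate directions of
  length \<open>|\<alpha>|\<close>; for vector-valued functions the derivatives are taken componentwise.
\<close>

definition has_weak_deriv ::
  "(real ^ 'n) set \<Rightarrow> 'n list \<Rightarrow> (real ^ 'n \<Rightarrow> 'b::euclidean_space) \<Rightarrow> (real ^ 'n \<Rightarrow> 'b) \<Rightarrow> bool"
where
  "has_weak_deriv \<Omega> is u g \<longleftrightarrow>
     (\<forall>\<phi> \<in> test_functions \<Omega>.
        (LINT x|lebesgue_on \<Omega>. partials is \<phi> x *\<^sub>R u x) =
        (-1) ^ length is *\<^sub>R (LINT x|lebesgue_on \<Omega>. \<phi> x *\<^sub>R g x))"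

definition sobolev :: "nat \<Rightarrow> (real ^ 'n) set \<Rightarrow> (real ^ 'n \<Rightarrow> 'b::euclidean_space) set" where
  "sobolev k \<Omega> =
     {u \<in> L2 \<Omega>. \<forall>is. length is \<le> k \<longrightarrow> (\<exists>g \<in> L2 \<Omega>. has_weak_deriv \<Omega> is u g)}"

text \<open>On open sets the choice is unique up to null sets.\<close>

definition weak_deriv ::
  "(real ^ 'n) set \<Rightarrow> 'n list \<Rightarrow> (real ^ 'n \<Rightarrow> 'b::euclidean_space) \<Rightarrow> real ^ 'n \<Rightarrow> 'b" where
  "weak_deriv \<Omega> is u = (SOME g. g \<in> L2 \<Omega> \<and> has_weak_deriv \<Omega> is u g)"

text \<open>
  For \<open>k \<le> 1\<close> lists and multi-indices coincide; for larger \<open>k\<close> mixed derivatives are counted with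
  multiplicity, which gives an equivalent norm.
\<close>

definition sobolev_norm ::
  "nat \<Rightarrow> (real ^ 'n) set \<Rightarrow> (real ^ 'n \<Rightarrow> 'b::euclidean_space) \<Rightarrow> real" where
  "sobolev_norm k \<Omega> u = sqrt (\<Sum>is | length is \<le> k. (L2_norm \<Omega> (weak_deriv \<Omega> is u))\<^sup>2)"

definition weak_laplacian ::
  "(real ^ 'n) set \<Rightarrow> (real ^ 'n \<Rightarrow> 'b::euclidean_space) \<Rightarrow> real ^ 'n \<Rightarrow> 'b" where
  "weak_laplacian \<Omega> u x = (\<Sum>i\<in>UNIV. weak_deriv \<Omega> [i, i] u x)"

text \<open>
  An unbounded operator in \<open>L\<^sub>2(\<Omega>)\<close>, or in a closed subspace of it, is given by its graph, a set of
  pairs (argument, value).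

  The Friedrichs extension of a densely defined, symmetric, lower semibounded operator \<open>S\<close> is the
  restriction of the adjoint of \<open>S\<close> to its intersection with the energy space. The latter is the
  completion of the domain of \<open>S\<close> in the norm given by
  \<open>\<langle>S \<phi>, \<phi>\<rangle> + c \<langle>\<phi>, \<phi>\<rangle>\<close> with large \<open>c\<close>, realised inside \<open>L\<^sub>2(\<Omega>)\<close>; along sequences
  that converge in \<open>L\<^sub>2(\<Omega>)\<close> the second summand does not affect the Cauchy property.
\<close>

definition energy_space ::
  "(real ^ 'n) set \<Rightarrow> ((real ^ 'n \<Rightarrow> 'b::euclidean_space) \<times> (real ^ 'n \<Rightarrow> 'b)) set \<Rightarrow>
   (real ^ 'n \<Rightarrow> 'b) set" where
  "energy_space \<Omega> S =
     {u \<in> L2 \<Omega>. \<exists>\<phi> \<psi>.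
        (\<forall>k::nat. (\<phi> k, \<psi> k) \<in> S) \<and>
        (\<lambda>k. L2_norm \<Omega> (\<lambda>x. \<phi> k x - u x)) \<longlonglongrightarrow> 0 \<and>
        (\<forall>e>0. \<exists>N. \<forall>k\<ge>N. \<forall>m\<ge>N.
           \<bar>L2_inner \<Omega> (\<lambda>x. \<psi> k x - \<psi> m x) (\<lambda>x. \<phi> k x - \<phi> m x)\<bar> < e)}"

definition adjoint_graph ::
  "(real ^ 'n) set \<Rightarrow> ((real ^ 'n \<Rightarrow> 'b::euclidean_space) \<times> (real ^ 'n \<Rightarrow> 'b)) set \<Rightarrow>
   ((real ^ 'n \<Rightarrow> 'b) \<times> (real ^ 'n \<Rightarrow> 'b)) set" where
  "adjoint_graph \<Omega> S =
     {(u, f). u \<in> L2 \<Omega> \<and> f \<in> L2 \<Omega> \<and>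
        (\<forall>(\<phi>, \<psi>) \<in> S. L2_inner \<Omega> \<psi> u = L2_inner \<Omega> \<phi> f)}"

definition friedrichs_extension ::
  "(real ^ 'n) set \<Rightarrow> ((real ^ 'n \<Rightarrow> 'b::euclidean_space) \<times> (real ^ 'n \<Rightarrow> 'b)) set \<Rightarrow>
   ((real ^ 'n \<Rightarrow> 'b) \<times> (real ^ 'n \<Rightarrow> 'b)) set" where
  "friedrichs_extension \<Omega> S = {(u, f) \<in> adjoint_graph \<Omega> S. u \<in> energy_space \<Omega> S}"

definition laplace_operator ::
  "(real ^ 'n) set \<Rightarrow> ((real ^ 'n \<Rightarrow> real) \<times> (real ^ 'n \<Rightarrow> real)) set" where
  "laplace_operator \<Omega> =
     friedrichs_extension \<Omega> {(\<phi>, \<lambda>x. - laplacian \<phi> x) |\<phi>. \<phi> \<in> test_functions \<Omega>}"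

text \<open>The fields \<open>\<V>(\<Omega>)\<close> and their closures in \<open>(L\<^sub>2(\<Omega>))\<^sup>n\<close> and in \<open>(W\<^sub>2\<^sup>1(\<Omega>))\<^sup>n\<close>.\<close>

definition solenoidal_test_fields :: "(real ^ 'n) set \<Rightarrow> (real ^ 'n \<Rightarrow> real ^ 'n) set" where
  "solenoidal_test_fields \<Omega> = {\<phi> \<in> test_functions \<Omega>. \<forall>x. divergence \<phi> x = 0}"

definition solenoidal_L2 :: "(real ^ 'n) set \<Rightarrow> (real ^ 'n \<Rightarrow> real ^ 'n) set" where
  "solenoidal_L2 \<Omega> =
     {u \<in> L2 \<Omega>. \<exists>\<phi>. (\<forall>k::nat. \<phi> k \<in> solenoidal_test_fields \<Omega>) \<and>
        (\<lambda>k. L2_norm \<Omega> (\<lambda>x. \<phi> k x - u x)) \<longlonglongrightarrow> 0}"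

definition solenoidal_W12 :: "(real ^ 'n) set \<Rightarrow> (real ^ 'n \<Rightarrow> real ^ 'n) set" where
  "solenoidal_W12 \<Omega> =
     {u \<in> sobolev 1 \<Omega>. \<exists>\<phi>. (\<forall>k::nat. \<phi> k \<in> solenoidal_test_fields \<Omega>) \<and>
        (\<lambda>k. sobolev_norm 1 \<Omega> (\<lambda>x. \<phi> k x - u x)) \<longlonglongrightarrow> 0}"

text \<open>The graph of the orthogonal projection \<open>\<Upsilon>\<close> of \<open>(L\<^sub>2(\<Omega>))\<^sup>n\<close> onto \<^const>\<open>solenoidal_L2\<close>.\<close>

definition solenoidal_projection ::
  "(real ^ 'n) set \<Rightarrow> ((real ^ 'n \<Rightarrow> real ^ 'n) \<times> (real ^ 'n \<Rightarrow> real ^ 'n)) set" where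
  "solenoidal_projection \<Omega> =
     {(v, w). v \<in> L2 \<Omega> \<and> w \<in> solenoidal_L2 \<Omega> \<and>
        (\<forall>h \<in> solenoidal_L2 \<Omega>. L2_inner \<Omega> (\<lambda>x. v x - w x) h = 0)}"

definition stokes_operator ::
  "(real ^ 'n) set \<Rightarrow> ((real ^ 'n \<Rightarrow> real ^ 'n) \<times> (real ^ 'n \<Rightarrow> real ^ 'n)) set" where
  "stokes_operator \<Omega> =
     {(u, f). u \<in> sobolev 2 \<Omega> \<inter> solenoidal_W12 \<Omega> \<and>
        ((\<lambda>x. - weak_laplacian \<Omega> u x), f) \<in> solenoidal_projection \<Omega>}"

definition is_eigenvalue ::
  "(real ^ 'n) set \<Rightarrow> ((real ^ 'n \<Rightarrow> 'b::euclidean_space) \<times> (real ^ 'n \<Rightarrow> 'b)) set \<Rightarrow> real \<Rightarrow> bool"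
where
  "is_eigenvalue \<Omega> T l \<longleftrightarrow>
     (\<exists>(u, f) \<in> T. \<not> (AE x in lebesgue_on \<Omega>. u x = 0) \<and>
                   (AE x in lebesgue_on \<Omega>. f x = l *\<^sub>R u x))"

definition first_eigenvalue ::
  "(real ^ 'n) set \<Rightarrow> ((real ^ 'n \<Rightarrow> 'b::euclidean_space) \<times> (real ^ 'n \<Rightarrow> 'b)) set \<Rightarrow> real" where
  "first_eigenvalue \<Omega> T = (LEAST l. is_eigenvalue \<Omega> T l)"

definition annulus :: "real \<Rightarrow> (real ^ 'n) set" where
  "annulus A = {x. A / 2 < norm x \<and> norm x < 1 + A / 2}"

definition first_laplace_eigenvalue :: "'n::finite itself \<Rightarrow> real \<Rightarrow> real" where
  "first_laplace_eigenvalue _ A =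
     first_eigenvalue (annulus A :: (real ^ 'n) set) (laplace_operator (annulus A))"

definition first_stokes_eigenvalue :: "'n::finite itself \<Rightarrow> real \<Rightarrow> real" where
  "first_stokes_eigenvalue _ A =
     first_eigenvalue (annulus A :: (real ^ 'n) set) (stokes_operator (annulus A))"

end

theory Submission
  imports Defs "HOL-Real_Asymp.Real_Asymp"
begin

text \<open>
  Write \<open>a = A / 2\<close>. Every eigenvalue of either operator is the Dirichlet energy of a limit of test
  functions, so lower bounds for the energy of test functions bound the eigenvalues from below: in the
  variable \<open>s = |x|\<^sup>2\<close>, whose range on the shell has length \<open>2 a + 1\<close>, the function
  \<open>cos (\<beta> (s - s\<^sub>0))\<close> with \<open>\<beta>\<close> slightly less than \<open>\<pi> / (2 a + 1)\<close> is a positive supersolution of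
  \<open>- \<Delta> u = c u\<close> with \<open>c\<close> close to \<open>\<pi>\<^sup>2\<close> when \<open>a\<close> is large. Eigenvalues close to \<open>\<pi>\<^sup>2\<close> come from explicit
  modes \<open>f (|x|\<^sup>2) P x\<close>, where \<open>P = 1\<close> for the Laplace operator and \<open>P\<close> is an infinitesimal rotation for
  the Stokes operator; the latter modes are divergence-free and need no pressure. Their profile is a
  power series that tends to \<open>sin (\<surd>\<lambda> t) / \<surd>\<lambda>\<close> as \<open>a \<rightarrow> \<infinity>\<close>, and the intermediate value theorem in \<open>\<lambda>\<close>
  provides the boundary condition. A smallest eigenvalue exists because only finitely many eigenvalues
  lie below any bound; this needs no regularity theory, since eigenfunctions to different eigenvalues
  are orthogonal and orthonormal functions of bounded energy are limited in number.
\<close>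

section \<open>Functions of class \<open>C\<^sup>k\<close>\<close>

text \<open>\<open>first_eigenvalue\<close> is a \<open>LEAST\<close> over the reals, so bounding an
  infimum is not enough: a minimum has to exist. Nor does a trial function with small Rayleigh
  quotient yield an eigenvalue without compactness, and membership in the Stokes domain would also
  call for second derivatives up to the boundary. Exact modes, smooth across the boundary, settle
  membership in both domains directly. Both operators are reduced to one notion,
  \<open>weak_eigenpair\<close>, with the class of test functions as a parameter; restricting that
  class to solenoidal fields removes the pressure. The lower bound for scalar functions passes to
  fields component by component, which is why both limits agree. Taking \<open>|x|\<^sup>2\<close>
  instead of \<open>|x|\<close> as radial variable keeps everything polynomial in \<open>x\<close>.
  On the shell its gradient has length close to \<open>2 a\<close> and its range has length
  \<open>2 a + 1\<close>, so a half-period fitted to that range has frequency close to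
  \<open>\<pi>\<close> in the radius. The dimension enters only through terms of order
  \<open>1 / a\<close>, for the modes as well as for the cosine.\<close>

primrec Ck ::
  "nat \<Rightarrow> 'a::real_normed_vector set \<Rightarrow> ('a \<Rightarrow> 'b::real_normed_vector) \<Rightarrow> bool" where
  "Ck 0 S f = continuous_on S f"
| "Ck (Suc k) S f \<longleftrightarrow>
     (\<forall>x\<in>S. f differentiable (at x)) \<and> (\<forall>v. Ck k S (\<lambda>x. frechet_derivative f (at x) v))"

text \<open>\<open>frechet_derivative\<close> is a choice among all derivatives at the point, so
  functions with the same derivatives get the same choice, also where neither is
  differentiable.\<close>

lemma frechet_derivative_cong_open:
  assumes "open S" "x \<in> S" "\<And>y. y \<in> S \<Longrightarrow> f y = g y"
  shows "frechet_derivative f (at x) = frechet_derivative g (at x)"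
proof -
  have "(f has_derivative D) (at x) \<longleftrightarrow> (g has_derivative D) (at x)" for D
    using has_derivative_transform_within_open[of f D x UNIV S g]
      has_derivative_transform_within_open[of g D x UNIV S f] assms by metis
  then show ?thesis
    by (simp add: frechet_derivative_def)
qed

lemma Ck_cong:
  assumes "open S" "\<And>x. x \<in> S \<Longrightarrow> f x = g x" "Ck k S f"
  shows "Ck k S g"
  using assms(2,3)
proof (induction k arbitrary: f g)
  case 0
  then show ?case
    by (simp cong: continuous_on_cong)
next
  case (Suc k)
  have "g differentiable (at x)" if "x \<in> S" for x
  proof -
    from that Suc.prems(2) obtain D where "(f has_derivative D) (at x)"
      by (auto simp: differentiable_def)
    then have "(g has_derivative D) (at x)"
      using has_derivative_transform_within_open[OF _ assms(1) that] Suc.prems(1) by blast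
    then show ?thesis
      by (auto simp: differentiable_def)
  qed
  moreover have "Ck k S (\<lambda>x. frechet_derivative g (at x) v)" for v
  proof (rule Suc.IH)
    show "Ck k S (\<lambda>x. frechet_derivative f (at x) v)"
      using Suc.prems(2) by simp
    show "frechet_derivative f (at x) v = frechet_derivative g (at x) v" if "x \<in> S" for x
      using frechet_derivative_cong_open[OF assms(1) that, of f g] Suc.prems(1) by metis
  qed
  ultimately show ?case
    by simp
qed

lemma Ck_SucI:
  assumes "open S" "\<And>x. x \<in> S \<Longrightarrow> (f has_derivative f' x) (at x)" "\<And>v. Ck k S (\<lambda>x. f' x v)"
  shows "Ck (Suc k) S f"
proof -
  have "Ck k S (\<lambda>x. frechet_derivative f (at x) v)" for v
    by (rule Ck_cong[OF assms(1) _ assms(3)[of v]]) (use assms(2) frechet_derivative_at in metis)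
  then show ?thesis
    using assms(2) by (auto simp: differentiable_def)
qed

lemma Ck_SucD:
  assumes "Ck (Suc k) S f" "x \<in> S"
  shows "(f has_derivative frechet_derivative f (at x)) (at x)"
  using assms by (simp add: frechet_derivative_works)

lemma Ck_Suc_imp: "Ck (Suc k) S f \<Longrightarrow> Ck k S f"
proof (induction k arbitrary: f)
  case 0
  then show ?case
    by (auto intro!: continuous_at_imp_continuous_on differentiable_imp_continuous_within)
qed auto

lemma Ck_mono: "Ck k S f \<Longrightarrow> j \<le> k \<Longrightarrow> Ck j S f"
proof (induction k)
  case (Suc k)
  then show ?case
    using Ck_Suc_imp[of k S f] by (cases "j = Suc k") auto
qed simp

lemma Ck_imp_continuous_on: "Ck k S f \<Longrightarrow> continuous_on S f"
  using Ck_mono[of k S f 0] by simp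

lemma Ck_subset: "Ck k S f \<Longrightarrow> T \<subseteq> S \<Longrightarrow> Ck k T f"
  by (induction k arbitrary: f) (auto intro: continuous_on_subset)

lemma Ck_const: "open S \<Longrightarrow> Ck k S (\<lambda>x. c)"
proof (induction k arbitrary: c)
  case (Suc k)
  show ?case
    by (rule Ck_SucI[where f' = "\<lambda>x v. 0"]) (use Suc in auto)
qed auto

lemma Ck_bounded_linear_id:
  assumes "open S" "bounded_linear L"
  shows "Ck k S L"
proof (cases k)
  case 0
  then show ?thesis
    using assms by (simp add: linear_continuous_on)
next
  case (Suc j)
  have "Ck (Suc j) S L"
    using assms by (intro Ck_SucI[where f' = "\<lambda>x. L"] bounded_linear_imp_has_derivative Ck_const)
  then show ?thesis
    by (simp only: Suc)
qed

lemma Ck_add: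
  assumes "open S" "Ck k S f" "Ck k S g"
  shows "Ck k S (\<lambda>x. f x + g x)"
  using assms(2,3)
proof (induction k arbitrary: f g)
  case 0
  then show ?case by (auto intro: continuous_intros)
next
  case (Suc k)
  show ?case
    by (rule Ck_SucI[where f' = "\<lambda>x v. frechet_derivative f (at x) v + frechet_derivative g (at x) v"])
      (use Suc assms(1) Ck_SucD[OF Suc.prems(1)] Ck_SucD[OF Suc.prems(2)] in \<open>auto intro!: has_derivative_add\<close>)
qed

lemma Ck_sum:
  assumes "open S" "\<And>i. i \<in> I \<Longrightarrow> Ck k S (f i)"
  shows "Ck k S (\<lambda>x. \<Sum>i\<in>I. f i x)"
  using assms(2) by (induction I rule: infinite_finite_induct) (auto intro: Ck_const Ck_add assms(1))

text \<open>One induction for scalar multiples, real products and inner products. It runs over both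
  factors, since each term of the product rule differentiates one of them and keeps the
  other.\<close>

lemma Ck_bilinear:
  fixes prod :: "'b::real_normed_vector \<Rightarrow> 'c::real_normed_vector \<Rightarrow> 'd::real_normed_vector"
  assumes "bounded_bilinear prod" "open S" "Ck k S f" "Ck k S g"
  shows "Ck k S (\<lambda>x. prod (f x) (g x))"
  using assms(3,4)
proof (induction k arbitrary: f g)
  case 0
  then show ?case
    by (auto intro: bounded_bilinear.continuous_on[OF assms(1)])
next
  case (Suc k)
  show ?case
  proof (rule Ck_SucI[OF assms(2)])
    show "((\<lambda>x. prod (f x) (g x)) has_derivative
        (\<lambda>v. prod (f x) (frechet_derivative g (at x) v) + prod (frechet_derivative f (at x) v) (g x))) (at x)"
      if "x \<in> S" for x
      using bounded_bilinear.FDERIV[OF assms(1) Ck_SucD[OF Suc.prems(1) that] Ck_SucD[OF Suc.prems(2) that]] .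
    show "Ck k S (\<lambda>x. prod (f x) (frechet_derivative g (at x) v) +
        prod (frechet_derivative f (at x) v) (g x))" for v
      using Suc.prems Ck_Suc_imp[OF Suc.prems(1)] Ck_Suc_imp[OF Suc.prems(2)]
      by (intro Ck_add Suc.IH assms(2)) auto
  qed
qed

lemmas Ck_scaleR = Ck_bilinear[OF bounded_bilinear_scaleR]
lemmas Ck_mult = Ck_bilinear[OF bounded_bilinear_mult]
lemmas Ck_inner = Ck_bilinear[OF bounded_bilinear_inner]

lemma Ck_minus: "open S \<Longrightarrow> Ck k S f \<Longrightarrow> Ck k S (\<lambda>x. - f x)"
  using Ck_scaleR[OF _ Ck_const, of S k f "-1"] by simp

lemma Ck_diff: "open S \<Longrightarrow> Ck k S f \<Longrightarrow> Ck k S g \<Longrightarrow> Ck k S (\<lambda>x. f x - g x)"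
  using Ck_add[of S k f "\<lambda>x. - g x"] Ck_minus[of S k g] by simp

lemma Ck_prod:
  fixes f :: "'i \<Rightarrow> 'a::real_normed_vector \<Rightarrow> real"
  assumes "open S" "\<And>i. i \<in> I \<Longrightarrow> Ck k S (f i)"
  shows "Ck k S (\<lambda>x. \<Prod>i\<in>I. f i x)"
  using assms(2) by (induction I rule: infinite_finite_induct) (auto intro: Ck_const Ck_mult assms(1))

text \<open>On the line a derivative is determined by its value at 1, so the chain rule gives a
  scalar multiple of \<open>?f' (g x)\<close> and the induction closes with
  \<open>Ck_scaleR\<close>.\<close>

lemma Ck_compose_real:
  fixes f :: "real \<Rightarrow> 'b::real_normed_vector"
  assumes "open S" "Ck k T f" "Ck k S g" "g ` S \<subseteq> T"
  shows "Ck k S (\<lambda>x. f (g x))"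
  using assms(2,3)
proof (induction k arbitrary: f)
  case 0
  then show ?case
    using assms(4) by (auto intro: continuous_on_compose2)
next
  case (Suc k)
  let ?f' = "\<lambda>y. frechet_derivative f (at y) 1"
  show ?case
  proof (rule Ck_SucI[OF assms(1)])
    fix x assume x: "x \<in> S"
    define D where "D = frechet_derivative f (at (g x))"
    have D: "(f has_derivative D) (at (g x))"
      unfolding D_def using Ck_SucD[OF Suc.prems(1)] x assms(4) by blast
    have "D h = h *\<^sub>R D 1" for h
      by (metis linear_scale[OF has_derivative_linear[OF D]] real_scaleR_def mult.right_neutral)
    then have "D = (\<lambda>h. h *\<^sub>R ?f' (g x))"
      unfolding D_def by (rule ext)
    with D have "(f has_derivative (\<lambda>h. h *\<^sub>R ?f' (g x))) (at (g x))"
      by (rule subst[rotated])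
    from has_derivative_compose[OF Ck_SucD[OF Suc.prems(2) x] this]
    show "((\<lambda>x. f (g x)) has_derivative
        (\<lambda>v. frechet_derivative g (at x) v *\<^sub>R ?f' (g x))) (at x)" .
  next
    fix v
    show "Ck k S (\<lambda>x. frechet_derivative g (at x) v *\<^sub>R ?f' (g x))"
      using Suc.prems Ck_Suc_imp[OF Suc.prems(2)] by (intro Ck_scaleR assms(1) Suc.IH) auto
  qed
qed

lemma Ck_inverse:
  fixes f :: "'a::real_normed_vector \<Rightarrow> real"
  assumes "open S" "Ck k S f" "\<And>x. x \<in> S \<Longrightarrow> f x \<noteq> 0"
  shows "Ck k S (\<lambda>x. inverse (f x))"
  using assms(2)
proof (induction k)
  case 0
  then show ?case
    using assms(3) by (auto intro: continuous_on_inverse)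
next
  case (Suc k)
  show ?case
  proof (rule Ck_SucI[OF assms(1)])
    show "((\<lambda>x. inverse (f x)) has_derivative
        (\<lambda>v. - (inverse (f x) * frechet_derivative f (at x) v * inverse (f x)))) (at x)"
      if "x \<in> S" for x
      using Deriv.has_derivative_inverse[OF assms(3)[OF that] Ck_SucD[OF Suc.prems that]] .
    show "Ck k S (\<lambda>x. - (inverse (f x) * frechet_derivative f (at x) v * inverse (f x)))" for v
      using Suc Ck_Suc_imp[OF Suc.prems] by (intro Ck_minus Ck_mult assms(1)) auto
  qed
qed

lemma Ck_Un:
  assumes "open S" "open T" "Ck k S f" "Ck k T f"
  shows "Ck k (S \<union> T) f"
  using assms(3,4) by (induction k arbitrary: f) (auto intro: continuous_on_open_Un assms(1,2))

text \<open>Class \<open>C^k\<close> is a local property, and the open sets \<open>S\<close> and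
  \<open>- K\<close> cover the space. Functions cut off inside a domain become functions on the
  whole space in this way.\<close>

lemma Ck_extend_zero:
  assumes "open S" "closed K" "K \<subseteq> S" "Ck k S f" "\<And>x. x \<notin> K \<Longrightarrow> f x = 0"
  shows "Ck k UNIV f"
proof -
  have "Ck k (- K) f"
    by (rule Ck_cong[where f = "\<lambda>x. 0"]) (use assms in \<open>auto intro: Ck_const\<close>)
  then have "Ck k (S \<union> - K) f"
    using assms by (intro Ck_Un) auto
  moreover have "S \<union> - K = UNIV"
    using assms(3) by auto
  ultimately show ?thesis by simp
qed

section \<open>Partial derivatives and test functions\<close>

lemma frechet_derivative_partial:
  fixes f :: "real ^ 'n::finite \<Rightarrow> 'b::real_normed_vector"
  assumes "f differentiable (at x)"
  shows "frechet_derivative f (at x) v = (\<Sum>i\<in>UNIV. v $ i *\<^sub>R partial i f x)"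
proof -
  interpret linear "frechet_derivative f (at x)"
    using assms linear_frechet_derivative by blast
  have "v = (\<Sum>i\<in>UNIV. v $ i *\<^sub>R axis i 1)"
    using basis_expansion[of v] by (simp add: scalar_mult_eq_scaleR)
  then have "frechet_derivative f (at x) v =
      frechet_derivative f (at x) (\<Sum>i\<in>UNIV. v $ i *\<^sub>R axis i 1)"
    by simp
  then show ?thesis
    by (simp only: sum scale partial_def)
qed

lemma partial_eqI: "(f has_derivative f') (at x) \<Longrightarrow> partial i f x = f' (axis i 1)"
  by (metis frechet_derivative_at partial_def)

lemma partial_cong_open:
  assumes "open S" "x \<in> S" "\<And>y. y \<in> S \<Longrightarrow> f y = g y"
  shows "partial i f x = partial i g x"
  using frechet_derivative_cong_open[OF assms] by (simp add: partial_def)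

lemma Ck_partial: "Ck (Suc k) S f \<Longrightarrow> Ck k S (partial i f)"
  using fun_cong[OF refl, of "partial i f"] by (simp add: partial_def[abs_def])

lemma partials_append: "partials (is @ js) f = partials is (partials js f)"
  by (induction "is") auto

lemma smooth_partial:
  assumes "smooth f"
  shows "smooth (partial i f)"
  unfolding smooth_def
proof (intro allI)
  fix "is" x
  show "partials is (partial i f) differentiable at x"
    using assms[unfolded smooth_def, rule_format, of "is @ [i]" x] by (simp add: partials_append)
qed

text \<open>\<open>smooth\<close> speaks of iterated partial derivatives, \<open>Ck\<close> of
  derivatives in all directions. The derivative in a fixed direction is a combination of partial
  derivatives with constant coefficients, and partial derivatives of smooth functions are smooth.
  The directional form is the one in which product and chain rule go through by induction on
  \<open>k\<close>.\<close>

lemma smooth_imp_Ck: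
  fixes f :: "real ^ 'n::finite \<Rightarrow> 'b::real_normed_vector"
  shows "smooth f \<Longrightarrow> Ck k UNIV f"
proof (induction k arbitrary: f)
  case 0
  then have "f differentiable (at x)" for x
    using partials.simps(1)[of f] unfolding smooth_def by metis
  then show ?case
    by (auto intro!: continuous_at_imp_continuous_on differentiable_imp_continuous_within)
next
  case (Suc k)
  have d: "f differentiable (at x)" for x
    using Suc.prems partials.simps(1)[of f] unfolding smooth_def by metis
  have "Ck k UNIV (\<lambda>x. \<Sum>i\<in>UNIV. v $ i *\<^sub>R partial i f x)" for v
    by (intro Ck_sum Ck_scaleR Ck_const Suc.IH smooth_partial Suc.prems) auto
  then show ?case
    using d by (simp add: frechet_derivative_partial)
qed

lemma smooth_iff_Ck:
  fixes f :: "real ^ 'n::finite \<Rightarrow> 'b::real_normed_vector"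
  shows "smooth f \<longleftrightarrow> (\<forall>k. Ck k UNIV f)"
proof
  assume f: "\<forall>k. Ck k UNIV f"
  have "\<forall>k. Ck k UNIV (partials is f)" for "is"
    by (induction "is") (use f in \<open>auto intro: Ck_partial\<close>)
  then have "Ck (Suc 0) UNIV (partials is f)" for "is"
    by blast
  then show "smooth f"
    by (auto simp: smooth_def)
qed (auto intro: smooth_imp_Ck)

lemma Ck_partials:
  "Ck (length is + k) S f \<Longrightarrow> Ck k S (partials is f)"
proof (induction "is" arbitrary: k)
  case (Cons i "is")
  then show ?case
    using Ck_partial[of k S "partials is f" i] Cons.IH[of "Suc k"] by (simp del: Ck.simps(2))
qed simp

lemma test_functionsI:
  fixes \<phi> :: "real ^ 'n::finite \<Rightarrow> 'b::real_normed_vector"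
  assumes "\<And>k. Ck k UNIV \<phi>" "compact K" "K \<subseteq> \<Omega>" "\<And>x. x \<notin> K \<Longrightarrow> \<phi> x = 0"
  shows "\<phi> \<in> test_functions \<Omega>"
proof -
  have "closure {x. \<phi> x \<noteq> 0} \<subseteq> K"
    using assms by (intro closure_minimal compact_imp_closed) auto
  then have "compact (closure {x. \<phi> x \<noteq> 0})" "closure {x. \<phi> x \<noteq> 0} \<subseteq> \<Omega>"
    using assms(2,3) by (auto intro: compact_closure[THEN iffD2] bounded_subset[OF compact_imp_bounded]
        closure_subset[THEN subsetD])
  then show ?thesis
    using assms(1) by (auto simp: test_functions_def smooth_iff_Ck)
qed

lemma test_functionsE:
  fixes \<phi> :: "real ^ 'n::finite \<Rightarrow> 'b::real_normed_vector"
  assumes "\<phi> \<in> test_functions \<Omega>"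
  obtains K where "\<And>k. Ck k UNIV \<phi>" "compact K" "K \<subseteq> \<Omega>" "\<And>x. x \<notin> K \<Longrightarrow> \<phi> x = 0"
  using assms closure_subset[of "{x. \<phi> x \<noteq> 0}"]
  by (auto simp: test_functions_def smooth_iff_Ck intro!: that[of "closure {x. \<phi> x \<noteq> 0}"])

section \<open>Smooth cut-offs\<close>

text \<open>The powers of \<open>inverse t\<close> are included because differentiating
  \<open>exp (- inverse t)\<close> produces them: the span of this family is closed under
  differentiation.\<close>

definition flat :: "nat \<Rightarrow> real \<Rightarrow> real" where
  "flat n t = (if t > 0 then inverse t ^ n * exp (- inverse t) else 0)"

lemma flat_tendsto_0: "(flat n \<longlongrightarrow> 0) (at 0)"
proof (rule filterlim_split_at)
  show "(flat n \<longlongrightarrow> 0) (at_left 0)"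
    by (rule tendsto_eventually) (auto simp: flat_def eventually_at_filter)
  have "((\<lambda>t::real. inverse t ^ n / exp (inverse t)) \<longlongrightarrow> 0) (at_right 0)"
    by (rule filterlim_compose[OF tendsto_power_div_exp_0 filterlim_inverse_at_top_right])
  then show "(flat n \<longlongrightarrow> 0) (at_right 0)"
    by (rule Lim_transform_eventually)
      (auto simp: flat_def eventually_at_filter exp_minus divide_inverse)
qed

lemma flat_has_derivative:
  "(flat n has_real_derivative flat (n + 2) t - real n * flat (n + 1) t) (at t)"
proof (cases t "0::real" rule: linorder_cases)
  case less
  have "(flat n has_real_derivative 0) (at t)"
    by (rule has_field_derivative_transform_within_open[of "\<lambda>t. 0" _ _ "{..<0}"])
      (use less in \<open>auto simp: flat_def\<close>)
  then show ?thesis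
    using less by (simp add: flat_def)
next
  case equal
  \<comment> \<open>The difference quotient at 0 is \<open>flat (Suc n)\<close>, so the limit at 0
    of the next member of the family gives the derivative.\<close>
  have "((\<lambda>y. (flat n y - flat n 0) / (y - 0)) \<longlongrightarrow> 0) (at 0)"
    by (rule Lim_transform_eventually[OF flat_tendsto_0[of "Suc n"]])
      (auto simp: flat_def eventually_at_filter divide_inverse)
  then show ?thesis
    using equal by (simp add: has_field_derivative_iff flat_def)
next
  case greater
  \<comment> \<open>For \<open>n = 0\<close> the exponent \<open>n - 1\<close> is truncated, but the
    factor \<open>real n\<close> vanishes.\<close>
  have n: "real n * inverse t ^ (n - 1) = real n * (inverse t ^ n * t)"
    using greater by (cases n) auto
  have "((\<lambda>t. inverse t ^ n * exp (- inverse t)) has_real_derivative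
      (real n * inverse t ^ (n - 1)) * (- (inverse t * inverse t)) * exp (- inverse t) +
      inverse t ^ n * (exp (- inverse t) * (inverse t * inverse t))) (at t)"
    using greater by (auto intro!: derivative_eq_intros)
  then have "((\<lambda>t. inverse t ^ n * exp (- inverse t)) has_real_derivative
      flat (n + 2) t - real n * flat (n + 1) t) (at t)"
    unfolding n using greater by (simp add: flat_def field_simps)
  then show ?thesis
    by (rule has_field_derivative_transform_within_open[of _ _ _ "{0<..}"])
      (use greater in \<open>auto simp: flat_def\<close>)
qed

lemma Ck_flat: "Ck k UNIV (flat n)"
proof (induction k arbitrary: n)
  case 0
  then show ?case
    by (auto intro!: continuous_at_imp_continuous_on DERIV_isCont flat_has_derivative)
next
  case (Suc k)
  show ?case
  proof (rule Ck_SucI)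
    show "(flat n has_derivative (\<lambda>v. (flat (n + 2) x - real n * flat (n + 1) x) * v)) (at x)" for x
      using flat_has_derivative by (simp add: has_field_derivative_def)
    show "Ck k UNIV (\<lambda>x. (flat (n + 2) x - real n * flat (n + 1) x) * v)" for v
      by (intro Ck_mult Ck_diff Ck_const Suc open_UNIV)
  qed simp
qed

text \<open>The denominator never vanishes, as \<open>t\<close> and \<open>1 - t\<close> are not
  both non-positive; the quotient rises smoothly from 0 to 1 on the unit interval.\<close>

definition step :: "real \<Rightarrow> real" where
  "step t = flat 0 t * inverse (flat 0 t + flat 0 (1 - t))"

lemma Ck_affine: "open S \<Longrightarrow> Ck k S (\<lambda>t::real. a * t + b)"
  by (intro Ck_add Ck_mult Ck_const Ck_bounded_linear_id bounded_linear_ident)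

lemma Ck_step: "Ck k UNIV step"
proof -
  have "Ck k UNIV (\<lambda>t. flat 0 t * inverse (flat 0 t + flat 0 ((- 1) * t + 1)))"
    by (intro Ck_mult Ck_inverse Ck_add Ck_flat open_UNIV
        Ck_compose_real[OF open_UNIV Ck_flat Ck_affine[OF open_UNIV]])
      (auto simp: flat_def add_pos_pos less_imp_neq[symmetric])
  then show ?thesis
    by (simp add: step_def[abs_def])
qed

lemma step_eq_0: "t \<le> 0 \<Longrightarrow> step t = 0"
  by (simp add: step_def flat_def)

lemma step_eq_1: "t \<ge> 1 \<Longrightarrow> step t = 1"
  by (simp add: step_def flat_def)

lemma step_nonneg: "0 \<le> step t" and step_le_1: "step t \<le> 1"
  by (auto simp: step_def flat_def field_simps add_pos_pos)

lemma Ck_Suc_real_derivative: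
  fixes f :: "real \<Rightarrow> real"
  assumes "Ck (Suc k) S f" "x \<in> S"
  shows "(f has_real_derivative deriv f x) (at x)"
  using assms by (auto simp: DERIV_deriv_iff_real_differentiable)

lemma frechet_derivative_real:
  fixes f :: "real \<Rightarrow> real"
  assumes "f differentiable (at x)"
  shows "frechet_derivative f (at x) = (\<lambda>v. deriv f x * v)"
  using assms frechet_derivative_at[of f "\<lambda>v. deriv f x * v" x]
  by (auto simp: DERIV_deriv_iff_real_differentiable[symmetric] has_field_derivative_def)

lemma Ck_deriv:
  fixes f :: "real \<Rightarrow> real"
  assumes "open S" "Ck (Suc k) S f"
  shows "Ck k S (deriv f)"
proof (rule Ck_cong[OF assms(1)])
  show "frechet_derivative f (at x) 1 = deriv f x" if "x \<in> S" for x
    using assms that by (simp add: frechet_derivative_real)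
  show "Ck k S (\<lambda>x. frechet_derivative f (at x) 1)"
    using assms by simp
qed

lemma deriv_eq_0_open:
  fixes f :: "real \<Rightarrow> real"
  assumes "open S" "x \<in> S" "\<And>y. y \<in> S \<Longrightarrow> f y = c"
  shows "deriv f x = 0"
proof -
  have "(f has_real_derivative 0) (at x)"
    by (rule has_field_derivative_transform_within_open[of "\<lambda>t. c" _ _ S]) (use assms in auto)
  then show ?thesis
    by (rule DERIV_imp_deriv)
qed

lemma deriv_step_eq_0: "t < 0 \<or> t > 1 \<Longrightarrow> deriv step t = 0"
  using deriv_eq_0_open[of "{..<0}" t step 0] deriv_eq_0_open[of "{1<..}" t step 1]
  by (auto simp: step_eq_0 step_eq_1)

lemma deriv_step_bounded: obtains B where "B \<ge> 0" "\<And>t. \<bar>deriv step t\<bar> \<le> B"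
proof -
  have "continuous_on {0..1} (deriv step)"
    using Ck_imp_continuous_on[OF Ck_deriv[OF open_UNIV Ck_step[of "Suc 0"]]]
    by (rule continuous_on_subset) simp
  then have "bounded (deriv step ` {0..1})"
    by (intro compact_imp_bounded compact_continuous_image compact_Icc)
  then obtain B where "\<forall>t\<in>{0..1}. \<bar>deriv step t\<bar> \<le> B"
    unfolding bounded_iff by auto
  then have B: "\<bar>deriv step t\<bar> \<le> B" if "t \<in> {0..1}" for t
    using that by blast
  have "\<bar>deriv step t\<bar> \<le> B" for t
    using B[of t] B[of 0] deriv_step_eq_0[of t] by (cases "0 \<le> t \<and> t \<le> 1") auto
  moreover from this[of 0] have "B \<ge> 0"
    by linarith
  ultimately show thesis
    using that by blast
qed

text \<open>
  The factor \<open>k + 1\<close> from differentiating the cut-off is compensated by the zero of \<open>F\<close> at the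
  end point next to which the cut-off varies.
\<close>

lemma cutoff_approximation:
  fixes F :: "real \<Rightarrow> real"
  assumes "open S" "{0..e} \<subseteq> S" "0 < e" "\<And>k. Ck k S F" "F 0 = 0" "F e = 0"
  obtains h :: "nat \<Rightarrow> real \<Rightarrow> real" and C where
    "\<And>k j. Ck j UNIV (h k)"
    "\<And>k t. t \<notin> {1 / real (k + 1)..e - 1 / real (k + 1)} \<Longrightarrow> h k t = 0"
    "\<And>k t. \<bar>h k t\<bar> \<le> C" "\<And>k t. \<bar>deriv (h k) t\<bar> \<le> C"
    "\<And>t. 0 < t \<Longrightarrow> t < e \<Longrightarrow> \<forall>\<^sub>F k in sequentially. h k t = F t \<and> deriv (h k) t = deriv F t"
proof -
  obtain B where B: "B \<ge> 0" "\<And>t. \<bar>deriv step t\<bar> \<le> B"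
    using deriv_step_bounded by blast
  have "continuous_on {0..e} F" "continuous_on {0..e} (deriv F)"
    using Ck_imp_continuous_on[OF assms(4)] Ck_imp_continuous_on[OF Ck_deriv[OF assms(1,4)]]
      assms(2) continuous_on_subset by blast+
  then have "bounded (F ` {0..e})" "bounded (deriv F ` {0..e})"
    by (auto intro!: compact_imp_bounded compact_continuous_image)
  then obtain C1 C2 where "\<forall>t\<in>{0..e}. \<bar>F t\<bar> \<le> C1" "\<forall>t\<in>{0..e}. \<bar>deriv F t\<bar> \<le> C2"
    unfolding bounded_iff by auto
  then have C1: "\<bar>F t\<bar> \<le> C1" and C2: "\<bar>deriv F t\<bar> \<le> C2" if "t \<in> {0..e}" for t
    using that by blast+
  have C12: "0 \<le> C1" "0 \<le> C2"
    using C1[of 0] C2[of 0] assms(3) by force+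
  have dF: "(F has_real_derivative deriv F t) (at t)" if "t \<in> {0..e}" for t
    using Ck_Suc_real_derivative[OF assms(4)] assms(2) that by blast
  have lip: "\<bar>F x - F y\<bar> \<le> C2 * \<bar>x - y\<bar>" if "x \<in> {0..e}" "y \<in> {0..e}" for x y
    using field_differentiable_bound[of "{0..e}" F "deriv F" C2 x y]
      has_field_derivative_at_within[OF dF] C2 that
    by (simp add: abs_minus_commute convex_real_interval)
  \<comment> \<open>\<open>step (p k t)\<close> is 0 up to \<open>1 / (k + 1)\<close> and 1 from
    \<open>2 / (k + 1)\<close> on; \<open>q\<close> is the mirror image at \<open>e\<close>.\<close>
  define p where "p k t = real (k + 1) * t - 1" for k t
  define q where "q k t = real (k + 1) * (e - t) - 1" for k t
  define c where "c k t = step (p k t) * step (q k t)" for k t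
  define h where "h k t = c k t * F t" for k t
  have zero: "h k t = 0" if "t \<notin> {1 / real (k + 1)..e - 1 / real (k + 1)}" for k t
  proof -
    have "p k t \<le> 0 \<or> q k t \<le> 0"
      using that unfolding p_def q_def by (auto simp: field_simps)
    then show ?thesis
      by (auto simp: h_def c_def step_eq_0)
  qed
  have sub: "{1 / real (k + 1)..e - 1 / real (k + 1)} \<subseteq> {0..e}" for k
    by (auto intro: order_trans[of 0 "1 / (1 + real k)"] order_trans[of _ "e - 1 / (1 + real k)"])
  have pq: "Ck j UNIV (p k)" "Ck j UNIV (q k)" for j k
  proof -
    show "Ck j UNIV (p k)"
      using Ck_affine[OF open_UNIV, of j "real (k + 1)" "- 1"] by (simp add: p_def[abs_def])
    have "q k = (\<lambda>t. (- real (k + 1)) * t + (real (k + 1) * e - 1))"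
      by (auto simp: q_def algebra_simps)
    then show "Ck j UNIV (q k)"
      using Ck_affine[OF open_UNIV, of j "- real (k + 1)" "real (k + 1) * e - 1"] by simp
  qed
  have Ck_c: "Ck j UNIV (c k)" for j k
    unfolding c_def[abs_def] by (intro Ck_mult Ck_compose_real[OF open_UNIV Ck_step] pq) auto
  have Ck_h_S: "Ck j S (h k)" for j k
    unfolding h_def[abs_def] by (intro Ck_mult assms(1,4) Ck_subset[OF Ck_c]) auto
  have Ck_h: "Ck j UNIV (h k)" for j k
    by (rule Ck_extend_zero[OF assms(1) closed_atLeastAtMost subset_trans[OF sub assms(2)] Ck_h_S zero])
  have h_bound: "\<bar>h k t\<bar> \<le> C1" for k t
  proof (cases "t \<in> {0..e}")
    case True
    have "\<bar>c k t\<bar> \<le> 1"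
      unfolding c_def by (simp add: abs_mult step_nonneg step_le_1 mult_le_one)
    then show ?thesis
      using mult_mono[OF _ C1[OF True], of "\<bar>c k t\<bar>" 1] by (simp add: h_def abs_mult)
  next
    case False
    then have "t \<notin> {1 / real (k + 1)..e - 1 / real (k + 1)}"
      using sub by blast
    then show ?thesis
      using zero C12 by simp
  qed
  have dstep: "(step has_real_derivative deriv step t) (at t)" for t
    using Ck_Suc_real_derivative[OF Ck_step] by blast
  have dh: "(h k has_real_derivative
      (real (k + 1) * deriv step (p k t) * step (q k t) -
       step (p k t) * (real (k + 1) * deriv step (q k t))) * F t + c k t * deriv F t) (at t)"
    if "t \<in> {0..e}" for k t
    unfolding h_def[abs_def] c_def[abs_def] p_def q_def
    by (rule derivative_eq_intros dF[OF that] DERIV_chain2[OF dstep] refl)+ (simp add: algebra_simps)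
  have dh_bound: "\<bar>deriv (h k) t\<bar> \<le> 4 * B * C2 + C2" for k t
  proof (cases "t \<in> {0..e}")
    case True
    \<comment> \<open>Where the first cut-off varies, \<open>p k t \<le> 1\<close> means
      \<open>(k + 1) t \<le> 2\<close>, and \<open>F 0 = 0\<close> gives
      \<open>|F t| \<le> C2 t\<close>: the factor \<open>k + 1\<close> is absorbed. Elsewhere the
      derivative of \<open>step\<close> vanishes.\<close>
    have 1: "\<bar>real (k + 1) * deriv step (p k t) * F t\<bar> \<le> 2 * B * C2"
    proof (cases "p k t \<le> 1")
      case le: True
      have "\<bar>F t\<bar> \<le> C2 * t"
        using lip[of t 0] True assms by auto
      then have "\<bar>real (k + 1) * deriv step (p k t) * F t\<bar> \<le> real (k + 1) * B * (C2 * t)"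
        unfolding abs_mult by (intro mult_mono B) (use True C12 B in auto)
      also have "\<dots> = (real (k + 1) * t) * (B * C2)"
        by simp
      also have "\<dots> \<le> 2 * (B * C2)"
        by (intro mult_right_mono) (use le B C12 in \<open>auto simp: p_def\<close>)
      finally show ?thesis by simp
    qed (use deriv_step_eq_0 B C12 in simp)
    have 2: "\<bar>real (k + 1) * deriv step (q k t) * F t\<bar> \<le> 2 * B * C2"
    proof (cases "q k t \<le> 1")
      case le: True
      have "\<bar>F t\<bar> \<le> C2 * (e - t)"
        using lip[of t e] True assms by auto
      then have "\<bar>real (k + 1) * deriv step (q k t) * F t\<bar> \<le> real (k + 1) * B * (C2 * (e - t))"
        unfolding abs_mult by (intro mult_mono B) (use True C12 B in auto)
      also have "\<dots> = (real (k + 1) * (e - t)) * (B * C2)"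
        by simp
      also have "\<dots> \<le> 2 * (B * C2)"
        by (intro mult_right_mono) (use le B C12 in \<open>auto simp: q_def\<close>)
      finally show ?thesis by simp
    qed (use deriv_step_eq_0 B C12 in simp)
    have 3: "\<bar>x * step s\<bar> \<le> \<bar>x\<bar>" for x s
      by (simp add: abs_mult step_nonneg step_le_1 mult_left_le)
    have 4: "\<bar>c k t * deriv F t\<bar> \<le> C2"
      using 3[of "deriv F t * step (p k t)" "q k t"] 3[of "deriv F t" "p k t"] C2[OF True]
      by (simp add: c_def mult_ac)
    have "deriv (h k) t = real (k + 1) * deriv step (p k t) * F t * step (q k t) -
        real (k + 1) * deriv step (q k t) * F t * step (p k t) + c k t * deriv F t"
      using DERIV_imp_deriv[OF dh[OF True, of k]] by (simp add: algebra_simps)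
    then show ?thesis
      using 1 2 4 3[of "real (k + 1) * deriv step (p k t) * F t" "q k t"]
        3[of "real (k + 1) * deriv step (q k t) * F t" "p k t"] by linarith
  next
    case False
    have "deriv (h k) t = 0"
    proof (rule deriv_eq_0_open)
      show "open (- {1 / real (k + 1)..e - 1 / real (k + 1)})" by auto
      show "t \<in> - {1 / real (k + 1)..e - 1 / real (k + 1)}"
        using False sub by blast
    qed (use zero in auto)
    then show ?thesis
      using B C12 by simp
  qed
  have ev: "\<forall>\<^sub>F k in sequentially. h k t = F t \<and> deriv (h k) t = deriv F t"
    if t: "0 < t" "t < e" for t
  proof -
    have "\<forall>\<^sub>F k in sequentially. real k > max (2 / t) (2 / (e - t))"
      using filterlim_real_sequentially filterlim_at_top_dense[of real sequentially] by blast
    then show ?thesis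
    proof eventually_elim
      case (elim k)
      have "2 < real k * t" "2 < real k * (e - t)"
        using elim t by (auto simp: field_simps)
      then have pq1: "p k t > 1" "q k t > 1"
        unfolding p_def q_def of_nat_add distrib_right using t by simp_all
      then have "h k t = F t"
        by (simp add: h_def c_def step_eq_1)
      moreover have "deriv (h k) t = deriv F t"
        using DERIV_imp_deriv[OF dh, of t k] t pq1
        by (simp add: c_def deriv_step_eq_0 step_eq_1)
      ultimately show ?case by simp
    qed
  qed
  show thesis
    by (rule that[of h "max C1 (4 * B * C2 + C2)"])
      (use Ck_h zero h_bound dh_bound ev in \<open>auto simp: le_max_iff_disj\<close>)
qed

lemma Ck_powser:
  fixes c :: "nat \<Rightarrow> real"
  assumes "\<And>x. \<bar>x\<bar> < r \<Longrightarrow> summable (\<lambda>n. c n * x ^ n)"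
  shows "Ck k {-r<..<r} (\<lambda>x. \<Sum>n. c n * x ^ n)"
  using assms
proof (induction k arbitrary: c)
  have D: "((\<lambda>x. \<Sum>n. c n * x ^ n) has_real_derivative (\<Sum>n. diffs c n * x ^ n)) (at x)"
    if c: "\<And>x. \<bar>x\<bar> < r \<Longrightarrow> summable (\<lambda>n. c n * x ^ n)" and "x \<in> {-r<..<r}"
    for c :: "nat \<Rightarrow> real" and x
    by (rule termdiffs_strong'[of r]) (use that in auto)
  {
    case 0
    then show ?case
      by (auto intro!: continuous_at_imp_continuous_on DERIV_isCont D)
  next
    case (Suc k)
    show ?case
    proof (rule Ck_SucI)
      show "((\<lambda>x. \<Sum>n. c n * x ^ n) has_derivative (\<lambda>v. (\<Sum>n. diffs c n * x ^ n) * v)) (at x)"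
        if "x \<in> {-r<..<r}" for x
        using D[OF Suc.prems that] by (simp add: has_field_derivative_def)
      have "Ck k {-r<..<r} (\<lambda>x. \<Sum>n. diffs c n * x ^ n)"
        by (rule Suc.IH) (use termdiff_converges[of _ r c] Suc.prems in auto)
      then show "Ck k {-r<..<r} (\<lambda>x. (\<Sum>n. diffs c n * x ^ n) * v)" for v
        by (intro Ck_mult Ck_const) auto
    qed auto
  }
qed

section \<open>Square integrable functions\<close>

text \<open>The discriminant inequality behind both Cauchy-Schwarz inequalities below. The case
  \<open>c = 0\<close> is included because the \<open>L\<^sub>2\<close> form on functions, not on
  classes, and the energy form are only semidefinite. For \<open>c > 0\<close> the minimum is at
  \<open>t = - b / c\<close>.\<close>

lemma square_le_mult_of_quadratic:
  fixes a b c :: real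
  assumes "\<And>t. 0 \<le> a + 2 * t * b + t\<^sup>2 * c" "0 \<le> c"
  shows "b\<^sup>2 \<le> a * c"
proof (cases "c = 0")
  case True
  have "b = 0"
  proof (rule ccontr)
    assume "b \<noteq> 0"
    \<comment> \<open>With \<open>c = 0\<close> the chosen \<open>t\<close> gives the polynomial the
      value \<open>a - (a + 1) = - 1\<close>.\<close>
    then show False
      using assms(1)[of "- (a + 1) / (2 * b)"] True by (simp add: field_simps)
  qed
  then show ?thesis
    using True by simp
next
  case False
  have c: "c > 0"
    using False assms(2) by simp
  have "0 \<le> a + 2 * (- b / c) * b + (- b / c)\<^sup>2 * c"
    by (rule assms(1))
  also have "\<dots> = a - b\<^sup>2 / c"
    using c by (simp add: field_simps power2_eq_square)
  finally show ?thesis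
    using c by (simp add: field_simps)
qed

lemma L2_measurable: "u \<in> L2 \<Omega> \<Longrightarrow> u \<in> borel_measurable (lebesgue_on \<Omega>)"
  by (simp add: L2_def)

lemma L2_integrable_inner:
  assumes "u \<in> L2 \<Omega>" "v \<in> L2 \<Omega>"
  shows "integrable (lebesgue_on \<Omega>) (\<lambda>x. u x \<bullet> v x)"
proof (rule Bochner_Integration.integrable_bound)
  show "integrable (lebesgue_on \<Omega>) (\<lambda>x. (norm (u x))\<^sup>2 + (norm (v x))\<^sup>2)"
    using assms by (auto simp: L2_def)
  show "(\<lambda>x. u x \<bullet> v x) \<in> borel_measurable (lebesgue_on \<Omega>)"
    using assms by (intro borel_measurable_inner L2_measurable)
  show "AE x in lebesgue_on \<Omega>. norm (u x \<bullet> v x) \<le> norm ((norm (u x))\<^sup>2 + (norm (v x))\<^sup>2)"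
  proof (rule AE_I2)
    fix x
    have "norm (u x \<bullet> v x) \<le> norm (u x) * norm (v x)"
      using Cauchy_Schwarz_ineq2 by simp
    also have "\<dots> \<le> (norm (u x))\<^sup>2 + (norm (v x))\<^sup>2"
      using sum_squares_bound[of "norm (u x)" "norm (v x)"]
        mult_nonneg_nonneg[OF norm_ge_zero[of "u x"] norm_ge_zero[of "v x"]] by linarith
    finally show "norm (u x \<bullet> v x) \<le> norm ((norm (u x))\<^sup>2 + (norm (v x))\<^sup>2)" by simp
  qed
qed

lemma L2_add:
  assumes "u \<in> L2 \<Omega>" "v \<in> L2 \<Omega>"
  shows "(\<lambda>x. u x + v x) \<in> L2 \<Omega>"
proof -
  have "integrable (lebesgue_on \<Omega>) (\<lambda>x. (norm (u x))\<^sup>2 + 2 * (u x \<bullet> v x) + (norm (v x))\<^sup>2)"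
    using assms L2_integrable_inner[OF assms] by (auto simp: L2_def)
  moreover have "(norm (u x + v x))\<^sup>2 = (norm (u x))\<^sup>2 + 2 * (u x \<bullet> v x) + (norm (v x))\<^sup>2" for x
    by (simp add: power2_norm_eq_inner inner_add inner_commute)
  ultimately show ?thesis
    using assms by (auto simp: L2_def)
qed

lemma L2_scaleR:
  assumes "u \<in> L2 \<Omega>"
  shows "(\<lambda>x. c *\<^sub>R u x) \<in> L2 \<Omega>"
  using assms by (auto simp: L2_def power_mult_distrib)

lemma L2_zero: "(\<lambda>x. 0) \<in> L2 \<Omega>"
  by (simp add: L2_def)

lemma L2_minus: "u \<in> L2 \<Omega> \<Longrightarrow> (\<lambda>x. - u x) \<in> L2 \<Omega>"
  using L2_scaleR[of u \<Omega> "-1"] by simp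

lemma L2_diff: "u \<in> L2 \<Omega> \<Longrightarrow> v \<in> L2 \<Omega> \<Longrightarrow> (\<lambda>x. u x - v x) \<in> L2 \<Omega>"
  using L2_add[OF _ L2_minus, of u \<Omega> v] by simp

lemma L2_sum: "(\<And>i. i \<in> I \<Longrightarrow> u i \<in> L2 \<Omega>) \<Longrightarrow> (\<lambda>x. \<Sum>i\<in>I. u i x) \<in> L2 \<Omega>"
  by (induction I rule: infinite_finite_induct) (auto intro: L2_add L2_zero)

lemma L2_inner_commute: "L2_inner \<Omega> u v = L2_inner \<Omega> v u"
  by (simp add: L2_inner_def inner_commute)

lemma L2_inner_add_left:
  "u \<in> L2 \<Omega> \<Longrightarrow> v \<in> L2 \<Omega> \<Longrightarrow> w \<in> L2 \<Omega> \<Longrightarrow>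
   L2_inner \<Omega> (\<lambda>x. u x + v x) w = L2_inner \<Omega> u w + L2_inner \<Omega> v w"
  by (simp add: L2_inner_def inner_add_left L2_integrable_inner)

lemma L2_inner_diff_left:
  "u \<in> L2 \<Omega> \<Longrightarrow> v \<in> L2 \<Omega> \<Longrightarrow> w \<in> L2 \<Omega> \<Longrightarrow>
   L2_inner \<Omega> (\<lambda>x. u x - v x) w = L2_inner \<Omega> u w - L2_inner \<Omega> v w"
  by (simp add: L2_inner_def inner_diff_left L2_integrable_inner)

lemma L2_inner_scaleR_left: "L2_inner \<Omega> (\<lambda>x. c *\<^sub>R u x) v = c * L2_inner \<Omega> u v"
  by (simp add: L2_inner_def)

lemma L2_inner_minus_left: "L2_inner \<Omega> (\<lambda>x. - u x) v = - L2_inner \<Omega> u v"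
  by (simp add: L2_inner_def)

lemma L2_inner_sum_left:
  assumes "\<And>i. i \<in> I \<Longrightarrow> u i \<in> L2 \<Omega>" "w \<in> L2 \<Omega>"
  shows "L2_inner \<Omega> (\<lambda>x. \<Sum>i\<in>I. u i x) w = (\<Sum>i\<in>I. L2_inner \<Omega> (u i) w)"
  using assms by (simp add: L2_inner_def inner_sum_left L2_integrable_inner)

lemma L2_inner_add_right:
  "u \<in> L2 \<Omega> \<Longrightarrow> v \<in> L2 \<Omega> \<Longrightarrow> w \<in> L2 \<Omega> \<Longrightarrow>
   L2_inner \<Omega> w (\<lambda>x. u x + v x) = L2_inner \<Omega> w u + L2_inner \<Omega> w v"
  by (simp add: L2_inner_def inner_add_right L2_integrable_inner)

lemma L2_inner_diff_right:
  "u \<in> L2 \<Omega> \<Longrightarrow> v \<in> L2 \<Omega> \<Longrightarrow> w \<in> L2 \<Omega> \<Longrightarrow>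
   L2_inner \<Omega> w (\<lambda>x. u x - v x) = L2_inner \<Omega> w u - L2_inner \<Omega> w v"
  by (simp add: L2_inner_def inner_diff_right L2_integrable_inner)

lemma L2_inner_scaleR_right: "L2_inner \<Omega> u (\<lambda>x. c *\<^sub>R v x) = c * L2_inner \<Omega> u v"
  by (simp add: L2_inner_def)

lemma L2_inner_sum_right:
  assumes "\<And>i. i \<in> I \<Longrightarrow> u i \<in> L2 \<Omega>" "w \<in> L2 \<Omega>"
  shows "L2_inner \<Omega> w (\<lambda>x. \<Sum>i\<in>I. u i x) = (\<Sum>i\<in>I. L2_inner \<Omega> w (u i))"
  using assms by (simp add: L2_inner_def inner_sum_right L2_integrable_inner)

lemma L2_inner_cong_AE:
  assumes "AE x in lebesgue_on \<Omega>. u x = u' x" "AE x in lebesgue_on \<Omega>. v x = v' x"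
    "u \<in> L2 \<Omega>" "u' \<in> L2 \<Omega>" "v \<in> L2 \<Omega>" "v' \<in> L2 \<Omega>"
  shows "L2_inner \<Omega> u v = L2_inner \<Omega> u' v'"
  unfolding L2_inner_def
proof (rule integral_cong_AE)
  show "AE x in lebesgue_on \<Omega>. u x \<bullet> v x = u' x \<bullet> v' x"
    using assms(1,2) by eventually_elim simp
qed (use L2_integrable_inner assms in \<open>auto intro: borel_measurable_integrable\<close>)

lemma L2_inner_cong:
  assumes "\<And>x. x \<in> \<Omega> \<Longrightarrow> u x = u' x" "\<And>x. x \<in> \<Omega> \<Longrightarrow> v x = v' x"
  shows "L2_inner \<Omega> u v = L2_inner \<Omega> u' v'"
  unfolding L2_inner_def by (rule Bochner_Integration.integral_cong) (use assms in auto)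

lemma L2_inner_self_nonneg: "0 \<le> L2_inner \<Omega> u u"
  by (simp add: L2_inner_def)

lemma L2_norm_nonneg: "0 \<le> L2_norm \<Omega> u"
  by (simp add: L2_norm_def L2_inner_self_nonneg)

lemma L2_norm_power2: "(L2_norm \<Omega> u)\<^sup>2 = L2_inner \<Omega> u u"
  by (simp add: L2_norm_def L2_inner_self_nonneg)

lemma L2_norm_scaleR: "L2_norm \<Omega> (\<lambda>x. c *\<^sub>R u x) = \<bar>c\<bar> * L2_norm \<Omega> u"
  by (simp add: L2_norm_def L2_inner_scaleR_left L2_inner_scaleR_right real_sqrt_mult
      flip: mult.assoc power2_eq_square)

lemma L2_norm_minus_commute: "L2_norm \<Omega> (\<lambda>x. u x - v x) = L2_norm \<Omega> (\<lambda>x. v x - u x)"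
  using L2_norm_scaleR[of \<Omega> "-1" "\<lambda>x. u x - v x"] by simp

lemma L2_norm_eq_0_AE:
  assumes "u \<in> L2 \<Omega>" "L2_norm \<Omega> u = 0"
  shows "AE x in lebesgue_on \<Omega>. u x = 0"
proof -
  have "(LINT x|lebesgue_on \<Omega>. u x \<bullet> u x) = 0"
    using L2_norm_power2[of \<Omega> u] assms(2) by (simp add: L2_inner_def)
  then have "AE x in lebesgue_on \<Omega>. u x \<bullet> u x = 0"
    using integral_nonneg_eq_0_iff_AE[OF L2_integrable_inner[OF assms(1,1)]] by simp
  then show ?thesis by simp
qed

lemma L2_inner_quadratic:
  assumes "u \<in> L2 \<Omega>" "v \<in> L2 \<Omega>"
  shows "L2_inner \<Omega> (\<lambda>x. u x + t *\<^sub>R v x) (\<lambda>x. u x + t *\<^sub>R v x) =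
     L2_inner \<Omega> u u + 2 * t * L2_inner \<Omega> u v + t\<^sup>2 * L2_inner \<Omega> v v"
  using assms L2_inner_commute[of \<Omega> u v]
  by (simp add: L2_inner_add_left L2_inner_add_right L2_add L2_scaleR L2_inner_scaleR_left
      L2_inner_scaleR_right power2_eq_square algebra_simps)

lemma L2_Cauchy_Schwarz:
  assumes "u \<in> L2 \<Omega>" "v \<in> L2 \<Omega>"
  shows "\<bar>L2_inner \<Omega> u v\<bar> \<le> L2_norm \<Omega> u * L2_norm \<Omega> v"
proof -
  have "(L2_inner \<Omega> u v)\<^sup>2 \<le> L2_inner \<Omega> u u * L2_inner \<Omega> v v"
    by (rule square_le_mult_of_quadratic)
      (simp_all only: L2_inner_quadratic[OF assms, symmetric] L2_inner_self_nonneg)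
  then have "\<bar>L2_inner \<Omega> u v\<bar>\<^sup>2 \<le> (L2_norm \<Omega> u * L2_norm \<Omega> v)\<^sup>2"
    by (simp add: power_mult_distrib L2_norm_power2)
  then show ?thesis
    by (rule power2_le_imp_le) (simp add: L2_norm_nonneg)
qed

lemma L2_norm_triangle:
  assumes "u \<in> L2 \<Omega>" "v \<in> L2 \<Omega>"
  shows "L2_norm \<Omega> (\<lambda>x. u x + v x) \<le> L2_norm \<Omega> u + L2_norm \<Omega> v"
proof (rule power2_le_imp_le)
  have "(L2_norm \<Omega> (\<lambda>x. u x + v x))\<^sup>2 = L2_inner \<Omega> u u + 2 * L2_inner \<Omega> u v + L2_inner \<Omega> v v"
    using L2_inner_quadratic[OF assms, of 1] by (simp add: L2_norm_power2)
  also have "\<dots> \<le> (L2_norm \<Omega> u)\<^sup>2 + 2 * (L2_norm \<Omega> u * L2_norm \<Omega> v) + (L2_norm \<Omega> v)\<^sup>2"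
    using L2_Cauchy_Schwarz[OF assms] by (simp add: L2_norm_power2)
  also have "\<dots> = (L2_norm \<Omega> u + L2_norm \<Omega> v)\<^sup>2"
    by (simp add: power2_sum)
  finally show "(L2_norm \<Omega> (\<lambda>x. u x + v x))\<^sup>2 \<le> (L2_norm \<Omega> u + L2_norm \<Omega> v)\<^sup>2" .
qed (simp add: L2_norm_nonneg)

lemma L2_norm_diff_triangle:
  assumes "u \<in> L2 \<Omega>" "v \<in> L2 \<Omega>" "w \<in> L2 \<Omega>"
  shows "L2_norm \<Omega> (\<lambda>x. u x - w x) \<le> L2_norm \<Omega> (\<lambda>x. u x - v x) + L2_norm \<Omega> (\<lambda>x. v x - w x)"
  using L2_norm_triangle[OF L2_diff[OF assms(1,2)] L2_diff[OF assms(2,3)]] by simp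

lemma L2_inner_tendsto:
  assumes "\<And>k. u k \<in> L2 \<Omega>" "u' \<in> L2 \<Omega>" "\<And>k. v k \<in> L2 \<Omega>" "v' \<in> L2 \<Omega>"
    "(\<lambda>k. L2_norm \<Omega> (\<lambda>x. u k x - u' x)) \<longlonglongrightarrow> 0" "(\<lambda>k. L2_norm \<Omega> (\<lambda>x. v k x - v' x)) \<longlonglongrightarrow> 0"
  shows "(\<lambda>k. L2_inner \<Omega> (u k) (v k)) \<longlonglongrightarrow> L2_inner \<Omega> u' v'"
proof -
  let ?a = "\<lambda>k. L2_norm \<Omega> (\<lambda>x. u k x - u' x)" and ?b = "\<lambda>k. L2_norm \<Omega> (\<lambda>x. v k x - v' x)"
  have 1: "norm (L2_inner \<Omega> (u k) (v k) - L2_inner \<Omega> u' v') \<le>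
      ?a k * ?b k + ?a k * L2_norm \<Omega> v' + L2_norm \<Omega> u' * ?b k" for k
  proof -
    have [simp]: "(\<lambda>x. u k x - u' x) \<in> L2 \<Omega>" "(\<lambda>x. v k x - v' x) \<in> L2 \<Omega>"
      "u k \<in> L2 \<Omega>" "v k \<in> L2 \<Omega>" "u' \<in> L2 \<Omega>" "v' \<in> L2 \<Omega>"
      by (intro L2_diff assms)+
    have "L2_inner \<Omega> (u k) (v k) - L2_inner \<Omega> u' v' =
        L2_inner \<Omega> (\<lambda>x. u k x - u' x) (\<lambda>x. v k x - v' x) +
        L2_inner \<Omega> (\<lambda>x. u k x - u' x) v' + L2_inner \<Omega> u' (\<lambda>x. v k x - v' x)"
      by (simp add: L2_inner_diff_left L2_inner_diff_right)
    then show ?thesis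
      using L2_Cauchy_Schwarz[OF L2_diff[OF assms(1,2)] L2_diff[OF assms(3,4)], of k k]
        L2_Cauchy_Schwarz[OF L2_diff[OF assms(1,2)] assms(4), of k]
        L2_Cauchy_Schwarz[OF assms(2) L2_diff[OF assms(3,4)], of k]
      unfolding real_norm_def by linarith
  qed
  have "(\<lambda>k. ?a k * ?b k + ?a k * L2_norm \<Omega> v' + L2_norm \<Omega> u' * ?b k) \<longlonglongrightarrow>
      0 * 0 + 0 * L2_norm \<Omega> v' + L2_norm \<Omega> u' * 0"
    by (intro tendsto_add tendsto_mult tendsto_const assms)
  then have "(\<lambda>k. ?a k * ?b k + ?a k * L2_norm \<Omega> v' + L2_norm \<Omega> u' * ?b k) \<longlonglongrightarrow> 0"
    by simp
  then have "(\<lambda>k. L2_inner \<Omega> (u k) (v k) - L2_inner \<Omega> u' v') \<longlonglongrightarrow> 0"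
    by (rule Lim_null_comparison[rotated]) (intro always_eventually allI 1)
  then show ?thesis
    by (rule LIM_zero_cancel)
qed

lemma L2_inner_tendsto_left:
  assumes "\<And>k. u k \<in> L2 \<Omega>" "u' \<in> L2 \<Omega>" "v \<in> L2 \<Omega>"
    "(\<lambda>k. L2_norm \<Omega> (\<lambda>x. u k x - u' x)) \<longlonglongrightarrow> 0"
  shows "(\<lambda>k. L2_inner \<Omega> (u k) v) \<longlonglongrightarrow> L2_inner \<Omega> u' v"
proof -
  have "L2_norm \<Omega> (\<lambda>x. v x - v x) = 0"
    by (simp add: L2_norm_def L2_inner_def)
  then show ?thesis
    using assms by (intro L2_inner_tendsto) auto
qed

section \<open>Integrability of continuous functions\<close>

lemma integrable_continuous_compact_support:
  fixes f :: "'a::euclidean_space \<Rightarrow> 'b::euclidean_space"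
  assumes "continuous_on UNIV f" "compact K" "\<And>x. x \<notin> K \<Longrightarrow> f x = 0"
  shows "integrable lborel f"
proof -
  have "integrable lborel (\<lambda>x. indicator K x *\<^sub>R f x)"
    using assms by (intro borel_integrable_compact) (auto intro: continuous_on_subset)
  moreover have "(\<lambda>x. indicator K x *\<^sub>R f x) = f"
    using assms(3) by (auto simp: indicator_def)
  ultimately show ?thesis by simp
qed

lemma integrable_lebesgue_on:
  fixes f :: "'a::euclidean_space \<Rightarrow> 'b::euclidean_space"
  assumes "integrable lborel f" "\<Omega> \<in> sets lebesgue"
  shows "integrable (lebesgue_on \<Omega>) f"
  using assms
  by (simp add: integrable_restrict_space integrable_completion integrable_mult_indicator
      borel_measurable_integrable)

lemma integral_lebesgue_on_support:
  fixes f :: "'a::euclidean_space \<Rightarrow> 'b::euclidean_space"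
  assumes "f \<in> borel_measurable borel" "\<Omega> \<in> sets lebesgue" "\<And>x. x \<notin> \<Omega> \<Longrightarrow> f x = 0"
  shows "(LINT x|lebesgue_on \<Omega>. f x) = (LINT x|lborel. f x)"
proof -
  have "(\<lambda>x. indicator \<Omega> x *\<^sub>R f x) = f"
    using assms(3) by (auto simp: indicator_def)
  then show ?thesis
    using assms(1,2) by (simp add: integral_restrict_space integral_completion)
qed

lemma L2_continuous_compact_support:
  fixes f :: "real ^ 'n::finite \<Rightarrow> 'b::euclidean_space"
  assumes "continuous_on UNIV f" "compact K" "\<And>x. x \<notin> K \<Longrightarrow> f x = 0" "\<Omega> \<in> sets lebesgue"
  shows "f \<in> L2 \<Omega>"
proof -
  have "integrable lborel f"
    using assms by (intro integrable_continuous_compact_support) auto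
  moreover have "integrable lborel (\<lambda>x. (norm (f x))\<^sup>2)"
    by (rule integrable_continuous_compact_support[OF _ assms(2)])
      (use assms in \<open>auto intro!: continuous_intros\<close>)
  ultimately show ?thesis
    using integrable_lebesgue_on[OF _ assms(4), of "\<lambda>x. (norm (f x))\<^sup>2"]
      borel_measurable_integrable[OF integrable_lebesgue_on[OF _ assms(4), of f]]
    by (simp add: L2_def)
qed

lemma L2_bounded_continuous:
  fixes f :: "real ^ 'n::finite \<Rightarrow> 'b::euclidean_space"
  assumes "open \<Omega>" "bounded \<Omega>" "continuous_on \<Omega> f" "\<And>x. x \<in> \<Omega> \<Longrightarrow> norm (f x) \<le> C"
  shows "f \<in> L2 \<Omega>"
proof -
  have \<Omega>: "\<Omega> \<in> lmeasurable"
    using assms(1,2) by (simp add: lmeasurable_open)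
  have f: "f \<in> borel_measurable (lebesgue_on \<Omega>)"
    using assms(1,3) by (intro continuous_imp_measurable_on_sets_lebesgue) auto
  have "integrable (lebesgue_on \<Omega>) (\<lambda>x. C\<^sup>2)"
    by (intro finite_measure.integrable_const finite_measure_lebesgue_on \<Omega>)
  then have "integrable (lebesgue_on \<Omega>) (\<lambda>x. (norm (f x))\<^sup>2)"
    by (rule Bochner_Integration.integrable_bound)
      (use f assms(4) in \<open>auto intro!: AE_I2 power_mono\<close>)
  then show ?thesis
    using f by (simp add: L2_def)
qed

section \<open>Integration by parts\<close>

lemma integral_lborel_translation:
  fixes f :: "'a::euclidean_space \<Rightarrow> 'b::euclidean_space"
  assumes "f \<in> borel_measurable borel"
  shows "(LINT x|lborel. f (x + y)) = (LINT x|lborel. f x)"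
proof -
  have "(LINT x|lborel. f (y + x)) = (LINT x|distr lborel borel ((+) y). f x)"
    using assms by (intro integral_distr[symmetric]) auto
  then show ?thesis
    by (simp add: lborel_distr_plus add.commute)
qed

lemma integrable_lborel_translation:
  fixes f :: "'a::euclidean_space \<Rightarrow> 'b::euclidean_space"
  assumes "integrable lborel f"
  shows "integrable lborel (\<lambda>x. f (x + y))"
proof -
  have "integrable (distr lborel borel ((+) y)) f"
    using assms by (simp add: lborel_distr_plus)
  then show ?thesis
    by (subst (asm) integrable_distr_eq) (use assms in \<open>auto simp: add.commute\<close>)
qed

lemma bounded_continuous_compact_support:
  fixes f :: "'a::topological_space \<Rightarrow> 'b::real_normed_vector"
  assumes "continuous_on UNIV f" "compact K" "\<And>x. x \<notin> K \<Longrightarrow> f x = 0"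
  obtains B where "B \<ge> 0" "\<And>x. norm (f x) \<le> B"
proof -
  have "bounded (f ` K)"
    using assms by (intro compact_imp_bounded compact_continuous_image)
      (auto intro: continuous_on_subset)
  then obtain B where "\<forall>x\<in>K. norm (f x) \<le> B"
    unfolding bounded_iff by auto
  then have "norm (f x) \<le> max B 0" for x
    using assms(3)[of x] by (cases "x \<in> K") (auto simp: le_max_iff_disj)
  then show thesis
    using that[of "max B 0"] by auto
qed

lemma partial_eq_0:
  assumes "closed K" "\<And>x. x \<notin> K \<Longrightarrow> f x = 0" "x \<notin> K"
  shows "partial i f x = 0"
proof -
  have "partial i f x = partial i (\<lambda>x. 0) x"
    by (rule partial_cong_open[of "- K"]) (use assms in auto)
  then show ?thesis
    by (simp add: partial_def)
qed

lemma lipschitz_compact_support: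
  fixes f :: "real ^ 'n::finite \<Rightarrow> 'b::euclidean_space"
  assumes "Ck 1 UNIV f" "compact K" "\<And>x. x \<notin> K \<Longrightarrow> f x = 0"
  obtains B where "B \<ge> 0" "\<And>x y. norm (f x - f y) \<le> B * norm (x - y)"
proof -
  have "\<exists>B\<ge>0. \<forall>x. norm (partial i f x) \<le> B" for i
  proof -
    have "continuous_on UNIV (partial i f)"
      using assms(1) Ck_partial[of 0 UNIV f i] by simp
    then obtain B where "B \<ge> 0" "\<And>x. norm (partial i f x) \<le> B"
    proof (rule bounded_continuous_compact_support[of "partial i f" K])
      show "partial i f x = 0" if "x \<notin> K" for x
        by (rule partial_eq_0[OF compact_imp_closed[OF assms(2)] assms(3) that])
    qed (use assms(2) in auto)
    then show ?thesis
      by blast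
  qed
  then obtain B where B: "\<And>i. B i \<ge> 0" "\<And>i x. norm (partial i f x) \<le> B i"
    by metis
  have d: "(f has_derivative frechet_derivative f (at x)) (at x)" for x
    using Ck_SucD[of 0 UNIV f x] assms(1) by simp
  have "onorm (frechet_derivative f (at x)) \<le> (\<Sum>i\<in>UNIV. B i)" for x
  proof (rule onorm_le)
    fix v :: "real ^ 'n"
    have "f differentiable (at x)"
      using assms(1) by simp
    then have "norm (frechet_derivative f (at x) v) \<le> (\<Sum>i\<in>UNIV. norm (v $ i *\<^sub>R partial i f x))"
      by (simp only: frechet_derivative_partial norm_sum)
    also have "\<dots> \<le> (\<Sum>i\<in>UNIV. B i * norm v)"
      using component_le_norm_cart[of v] B
      by (intro sum_mono) (simp add: mult.commute[of "B _"] mult_mono)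
    finally show "norm (frechet_derivative f (at x) v) \<le> (\<Sum>i\<in>UNIV. B i) * norm v"
      by (simp add: sum_distrib_right)
  qed
  then have "norm (f x - f y) \<le> (\<Sum>i\<in>UNIV. B i) * norm (x - y)" for x y
    using d by (intro differentiable_bound[of UNIV f "\<lambda>x. frechet_derivative f (at x)"]) auto
  then show thesis
    using that[of "\<Sum>i\<in>UNIV. B i"] B by (simp add: sum_nonneg)
qed

text \<open>The steps \<open>y / (m + 1)\<close> have length at most \<open>norm y\<close>, so all
  difference quotients live on one ball and share the Lipschitz bound. This is the dominating
  function for both limits taken later, in integration by parts and in the translation
  estimate.\<close>

lemma difference_quotient_dominated:
  fixes f :: "real ^ 'n::finite \<Rightarrow> 'b::euclidean_space"
  assumes "Ck 1 UNIV f" "compact K" "\<And>x. x \<notin> K \<Longrightarrow> f x = 0"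
  obtains B R where "B \<ge> 0"
    "\<And>m x. norm (real (Suc m) *\<^sub>R (f (x + y /\<^sub>R real (Suc m)) - f x)) \<le> B * indicator (cball 0 R) x"
    "\<And>x. (\<lambda>m. real (Suc m) *\<^sub>R (f (x + y /\<^sub>R real (Suc m)) - f x)) \<longlonglongrightarrow>
       frechet_derivative f (at x) y"
proof -
  obtain L where L: "L \<ge> 0" "\<And>x y. norm (f x - f y) \<le> L * norm (x - y)"
    using lipschitz_compact_support[OF assms] by blast
  obtain R0 where R0: "\<And>x. x \<in> K \<Longrightarrow> norm x \<le> R0"
    using compact_imp_bounded[OF assms(2)] unfolding bounded_iff by auto
  have "norm (real (Suc m) *\<^sub>R (f (x + y /\<^sub>R real (Suc m)) - f x)) \<le>
      L * norm y * indicator (cball 0 (R0 + norm y)) x" for m x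
  proof (cases "norm x \<le> R0 + norm y")
    case True
    have "norm (f (x + y /\<^sub>R real (Suc m)) - f x) \<le> L * norm (y /\<^sub>R real (Suc m))"
      using L(2)[of "x + y /\<^sub>R real (Suc m)" x] by simp
    then have "real (Suc m) * norm (f (x + y /\<^sub>R real (Suc m)) - f x) \<le>
        real (Suc m) * (L * norm (y /\<^sub>R real (Suc m)))"
      by (intro mult_left_mono) auto
    also have "\<dots> = L * norm y"
      by (simp del: of_nat_Suc)
    finally show ?thesis
      using True by (simp del: of_nat_Suc)
  next
    case False
    have "norm (y /\<^sub>R real (Suc m)) \<le> norm y"
      by (simp add: divide_simps mult_right_mono)
        (metis le_add_same_cancel1 mult_nonneg_nonneg norm_ge_zero of_nat_0_le_iff
          distrib_left mult.right_neutral)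
    then have "norm (x + y /\<^sub>R real (Suc m)) > R0"
      using False norm_triangle_ineq4[of "x + y /\<^sub>R real (Suc m)" "y /\<^sub>R real (Suc m)"] by simp
    moreover have "norm x > R0"
      using False norm_ge_zero[of y] by linarith
    ultimately have "x + y /\<^sub>R real (Suc m) \<notin> K" "x \<notin> K"
      using R0 by force+
    then show ?thesis
      using assms(3) L by simp
  qed
  moreover have "(\<lambda>m. real (Suc m) *\<^sub>R (f (x + y /\<^sub>R real (Suc m)) - f x)) \<longlonglongrightarrow>
       frechet_derivative f (at x) y" for x
  proof -
    have d: "(f has_derivative frechet_derivative f (at x)) (at x)"
      using Ck_SucD[of 0 UNIV f x] assms(1) by simp
    have "((\<lambda>t. f (x + t *\<^sub>R y)) has_vector_derivative frechet_derivative f (at x) y) (at 0)"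
    proof -
      have "((\<lambda>t::real. x + t *\<^sub>R y) has_derivative (\<lambda>t. t *\<^sub>R y)) (at 0)"
        by (auto intro!: derivative_eq_intros)
      from has_derivative_compose[OF this, of f "frechet_derivative f (at x)"] d
      have "((\<lambda>t. f (x + t *\<^sub>R y)) has_derivative (\<lambda>t. frechet_derivative f (at x) (t *\<^sub>R y))) (at 0)"
        by simp
      then show ?thesis
        using linear_scale[OF has_derivative_linear[OF d]]
        by (simp add: has_vector_derivative_def)
    qed
    then have "((\<lambda>h. norm (f (x + h *\<^sub>R y) - f x - h *\<^sub>R frechet_derivative f (at x) y) / \<bar>h\<bar>) \<longlongrightarrow> 0) (at 0)"
      by (simp add: has_vector_derivative_def has_derivative_at)
    then have "((\<lambda>h. norm ((f (x + h *\<^sub>R y) - f x) /\<^sub>R h - frechet_derivative f (at x) y)) \<longlongrightarrow> 0) (at 0)"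
    proof (rule Lim_transform_eventually)
      have "norm (f (x + h *\<^sub>R y) - f x - h *\<^sub>R D) / \<bar>h\<bar> = norm ((f (x + h *\<^sub>R y) - f x) /\<^sub>R h - D)"
        if "h \<noteq> 0" for h D
      proof -
        have "(f (x + h *\<^sub>R y) - f x) /\<^sub>R h - D = (f (x + h *\<^sub>R y) - f x - h *\<^sub>R D) /\<^sub>R h"
          using that by (simp add: scaleR_diff_right)
        then show ?thesis
          by (simp add: divide_inverse)
      qed
      then show "\<forall>\<^sub>F h in at 0. norm (f (x + h *\<^sub>R y) - f x - h *\<^sub>R frechet_derivative f (at x) y) / \<bar>h\<bar> =
          norm ((f (x + h *\<^sub>R y) - f x) /\<^sub>R h - frechet_derivative f (at x) y)"
        by (auto simp: eventually_at_filter)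
    qed
    then have lim: "((\<lambda>h. (f (x + h *\<^sub>R y) - f x) /\<^sub>R h) \<longlongrightarrow> frechet_derivative f (at x) y) (at 0)"
      using LIM_zero_cancel tendsto_norm_zero_iff by blast
    show ?thesis
      using filterlim_compose[OF lim filterlim_atI[OF LIMSEQ_inverse_real_of_nat]]
      by simp
  qed
  ultimately show thesis
    using that[of "L * norm y" "R0 + norm y"] L by auto
qed


lemma integrable_indicator_cball:
  fixes x :: "'a::euclidean_space"
  shows "integrable lborel (\<lambda>y. c * indicator (cball x r) y :: real)"
  using emeasure_bounded_finite[OF bounded_cball, of x r]
  by (intro integrable_mult_right integrable_real_indicator) (auto simp: top.not_eq_extremum)

text \<open>
  The integral of a difference quotient vanishes by translation invariance, so no integration along
  lines is needed.
\<close>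

lemma integral_partial_eq_0:
  fixes f :: "real ^ 'n::finite \<Rightarrow> 'b::euclidean_space"
  assumes "Ck 1 UNIV f" "compact K" "\<And>x. x \<notin> K \<Longrightarrow> f x = 0"
  shows "(LINT x|lborel. partial i f x) = 0"
proof -
  obtain B R where B: "B \<ge> 0"
    "\<And>m x. norm (real (Suc m) *\<^sub>R (f (x + axis i 1 /\<^sub>R real (Suc m)) - f x)) \<le> B * indicator (cball 0 R) x"
    "\<And>x. (\<lambda>m. real (Suc m) *\<^sub>R (f (x + axis i 1 /\<^sub>R real (Suc m)) - f x)) \<longlonglongrightarrow>
       frechet_derivative f (at x) (axis i 1)"
    using difference_quotient_dominated[OF assms] by blast
  have cont: "continuous_on UNIV f"
    using Ck_imp_continuous_on assms(1) .
  then have meas [measurable]: "f \<in> borel_measurable borel"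
    by (rule borel_measurable_continuous_onI)
  have [measurable]: "partial i f \<in> borel_measurable borel"
    using assms(1) Ck_partial[of 0 UNIV f i] by (intro borel_measurable_continuous_onI) simp
  have int: "integrable lborel f"
    using integrable_continuous_compact_support[OF cont assms(2,3)] .
  have "(\<lambda>m. LINT x|lborel. real (Suc m) *\<^sub>R (f (x + axis i 1 /\<^sub>R real (Suc m)) - f x)) \<longlonglongrightarrow>
      (LINT x|lborel. partial i f x)"
  proof (rule integral_dominated_convergence)
    show "integrable lborel (\<lambda>x::real ^ 'n. B * indicator (cball 0 R) x)"
      by (rule integrable_indicator_cball)
    show "partial i f \<in> borel_measurable lborel"
      by simp
  qed (use B in \<open>auto simp: partial_def[symmetric]\<close>)
  moreover have "(LINT x|lborel. real (Suc m) *\<^sub>R (f (x + axis i 1 /\<^sub>R real (Suc m)) - f x)) = 0" for m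
    using integrable_lborel_translation[OF int] int integral_lborel_translation[OF meas]
    by (simp del: of_nat_Suc)
  ultimately have "(\<lambda>m::nat. 0) \<longlonglongrightarrow> (LINT x|lborel. partial i f x)"
    by simp
  then show ?thesis
    by (simp add: LIMSEQ_const_iff)
qed

lemma partial_bilinear:
  fixes f :: "real ^ 'n::finite \<Rightarrow> 'b::real_normed_vector" and g :: "real ^ 'n \<Rightarrow> 'c::real_normed_vector"
    and prod :: "'b \<Rightarrow> 'c \<Rightarrow> 'd::real_normed_vector"
  assumes "bounded_bilinear prod" "f differentiable (at x)" "g differentiable (at x)"
  shows "partial i (\<lambda>x. prod (f x) (g x)) x = prod (f x) (partial i g x) + prod (partial i f x) (g x)"
  unfolding partial_def[of i f] partial_def[of i g]
  by (rule partial_eqI[OF bounded_bilinear.FDERIV[OF assms(1)]])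
    (use assms frechet_derivative_works in auto)

text \<open>The support of \<open>f\<close> makes the product of class \<open>C^1\<close> on the
  whole space, although \<open>g\<close> is regular only on \<open>\<Omega>\<close>; then the
  integral of the partial derivative of the product vanishes. The bilinear product is left open
  because inner products, scalar multiples and real products are all needed.\<close>

lemma integration_by_parts:
  fixes f :: "real ^ 'n::finite \<Rightarrow> 'b::euclidean_space" and g :: "real ^ 'n \<Rightarrow> 'c::euclidean_space"
    and prod :: "'b \<Rightarrow> 'c \<Rightarrow> 'd::euclidean_space"
  assumes "bounded_bilinear prod" "open \<Omega>" "Ck 1 \<Omega> f" "Ck 1 \<Omega> g"
    and K: "compact K" "K \<subseteq> \<Omega>" "\<And>x. x \<notin> K \<Longrightarrow> f x = 0"
  shows "(LINT x|lebesgue_on \<Omega>. prod (partial i f x) (g x)) =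
    - (LINT x|lebesgue_on \<Omega>. prod (f x) (partial i g x))" (is "integral\<^sup>L _ ?l = - integral\<^sup>L _ ?r")
    and "integrable (lebesgue_on \<Omega>) (\<lambda>x. prod (partial i f x) (g x))"
    and "integrable (lebesgue_on \<Omega>) (\<lambda>x. prod (f x) (partial i g x))"
proof -
  note zero = bounded_bilinear.zero_left[OF assms(1)]
  have clK: "closed K"
    using K(1) by (rule compact_imp_closed)
  have f0: "partial i f x = 0" if "x \<notin> K" for x
    using partial_eq_0[OF clK K(3) that] .
  have "Ck 1 \<Omega> (\<lambda>x. prod (f x) (g x))"
    by (rule Ck_bilinear[OF assms(1-4)])
  then have C1: "Ck 1 UNIV (\<lambda>x. prod (f x) (g x))"
    by (rule Ck_extend_zero[OF assms(2) clK K(2)]) (use K zero in simp)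
  have c\<Omega>: "continuous_on \<Omega> f" "continuous_on \<Omega> g" "continuous_on \<Omega> (partial i f)" "continuous_on \<Omega> (partial i g)"
    by (rule Ck_imp_continuous_on[OF assms(3)] Ck_imp_continuous_on[OF assms(4)]
        Ck_imp_continuous_on[OF Ck_partial[OF assms(3)[unfolded One_nat_def]]]
        Ck_imp_continuous_on[OF Ck_partial[OF assms(4)[unfolded One_nat_def]]])+
  have "Ck 0 UNIV ?l"
    by (rule Ck_extend_zero[OF assms(2) clK K(2)])
      (use c\<Omega> f0 zero in \<open>auto intro: bounded_bilinear.continuous_on[OF assms(1)]\<close>)
  moreover have "Ck 0 UNIV ?r"
    by (rule Ck_extend_zero[OF assms(2) clK K(2)])
      (use c\<Omega> K zero in \<open>auto intro: bounded_bilinear.continuous_on[OF assms(1)]\<close>)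
  ultimately have cont: "continuous_on UNIV ?l" "continuous_on UNIV ?r"
    by simp_all
  have int: "integrable lborel ?l" "integrable lborel ?r"
    by (rule integrable_continuous_compact_support[OF cont(1) K(1)], use f0 zero in simp)
      (rule integrable_continuous_compact_support[OF cont(2) K(1)], use K zero in simp)
  have \<Omega>: "\<Omega> \<in> sets lebesgue"
    using assms(2) by simp
  show "integrable (lebesgue_on \<Omega>) ?l" "integrable (lebesgue_on \<Omega>) ?r"
    using int integrable_lebesgue_on \<Omega> by blast+
  have "partial i (\<lambda>x. prod (f x) (g x)) x = ?r x + ?l x" for x
  proof (cases "x \<in> \<Omega>")
    case True
    then show ?thesis
      using assms(3,4) by (intro partial_bilinear[OF assms(1)]) auto
  next
    case False
    then have "x \<notin> K"
      using K by auto
    moreover from this have "partial i (\<lambda>x. prod (f x) (g x)) x = 0"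
      by (intro partial_eq_0[OF clK]) (use K zero in auto)
    ultimately show ?thesis
      using K f0 zero by simp
  qed
  then have "(LINT x|lborel. ?r x + ?l x) = 0"
    using integral_partial_eq_0[OF C1 K(1), of i] K zero by simp
  then have "(LINT x|lborel. ?l x) = - (LINT x|lborel. ?r x)"
    using int by (simp add: eq_neg_iff_add_eq_0 add.commute)
  moreover have "(LINT x|lebesgue_on \<Omega>. ?l x) = (LINT x|lborel. ?l x)"
      "(LINT x|lebesgue_on \<Omega>. ?r x) = (LINT x|lborel. ?r x)"
    by (rule integral_lebesgue_on_support[OF _ \<Omega>];
        use int f0 K zero in \<open>force intro: borel_measurable_integrable\<close>)+
  ultimately show "integral\<^sup>L (lebesgue_on \<Omega>) ?l = - integral\<^sup>L (lebesgue_on \<Omega>) ?r"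
    by simp
qed

section \<open>The Dirichlet form and weak eigenpairs\<close>

lemma test_functions_Ck:
  fixes \<phi> :: "real ^ 'n::finite \<Rightarrow> 'b::real_normed_vector"
  shows "\<phi> \<in> test_functions \<Omega> \<Longrightarrow> Ck k S \<phi>"
  by (rule Ck_subset[OF smooth_imp_Ck]) (auto simp: test_functions_def)

lemma test_functions_differentiable:
  fixes \<phi> :: "real ^ 'n::finite \<Rightarrow> 'b::real_normed_vector"
  shows "\<phi> \<in> test_functions \<Omega> \<Longrightarrow> \<phi> differentiable (at x)"
  using test_functions_Ck[of \<phi> \<Omega> "Suc 0" UNIV] by simp

lemma test_functions_partial:
  fixes \<phi> :: "real ^ 'n::finite \<Rightarrow> 'b::real_normed_vector"
  assumes "\<phi> \<in> test_functions \<Omega>"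
  shows "partial i \<phi> \<in> test_functions \<Omega>"
proof -
  obtain K where K: "\<And>k. Ck k UNIV \<phi>" "compact K" "K \<subseteq> \<Omega>" "\<And>x. x \<notin> K \<Longrightarrow> \<phi> x = 0"
    using assms by (rule test_functionsE) blast
  show ?thesis
    by (rule test_functionsI[OF Ck_partial[OF K(1)] K(2,3)])
      (rule partial_eq_0[OF compact_imp_closed[OF K(2)] K(4)])
qed

lemma test_functions_partials:
  fixes \<phi> :: "real ^ 'n::finite \<Rightarrow> 'b::real_normed_vector"
  shows "\<phi> \<in> test_functions \<Omega> \<Longrightarrow> partials is \<phi> \<in> test_functions \<Omega>"
  by (induction "is") (auto intro: test_functions_partial)

lemma test_functions_add_scaleR:
  fixes \<phi> :: "real ^ 'n::finite \<Rightarrow> 'b::real_normed_vector"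
  assumes "\<phi> \<in> test_functions \<Omega>" "\<psi> \<in> test_functions \<Omega>"
  shows "(\<lambda>x. \<phi> x + t *\<^sub>R \<psi> x) \<in> test_functions \<Omega>"
proof -
  obtain K where K: "\<And>k. Ck k UNIV \<phi>" "compact K" "K \<subseteq> \<Omega>" "\<And>x. x \<notin> K \<Longrightarrow> \<phi> x = 0"
    using assms(1) by (rule test_functionsE) blast
  obtain K' where K': "\<And>k. Ck k UNIV \<psi>" "compact K'" "K' \<subseteq> \<Omega>" "\<And>x. x \<notin> K' \<Longrightarrow> \<psi> x = 0"
    using assms(2) by (rule test_functionsE) blast
  show ?thesis
    by (rule test_functionsI[of _ "K \<union> K'"]) (use K K' in \<open>auto intro!: Ck_add Ck_scaleR Ck_const\<close>)
qed

lemma test_functions_diff: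
  fixes \<phi> :: "real ^ 'n::finite \<Rightarrow> 'b::real_normed_vector"
  shows "\<phi> \<in> test_functions \<Omega> \<Longrightarrow> \<psi> \<in> test_functions \<Omega> \<Longrightarrow> (\<lambda>x. \<phi> x - \<psi> x) \<in> test_functions \<Omega>"
  using test_functions_add_scaleR[of \<phi> \<Omega> \<psi> "-1"] by simp

lemma test_functions_inner:
  fixes \<phi> :: "real ^ 'n::finite \<Rightarrow> 'b::real_inner"
  assumes "\<phi> \<in> test_functions \<Omega>"
  shows "(\<lambda>x. \<phi> x \<bullet> b) \<in> test_functions \<Omega>"
proof -
  obtain K where K: "\<And>k. Ck k UNIV \<phi>" "compact K" "K \<subseteq> \<Omega>" "\<And>x. x \<notin> K \<Longrightarrow> \<phi> x = 0"
    using assms by (rule test_functionsE) blast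
  show ?thesis
    by (rule test_functionsI[of _ K]) (use K in \<open>auto intro!: Ck_inner Ck_const\<close>)
qed

lemma test_functions_L2:
  fixes \<phi> :: "real ^ 'n::finite \<Rightarrow> 'b::euclidean_space"
  assumes "open \<Omega>" "\<phi> \<in> test_functions \<Omega>"
  shows "\<phi> \<in> L2 \<Omega>"
proof -
  obtain K where K: "\<And>k. Ck k UNIV \<phi>" "compact K" "K \<subseteq> \<Omega>" "\<And>x. x \<notin> K \<Longrightarrow> \<phi> x = 0"
    using assms(2) by (rule test_functionsE) blast
  show ?thesis
    by (rule L2_continuous_compact_support[OF Ck_imp_continuous_on[OF K(1)] K(2,4)])
      (use assms(1) in auto)
qed

lemma partial_add_scaleR:
  fixes f g :: "real ^ 'n::finite \<Rightarrow> 'b::real_normed_vector"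
  assumes "f differentiable (at x)" "g differentiable (at x)"
  shows "partial i (\<lambda>x. f x + t *\<^sub>R g x) x = partial i f x + t *\<^sub>R partial i g x"
  unfolding partial_def[of i f] partial_def[of i g]
  by (rule partial_eqI) (use assms frechet_derivative_works in \<open>auto intro!: derivative_eq_intros\<close>)

lemma partial_diff:
  fixes f g :: "real ^ 'n::finite \<Rightarrow> 'b::real_normed_vector"
  assumes "f differentiable (at x)" "g differentiable (at x)"
  shows "partial i (\<lambda>x. f x - g x) x = partial i f x - partial i g x"
  using partial_add_scaleR[OF assms, of i "-1"] by simp

lemma partial_inner_const:
  fixes f :: "real ^ 'n::finite \<Rightarrow> 'b::real_inner"
  assumes "f differentiable (at x)"
  shows "partial i (\<lambda>x. f x \<bullet> b) x = partial i f x \<bullet> b"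
  unfolding partial_def[of i f]
  by (rule partial_eqI[OF bounded_linear.has_derivative[OF bounded_linear_inner_left]])
    (use assms frechet_derivative_works in auto)

lemma L2_inner_partial:
  fixes \<phi> \<psi> :: "real ^ 'n::finite \<Rightarrow> 'b::euclidean_space"
  assumes "open \<Omega>" "\<phi> \<in> test_functions \<Omega>" "\<psi> \<in> test_functions \<Omega>"
  shows "L2_inner \<Omega> (partial i \<phi>) \<psi> = - L2_inner \<Omega> \<phi> (partial i \<psi>)"
proof -
  obtain K where K: "\<And>k. Ck k UNIV \<phi>" "compact K" "K \<subseteq> \<Omega>" "\<And>x. x \<notin> K \<Longrightarrow> \<phi> x = 0"
    using assms(2) by (rule test_functionsE) blast
  show ?thesis
    unfolding L2_inner_def
    by (rule integration_by_parts[OF bounded_bilinear_inner assms(1) test_functions_Ck[OF assms(2)]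
          test_functions_Ck[OF assms(3)] K(2-4)])
qed

text \<open>Classical derivatives suffice, since the form is evaluated only at test functions; their
  limits are handled through \<open>energy_approx\<close>.\<close>

definition dirichlet ::
  "(real ^ 'n::finite) set \<Rightarrow> (real ^ 'n \<Rightarrow> 'b::euclidean_space) \<Rightarrow> (real ^ 'n \<Rightarrow> 'b) \<Rightarrow> real" where
  "dirichlet \<Omega> \<phi> \<psi> = (\<Sum>i\<in>UNIV. L2_inner \<Omega> (partial i \<phi>) (partial i \<psi>))"

lemma laplacian_L2:
  fixes \<phi> :: "real ^ 'n::finite \<Rightarrow> 'b::euclidean_space"
  assumes "open \<Omega>" "\<phi> \<in> test_functions \<Omega>"
  shows "(\<lambda>x. - laplacian \<phi> x) \<in> L2 \<Omega>"
  unfolding laplacian_def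
  by (intro L2_minus L2_sum test_functions_L2 assms test_functions_partials)

lemma L2_inner_laplacian:
  fixes \<phi> \<psi> :: "real ^ 'n::finite \<Rightarrow> 'b::euclidean_space"
  assumes "open \<Omega>" "\<phi> \<in> test_functions \<Omega>" "\<psi> \<in> test_functions \<Omega>"
  shows "L2_inner \<Omega> (\<lambda>x. - laplacian \<phi> x) \<psi> = dirichlet \<Omega> \<phi> \<psi>"
proof -
  have "L2_inner \<Omega> (\<lambda>x. - laplacian \<phi> x) \<psi> = - (\<Sum>i\<in>UNIV. L2_inner \<Omega> (partials [i, i] \<phi>) \<psi>)"
    unfolding laplacian_def L2_inner_minus_left
    by (subst L2_inner_sum_left) (intro refl test_functions_L2 assms test_functions_partials)+
  also have "\<dots> = dirichlet \<Omega> \<phi> \<psi>"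
    unfolding dirichlet_def
    by (simp add: L2_inner_partial[OF assms(1) test_functions_partial[OF assms(2)] assms(3)]
        sum_negf)
  finally show ?thesis .
qed

lemma dirichlet_commute: "dirichlet \<Omega> \<phi> \<psi> = dirichlet \<Omega> \<psi> \<phi>"
  by (simp add: dirichlet_def L2_inner_commute)

lemma dirichlet_nonneg: "0 \<le> dirichlet \<Omega> \<phi> \<phi>"
  by (simp add: dirichlet_def L2_inner_self_nonneg sum_nonneg)

lemma dirichlet_quadratic:
  fixes \<phi> \<psi> :: "real ^ 'n::finite \<Rightarrow> 'b::euclidean_space"
  assumes "open \<Omega>" "\<phi> \<in> test_functions \<Omega>" "\<psi> \<in> test_functions \<Omega>"
  shows "dirichlet \<Omega> (\<lambda>x. \<phi> x + t *\<^sub>R \<psi> x) (\<lambda>x. \<phi> x + t *\<^sub>R \<psi> x) =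
     dirichlet \<Omega> \<phi> \<phi> + 2 * t * dirichlet \<Omega> \<phi> \<psi> + t\<^sup>2 * dirichlet \<Omega> \<psi> \<psi>"
proof -
  have "partial i (\<lambda>x. \<phi> x + t *\<^sub>R \<psi> x) = (\<lambda>x. partial i \<phi> x + t *\<^sub>R partial i \<psi> x)" for i
    using partial_add_scaleR[OF test_functions_differentiable[OF assms(2)]
        test_functions_differentiable[OF assms(3)]] by blast
  then show ?thesis
    unfolding dirichlet_def
    by (simp add: L2_inner_quadratic test_functions_L2 test_functions_partial assms sum.distrib
        sum_distrib_left)
qed

lemma dirichlet_diff_right:
  fixes \<phi> \<psi> \<eta> :: "real ^ 'n::finite \<Rightarrow> 'b::euclidean_space"
  assumes "open \<Omega>" "\<phi> \<in> test_functions \<Omega>" "\<psi> \<in> test_functions \<Omega>" "\<eta> \<in> test_functions \<Omega>"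
  shows "dirichlet \<Omega> \<phi> (\<lambda>x. \<psi> x - \<eta> x) = dirichlet \<Omega> \<phi> \<psi> - dirichlet \<Omega> \<phi> \<eta>"
proof -
  have "partial i (\<lambda>x. \<psi> x - \<eta> x) = (\<lambda>x. partial i \<psi> x - partial i \<eta> x)" for i
    using partial_diff[OF test_functions_differentiable[OF assms(3)]
        test_functions_differentiable[OF assms(4)]] by blast
  then show ?thesis
    unfolding dirichlet_def
    by (simp add: L2_inner_diff_right test_functions_L2 test_functions_partial assms sum_subtractf)
qed

lemma dirichlet_Cauchy_Schwarz:
  fixes \<phi> \<psi> :: "real ^ 'n::finite \<Rightarrow> 'b::euclidean_space"
  assumes "open \<Omega>" "\<phi> \<in> test_functions \<Omega>" "\<psi> \<in> test_functions \<Omega>"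
  shows "(dirichlet \<Omega> \<phi> \<psi>)\<^sup>2 \<le> dirichlet \<Omega> \<phi> \<phi> * dirichlet \<Omega> \<psi> \<psi>"
  by (rule square_le_mult_of_quadratic)
    (simp_all only: dirichlet_quadratic[OF assms, symmetric] dirichlet_nonneg)

text \<open>The parallelogram identity for \<open>\<phi> - \<psi>\<close> and \<open>\<psi>\<close>,
  with the energy of \<open>\<phi> - 2 \<psi>\<close> dropped.\<close>

lemma dirichlet_le_add_diff:
  fixes \<phi> \<psi> :: "real ^ 'n::finite \<Rightarrow> 'b::euclidean_space"
  assumes "open \<Omega>" "\<phi> \<in> test_functions \<Omega>" "\<psi> \<in> test_functions \<Omega>"
  shows "dirichlet \<Omega> \<phi> \<phi> \<le> 2 * dirichlet \<Omega> \<psi> \<psi> + 2 * dirichlet \<Omega> (\<lambda>x. \<phi> x - \<psi> x) (\<lambda>x. \<phi> x - \<psi> x)"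
  using dirichlet_quadratic[OF assms(1) test_functions_diff[OF assms(2,3)] assms(3), of 1]
    dirichlet_quadratic[OF assms(1) test_functions_diff[OF assms(2,3)] assms(3), of "-1"]
    dirichlet_nonneg[of \<Omega> "\<lambda>x. \<phi> x - \<psi> x + (-1) *\<^sub>R \<psi> x"]
  by simp

text \<open>Asking for the Cauchy property of the energy avoids naming a gradient of the limit
  \<open>u\<close>. The class \<open>\<D>\<close> will be all test functions for the Laplace
  operator and the solenoidal ones for the Stokes operator.\<close>

definition energy_approx ::
  "(real ^ 'n::finite) set \<Rightarrow> (real ^ 'n \<Rightarrow> 'b::euclidean_space) set \<Rightarrow>
   (nat \<Rightarrow> real ^ 'n \<Rightarrow> 'b) \<Rightarrow> (real ^ 'n \<Rightarrow> 'b) \<Rightarrow> bool" where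
  "energy_approx \<Omega> \<D> \<phi> u \<longleftrightarrow>
     (\<forall>k. \<phi> k \<in> \<D>) \<and> (\<lambda>k. L2_norm \<Omega> (\<lambda>x. \<phi> k x - u x)) \<longlonglongrightarrow> 0 \<and>
     (\<forall>e>0. \<exists>N. \<forall>k\<ge>N. \<forall>m\<ge>N. dirichlet \<Omega> (\<lambda>x. \<phi> k x - \<phi> m x) (\<lambda>x. \<phi> k x - \<phi> m x) < e)"

text \<open>The Laplacian stands on the test function, so \<open>u\<close> needs no derivatives. For
  solenoidal \<open>\<D>\<close> this is the equation without pressure, since gradients are
  orthogonal to \<open>\<D>\<close>.\<close>

definition weak_eigenpair ::
  "(real ^ 'n::finite) set \<Rightarrow> (real ^ 'n \<Rightarrow> 'b::euclidean_space) set \<Rightarrow> real \<Rightarrow> (real ^ 'n \<Rightarrow> 'b) \<Rightarrow> bool"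
where
  "weak_eigenpair \<Omega> \<D> l u \<longleftrightarrow>
     u \<in> L2 \<Omega> \<and> \<not> (AE x in lebesgue_on \<Omega>. u x = 0) \<and>
     (\<forall>\<phi>\<in>\<D>. L2_inner \<Omega> (\<lambda>x. - laplacian \<phi> x) u = l * L2_inner \<Omega> \<phi> u) \<and>
     (\<exists>\<phi>. energy_approx \<Omega> \<D> \<phi> u)"

text \<open>For fixed \<open>k\<close> the form at \<open>\<phi> k\<close> and
  \<open>\<psi> m\<close> equals
  \<open>\<langle>- \<Delta> \<phi>\<^sub>k, \<psi>\<^sub>m\<rangle>\<close> and tends to
  \<open>l \<langle>\<phi>\<^sub>k, v\<rangle>\<close> as \<open>m\<close> grows. Bounded energy of
  \<open>\<phi>\<close> and the Cauchy property of \<open>\<psi>\<close> make this uniform in late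
  \<open>k\<close>, so the diagonal has the same limit as the iterated one.\<close>

lemma dirichlet_tendsto:
  fixes u v :: "real ^ 'n::finite \<Rightarrow> 'b::euclidean_space"
  assumes "open \<Omega>" "\<D> \<subseteq> test_functions \<Omega>" "u \<in> L2 \<Omega>" "v \<in> L2 \<Omega>"
    and \<phi>: "energy_approx \<Omega> \<D> \<phi> u" and \<psi>: "energy_approx \<Omega> \<D> \<psi> v"
    and v: "\<And>\<phi>. \<phi> \<in> \<D> \<Longrightarrow> L2_inner \<Omega> (\<lambda>x. - laplacian \<phi> x) v = l * L2_inner \<Omega> \<phi> v"
  shows "(\<lambda>k. dirichlet \<Omega> (\<phi> k) (\<psi> k)) \<longlonglongrightarrow> l * L2_inner \<Omega> u v"
proof -
  have test: "\<phi> k \<in> test_functions \<Omega>" "\<psi> k \<in> test_functions \<Omega>" "\<phi> k \<in> \<D>" for k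
    using \<phi> \<psi> assms(2) by (auto simp: energy_approx_def)
  note L2 = test_functions_L2[OF assms(1) test(1)] test_functions_L2[OF assms(1) test(2)]
  let ?E = "\<lambda>\<eta>. dirichlet \<Omega> \<eta> \<eta>"
  obtain N0 where N0: "\<And>k m. k \<ge> N0 \<Longrightarrow> m \<ge> N0 \<Longrightarrow> ?E (\<lambda>x. \<phi> k x - \<phi> m x) < 1"
    using \<phi> unfolding energy_approx_def by (metis zero_less_one)
  \<comment> \<open>Late members of \<open>\<phi>\<close> differ from \<open>\<phi> N0\<close> by
    energy less than 1, which bounds their energies by twice that of \<open>\<phi> N0\<close> plus
    2.\<close>
  define B where "B = 2 * ?E (\<phi> N0) + 2"
  have B: "?E (\<phi> k) \<le> B" if "k \<ge> N0" for k
    using dirichlet_le_add_diff[OF assms(1) test(1,1), of k N0] N0[OF that order_refl]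
    by (simp add: B_def)
  have "B > 0"
    using dirichlet_nonneg[of \<Omega> "\<phi> N0"] by (simp add: B_def)
  have "(\<lambda>k. dirichlet \<Omega> (\<phi> k) (\<psi> k) - l * L2_inner \<Omega> (\<phi> k) v) \<longlonglongrightarrow> 0"
  proof (rule LIMSEQ_I)
    fix r :: real assume "r > 0"
    \<comment> \<open>Chosen so that the Cauchy-Schwarz bound \<open>B * e\<close> is the square of
      \<open>r / 2\<close>.\<close>
    define e where "e = r\<^sup>2 / (4 * B)"
    have "e > 0"
      using \<open>r > 0\<close> \<open>B > 0\<close> by (simp add: e_def)
    then obtain N where N: "\<And>k m. k \<ge> N \<Longrightarrow> m \<ge> N \<Longrightarrow> ?E (\<lambda>x. \<psi> k x - \<psi> m x) < e"
      using \<psi> unfolding energy_approx_def by metis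
    have "norm (dirichlet \<Omega> (\<phi> k) (\<psi> k) - l * L2_inner \<Omega> (\<phi> k) v - 0) < r" if k: "k \<ge> max N N0" for k
    proof -
      have "\<bar>dirichlet \<Omega> (\<phi> k) (\<psi> k) - dirichlet \<Omega> (\<phi> k) (\<psi> m)\<bar> \<le> r / 2" if m: "m \<ge> N" for m
      proof (rule power2_le_imp_le)
        have "(dirichlet \<Omega> (\<phi> k) (\<lambda>x. \<psi> k x - \<psi> m x))\<^sup>2 \<le> ?E (\<phi> k) * ?E (\<lambda>x. \<psi> k x - \<psi> m x)"
          by (intro dirichlet_Cauchy_Schwarz assms(1) test test_functions_diff)
        also have "\<dots> \<le> B * e"
          using B[of k] N[of k m] k m dirichlet_nonneg \<open>B > 0\<close> by (intro mult_mono) auto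
        also have "\<dots> = (r / 2)\<^sup>2"
          using \<open>B > 0\<close> by (simp add: e_def power2_eq_square)
        finally show "\<bar>dirichlet \<Omega> (\<phi> k) (\<psi> k) - dirichlet \<Omega> (\<phi> k) (\<psi> m)\<bar>\<^sup>2 \<le> (r / 2)\<^sup>2"
          by (simp add: dirichlet_diff_right[OF assms(1) test(1) test(2) test(2)])
      qed (use \<open>r > 0\<close> in simp)
      moreover have "(\<lambda>m. \<bar>dirichlet \<Omega> (\<phi> k) (\<psi> k) - dirichlet \<Omega> (\<phi> k) (\<psi> m)\<bar>) \<longlonglongrightarrow>
          \<bar>dirichlet \<Omega> (\<phi> k) (\<psi> k) - l * L2_inner \<Omega> (\<phi> k) v\<bar>"
      proof (intro tendsto_rabs tendsto_diff tendsto_const)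
        have "(\<lambda>m. L2_inner \<Omega> (\<psi> m) (\<lambda>x. - laplacian (\<phi> k) x)) \<longlonglongrightarrow> L2_inner \<Omega> v (\<lambda>x. - laplacian (\<phi> k) x)"
          using \<psi> by (intro L2_inner_tendsto_left L2 assms(4) laplacian_L2[OF assms(1) test(1)])
            (simp add: energy_approx_def)
        then show "(\<lambda>m. dirichlet \<Omega> (\<phi> k) (\<psi> m)) \<longlonglongrightarrow> l * L2_inner \<Omega> (\<phi> k) v"
          using v[OF test(3)[of k]]
          by (simp add: L2_inner_laplacian[OF assms(1) test(1,2)]
              L2_inner_commute[of \<Omega> _ "\<lambda>x. - laplacian (\<phi> k) x"])
      qed
      ultimately have "\<bar>dirichlet \<Omega> (\<phi> k) (\<psi> k) - l * L2_inner \<Omega> (\<phi> k) v\<bar> \<le> r / 2"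
        by (intro LIMSEQ_le_const2[where X = "\<lambda>m. \<bar>dirichlet \<Omega> (\<phi> k) (\<psi> k) - dirichlet \<Omega> (\<phi> k) (\<psi> m)\<bar>"]) blast+
      then show ?thesis
        using \<open>r > 0\<close> by simp
    qed
    then show "\<exists>no. \<forall>k\<ge>no. norm (dirichlet \<Omega> (\<phi> k) (\<psi> k) - l * L2_inner \<Omega> (\<phi> k) v - 0) < r"
      by blast
  qed
  moreover have "(\<lambda>k. l * L2_inner \<Omega> (\<phi> k) v) \<longlonglongrightarrow> l * L2_inner \<Omega> u v"
    using \<phi> by (intro tendsto_mult_left L2_inner_tendsto_left L2 assms)
      (simp add: energy_approx_def)
  ultimately show ?thesis
    using tendsto_add[of "\<lambda>k. dirichlet \<Omega> (\<phi> k) (\<psi> k) - l * L2_inner \<Omega> (\<phi> k) v" 0 sequentially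
        "\<lambda>k. l * L2_inner \<Omega> (\<phi> k) v"] by simp
qed

text \<open>The symmetric form along both approximations has one limit, which is \<open>l'\<close>
  times the inner product by the equation for \<open>u'\<close> and \<open>l\<close> times it by the
  equation for \<open>u\<close>.\<close>

lemma weak_eigenpair_orthogonal:
  fixes u u' :: "real ^ 'n::finite \<Rightarrow> 'b::euclidean_space"
  assumes "open \<Omega>" "\<D> \<subseteq> test_functions \<Omega>" "weak_eigenpair \<Omega> \<D> l u" "weak_eigenpair \<Omega> \<D> l' u'" "l \<noteq> l'"
  shows "L2_inner \<Omega> u u' = 0"
proof -
  obtain \<phi> \<psi> where "energy_approx \<Omega> \<D> \<phi> u" "energy_approx \<Omega> \<D> \<psi> u'"
    using assms by (auto simp: weak_eigenpair_def)
  then have 1: "(\<lambda>k. dirichlet \<Omega> (\<phi> k) (\<psi> k)) \<longlonglongrightarrow> l' * L2_inner \<Omega> u u'"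
      and 2: "(\<lambda>k. dirichlet \<Omega> (\<psi> k) (\<phi> k)) \<longlonglongrightarrow> l * L2_inner \<Omega> u' u"
    using assms(3,4) by (auto simp: weak_eigenpair_def intro!: dirichlet_tendsto[OF assms(1,2)])
  from 2 have "(\<lambda>k. dirichlet \<Omega> (\<phi> k) (\<psi> k)) \<longlonglongrightarrow> l * L2_inner \<Omega> u u'"
    by (simp only: dirichlet_commute[of \<Omega> "\<psi> _"] L2_inner_commute[of \<Omega> u'])
  from LIMSEQ_unique[OF 1 this] have "l' * L2_inner \<Omega> u u' = l * L2_inner \<Omega> u u'" .
  then show ?thesis
    using assms(5) by simp
qed

lemma L2_inner_self_pos:
  assumes "u \<in> L2 \<Omega>" "\<not> (AE x in lebesgue_on \<Omega>. u x = 0)"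
  shows "L2_inner \<Omega> u u > 0"
  using L2_norm_eq_0_AE[OF assms(1)] assms(2) L2_inner_self_nonneg[of \<Omega> u]
  by (auto simp: L2_norm_def less_le)

lemma weak_eigenvalue_ge:
  fixes u :: "real ^ 'n::finite \<Rightarrow> 'b::euclidean_space"
  assumes "open \<Omega>" "\<D> \<subseteq> test_functions \<Omega>" "weak_eigenpair \<Omega> \<D> l u"
    and c: "\<And>\<phi>. \<phi> \<in> \<D> \<Longrightarrow> c * L2_inner \<Omega> \<phi> \<phi> \<le> dirichlet \<Omega> \<phi> \<phi>"
  shows "c \<le> l"
proof -
  obtain \<phi> where \<phi>: "energy_approx \<Omega> \<D> \<phi> u" and u: "u \<in> L2 \<Omega>" "\<not> (AE x in lebesgue_on \<Omega>. u x = 0)"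
    using assms by (auto simp: weak_eigenpair_def)
  have "\<phi> k \<in> L2 \<Omega>" for k
    using \<phi> assms(1,2) by (auto simp: energy_approx_def intro: test_functions_L2)
  then have "(\<lambda>k. c * L2_inner \<Omega> (\<phi> k) (\<phi> k)) \<longlonglongrightarrow> c * L2_inner \<Omega> u u"
    using \<phi> u by (intro tendsto_mult_left L2_inner_tendsto) (auto simp: energy_approx_def)
  moreover have "(\<lambda>k. dirichlet \<Omega> (\<phi> k) (\<phi> k)) \<longlonglongrightarrow> l * L2_inner \<Omega> u u"
    using assms(3) \<phi> u by (intro dirichlet_tendsto[OF assms(1,2)]) (auto simp: weak_eigenpair_def)
  ultimately have "c * L2_inner \<Omega> u u \<le> l * L2_inner \<Omega> u u"
    using \<phi> c by (intro LIMSEQ_le[of "\<lambda>k. c * L2_inner \<Omega> (\<phi> k) (\<phi> k)"]) (auto simp: energy_approx_def)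
  then show ?thesis
    using L2_inner_self_pos[OF u] by simp
qed

section \<open>Finiteness of the spectrum below a bound\<close>

text \<open>The translation is split into \<open>m + 1\<close> equal steps. Cauchy-Schwarz for the
  telescoping sum and translation invariance bound the left side by the integral of the squared
  difference quotient with step \<open>y / (m + 1)\<close>; then \<open>m\<close> tends to infinity.
  No integration along segments is involved.\<close>

lemma integral_translation_diff_le:
  fixes f :: "real ^ 'n::finite \<Rightarrow> 'b::euclidean_space"
  assumes "Ck 1 UNIV f" "compact K" "\<And>x. x \<notin> K \<Longrightarrow> f x = 0"
  shows "(LINT x|lborel. (norm (f (x + y) - f x))\<^sup>2) \<le>
    (LINT x|lborel. (norm (frechet_derivative f (at x) y))\<^sup>2)"
proof -
  obtain B R where B: "B \<ge> 0"
    "\<And>m x. norm (real (Suc m) *\<^sub>R (f (x + y /\<^sub>R real (Suc m)) - f x)) \<le> B * indicator (cball 0 R) x"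
    "\<And>x. (\<lambda>m. real (Suc m) *\<^sub>R (f (x + y /\<^sub>R real (Suc m)) - f x)) \<longlonglongrightarrow>
       frechet_derivative f (at x) y"
    using difference_quotient_dominated[OF assms, of y] by blast
  have cont: "continuous_on UNIV f"
    using Ck_imp_continuous_on assms(1) .
  then have meas [measurable]: "f \<in> borel_measurable borel"
    by (rule borel_measurable_continuous_onI)
  have [measurable]: "(\<lambda>x. frechet_derivative f (at x) y) \<in> borel_measurable borel"
    using assms(1) by (intro borel_measurable_continuous_onI) simp
  let ?q = "\<lambda>m x. (norm (real (Suc m) *\<^sub>R (f (x + y /\<^sub>R real (Suc m)) - f x)))\<^sup>2"
  have lim: "(\<lambda>m. LINT x|lborel. ?q m x) \<longlonglongrightarrow> (LINT x|lborel. (norm (frechet_derivative f (at x) y))\<^sup>2)"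
  proof (rule integral_dominated_convergence)
    show "integrable lborel (\<lambda>x::real ^ 'n. B\<^sup>2 * indicator (cball 0 R) x)"
      by (rule integrable_indicator_cball)
    show "AE x in lborel. norm (?q m x) \<le> B\<^sup>2 * indicator (cball 0 R) x" for m
    proof (rule AE_I2)
      fix x
      have "?q m x \<le> (B * indicator (cball 0 R) x)\<^sup>2"
        using B(2)[of m x] by (intro power_mono) auto
      then show "norm (?q m x) \<le> B\<^sup>2 * indicator (cball 0 R) x"
        by (cases "norm x \<le> R") (simp_all add: power_mult_distrib)
    qed
    show "AE x in lborel. (\<lambda>m. ?q m x) \<longlonglongrightarrow> (norm (frechet_derivative f (at x) y))\<^sup>2"
      using B(3) by (intro AE_I2 tendsto_power tendsto_norm)
  qed auto
  have int: "integrable lborel (\<lambda>x. (norm (f (x + a) - f (x + b)))\<^sup>2)" for a b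
  proof (rule integrable_continuous_compact_support)
    show "compact ((\<lambda>x. x - a) ` K \<union> (\<lambda>x. x - b) ` K)"
      using assms(2) by (intro compact_Un compact_continuous_image continuous_intros)
    show "(norm (f (x + a) - f (x + b)))\<^sup>2 = 0" if "x \<notin> (\<lambda>x. x - a) ` K \<union> (\<lambda>x. x - b) ` K" for x
    proof -
      have "x + a \<notin> K" "x + b \<notin> K"
        using that by (auto simp: image_iff)
      then show ?thesis
        using assms(3) by simp
    qed
    show "continuous_on UNIV (\<lambda>x. (norm (f (x + a) - f (x + b)))\<^sup>2)"
      by (intro continuous_intros continuous_on_compose2[OF cont]) auto
  qed
  have "(LINT x|lborel. (norm (f (x + y) - f x))\<^sup>2) \<le> (LINT x|lborel. ?q m x)" for m
  proof -
    define z where "z = y /\<^sub>R real (Suc m)"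
    let ?d = "\<lambda>k x. norm (f (x + real (Suc k) *\<^sub>R z) - f (x + real k *\<^sub>R z))"
    have zy: "real (Suc m) *\<^sub>R z = y"
      by (simp add: z_def del: of_nat_Suc)
    have "(norm (f (x + y) - f x))\<^sup>2 \<le> real (Suc m) * (\<Sum>k<Suc m. (?d k x)\<^sup>2)" for x
    proof -
      have "f (x + y) - f x = (\<Sum>k<Suc m. f (x + real (Suc k) *\<^sub>R z) - f (x + real k *\<^sub>R z))"
        by (subst sum_lessThan_telescope) (simp add: zy del: of_nat_Suc)
      then have "norm (f (x + y) - f x) \<le> (\<Sum>k<Suc m. ?d k x)"
        by (simp only: norm_sum)
      then have "(norm (f (x + y) - f x))\<^sup>2 \<le> (\<Sum>k<Suc m. ?d k x)\<^sup>2"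
        by (intro power_mono) auto
      also have "\<dots> \<le> (\<Sum>k<Suc m. (?d k x)\<^sup>2) * card {..<Suc m}"
        by (rule sum_squared_le_sum_of_squares)
      finally show ?thesis
        by (simp only: card_lessThan mult.commute)
    qed
    then have "(LINT x|lborel. (norm (f (x + y) - f x))\<^sup>2) \<le>
        (LINT x|lborel. real (Suc m) * (\<Sum>k<Suc m. (?d k x)\<^sup>2))"
      using int int[of y 0] by (intro integral_mono integrable_mult_right Bochner_Integration.integrable_sum) simp_all
    also have "\<dots> = real (Suc m) * (\<Sum>k<Suc m. LINT x|lborel. (?d k x)\<^sup>2)"
      using int by (simp only: integral_mult_right_zero Bochner_Integration.integral_sum)
    also have "\<dots> = real (Suc m) * (\<Sum>k<Suc m. LINT x|lborel. (norm (f (x + z) - f x))\<^sup>2)"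
    proof -
      have "(LINT x|lborel. (?d k x)\<^sup>2) = (LINT x|lborel. (norm (f (x + z) - f x))\<^sup>2)" for k
        using integral_lborel_translation[of "\<lambda>x. (norm (f (x + z) - f x))\<^sup>2" "real k *\<^sub>R z"]
        by (simp add: algebra_simps)
      then show ?thesis
        by (simp only:)
    qed
    also have "real (Suc m) * (\<Sum>k<Suc m. LINT x|lborel. (norm (f (x + z) - f x))\<^sup>2) =
        (LINT x|lborel. (real (Suc m))\<^sup>2 * (norm (f (x + z) - f x))\<^sup>2)"
      by (simp only: sum_constant card_lessThan integral_mult_right_zero power2_eq_square mult.assoc)
    also have "\<dots> = (LINT x|lborel. ?q m x)"
      by (simp add: z_def power_mult_distrib del: of_nat_Suc)
    finally show ?thesis .
  qed
  then show ?thesis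
    using LIMSEQ_le_const[OF lim] by blast
qed

lemma dirichlet_eq_integral:
  fixes \<phi> :: "real ^ 'n::finite \<Rightarrow> 'b::euclidean_space"
  assumes "open \<Omega>" "\<phi> \<in> test_functions \<Omega>"
  shows "dirichlet \<Omega> \<phi> \<phi> = (LINT x|lborel. (\<Sum>i\<in>UNIV. (norm (partial i \<phi> x))\<^sup>2))"
    and "integrable lborel (\<lambda>x. (norm (partial i \<phi> x))\<^sup>2)"
proof -
  have 1: "integrable lborel (\<lambda>x. (norm (\<psi> x))\<^sup>2) \<and> L2_inner \<Omega> \<psi> \<psi> = (LINT x|lborel. (norm (\<psi> x))\<^sup>2)"
    if \<psi>: "\<psi> \<in> test_functions \<Omega>" for \<psi> :: "real ^ 'n \<Rightarrow> 'b"
  proof -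
    obtain K where K: "\<And>k. Ck k UNIV \<psi>" "compact K" "K \<subseteq> \<Omega>" "\<And>x. x \<notin> K \<Longrightarrow> \<psi> x = 0"
      using \<psi> by (rule test_functionsE) blast
    have c: "continuous_on UNIV (\<lambda>x. (norm (\<psi> x))\<^sup>2)"
      using Ck_imp_continuous_on[OF K(1)] by (intro continuous_intros)
    have "integrable lborel (\<lambda>x. (norm (\<psi> x))\<^sup>2)"
      by (rule integrable_continuous_compact_support[OF c K(2)]) (use K in simp)
    moreover have "L2_inner \<Omega> \<psi> \<psi> = (LINT x|lborel. (norm (\<psi> x))\<^sup>2)"
      unfolding L2_inner_def dot_square_norm
      by (rule integral_lebesgue_on_support)
        (use K assms(1) borel_measurable_continuous_onI[OF c] in auto)
    ultimately show ?thesis by simp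
  qed
  note 2 = 1[OF test_functions_partial[OF assms(2)]]
  show "integrable lborel (\<lambda>x. (norm (partial i \<phi> x))\<^sup>2)"
    using 2 by blast
  show "dirichlet \<Omega> \<phi> \<phi> = (LINT x|lborel. (\<Sum>i\<in>UNIV. (norm (partial i \<phi> x))\<^sup>2))"
    using 2 by (simp add: dirichlet_def)
qed

lemma norm_frechet_derivative_le:
  fixes f :: "real ^ 'n::finite \<Rightarrow> 'b::euclidean_space"
  assumes "f differentiable (at x)"
  shows "(norm (frechet_derivative f (at x) y))\<^sup>2 \<le> (norm y)\<^sup>2 * (\<Sum>i\<in>UNIV. (norm (partial i f x))\<^sup>2)"
proof -
  have "norm (frechet_derivative f (at x) y) \<le> (\<Sum>i\<in>UNIV. \<bar>y $ i\<bar> * norm (partial i f x))"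
    unfolding frechet_derivative_partial[OF assms] by (rule order_trans[OF norm_sum]) simp
  then have "(norm (frechet_derivative f (at x) y))\<^sup>2 \<le> (\<Sum>i\<in>UNIV. \<bar>y $ i\<bar> * norm (partial i f x))\<^sup>2"
    by (intro power_mono) auto
  also have "\<dots> \<le> (\<Sum>i\<in>UNIV. \<bar>y $ i\<bar>\<^sup>2) * (\<Sum>i\<in>UNIV. (norm (partial i f x))\<^sup>2)"
    by (rule Cauchy_Schwarz_ineq_sum)
  also have "(\<Sum>i\<in>UNIV. \<bar>y $ i\<bar>\<^sup>2) = (norm y)\<^sup>2"
    unfolding power2_norm_eq_inner inner_vec_def by (simp add: power2_eq_square)
  finally show ?thesis .
qed

text \<open>Expanding \<open>|\<phi> (x + y) - \<phi> x|\<^sup>2\<close> under the integral gives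
  \<open>2 |\<phi>|\<^sup>2\<close> minus twice the correlation, and the translation estimate bounds
  this by \<open>|y|\<^sup>2\<close> times the energy.\<close>

lemma autocorrelation_ge:
  fixes \<phi> :: "real ^ 'n::finite \<Rightarrow> 'b::euclidean_space"
  assumes "open \<Omega>" "\<phi> \<in> test_functions \<Omega>"
  shows "L2_inner \<Omega> \<phi> \<phi> - (norm y)\<^sup>2 * dirichlet \<Omega> \<phi> \<phi> / 2 \<le> (LINT x|lborel. \<phi> x \<bullet> \<phi> (x + y))"
proof -
  obtain K where K: "\<And>k. Ck k UNIV \<phi>" "compact K" "K \<subseteq> \<Omega>" "\<And>x. x \<notin> K \<Longrightarrow> \<phi> x = 0"
    using assms(2) by (rule test_functionsE) blast
  have c [continuous_intros]: "continuous_on UNIV \<phi>" "continuous_on UNIV (\<lambda>x. \<phi> (x + y))"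
    using Ck_imp_continuous_on[OF K(1)]
    by (auto intro!: continuous_on_compose2[OF Ck_imp_continuous_on[OF K(1)]] continuous_intros)
  have int: "integrable lborel (\<lambda>x. \<phi> x \<bullet> \<phi> x)" "integrable lborel (\<lambda>x. \<phi> x \<bullet> \<phi> (x + y))"
    by (rule integrable_continuous_compact_support[OF _ K(2)];
        use K in \<open>auto intro!: continuous_intros c\<close>)+
  have int': "integrable lborel (\<lambda>x. \<phi> (x + y) \<bullet> \<phi> (x + y))"
    using integrable_lborel_translation[OF int(1)] .
  have L2: "L2_inner \<Omega> \<phi> \<phi> = (LINT x|lborel. \<phi> x \<bullet> \<phi> x)"
    unfolding L2_inner_def
    by (rule integral_lebesgue_on_support) (use K assms(1) int(1) in \<open>auto dest: borel_measurable_integrable\<close>)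
  have "(norm (\<phi> (x + y) - \<phi> x))\<^sup>2 = \<phi> (x + y) \<bullet> \<phi> (x + y) + \<phi> x \<bullet> \<phi> x - 2 * (\<phi> x \<bullet> \<phi> (x + y))" for x
    by (simp add: power2_norm_eq_inner inner_diff inner_commute)
  then have "(LINT x|lborel. (norm (\<phi> (x + y) - \<phi> x))\<^sup>2) =
      2 * L2_inner \<Omega> \<phi> \<phi> - 2 * (LINT x|lborel. \<phi> x \<bullet> \<phi> (x + y))"
    using int int' integral_lborel_translation[of "\<lambda>x. \<phi> x \<bullet> \<phi> x" y]
    by (simp add: L2 borel_measurable_integrable[OF int(1), simplified])
  moreover have "(LINT x|lborel. (norm (\<phi> (x + y) - \<phi> x))\<^sup>2) \<le>
      (LINT x|lborel. (norm (frechet_derivative \<phi> (at x) y))\<^sup>2)"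
    using K by (intro integral_translation_diff_le) auto
  moreover have "(LINT x|lborel. (norm (frechet_derivative \<phi> (at x) y))\<^sup>2) \<le>
      (LINT x|lborel. (norm y)\<^sup>2 * (\<Sum>i\<in>UNIV. (norm (partial i \<phi> x))\<^sup>2))"
    using dirichlet_eq_integral(2)[OF assms]
    by (intro integral_mono_AE' AE_I2 norm_frechet_derivative_le test_functions_differentiable[OF assms(2)])
      (auto intro!: mult_nonneg_nonneg sum_nonneg)
  moreover have "(LINT x|lborel. (norm y)\<^sup>2 * (\<Sum>i\<in>UNIV. (norm (partial i \<phi> x))\<^sup>2)) =
      (norm y)\<^sup>2 * dirichlet \<Omega> \<phi> \<phi>"
    by (simp only: dirichlet_eq_integral(1)[OF assms] integral_mult_right_zero)
  ultimately show ?thesis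
    by linarith
qed

text \<open>With \<open>p\<close> the would-be projection of \<open>w\<close>, an orthonormal family
  has \<open>\<langle>p, p\<rangle> = S\<close>. Errors up to \<open>1 / N\<close> in the Gram
  matrix add at most \<open>(\<Sum> |c\<^sub>i|)\<^sup>2 / N \<le> S\<close>, so
  \<open>\<langle>p, p\<rangle> \<le> 2 S\<close>; the square of \<open>w - p / 2\<close> being
  non-negative, \<open>S\<close> is at most \<open>2 |w|\<^sup>2\<close>.\<close>

lemma almost_Bessel:
  fixes \<phi> :: "nat \<Rightarrow> real ^ 'n::finite \<Rightarrow> 'b::euclidean_space"
  assumes "w \<in> L2 \<Omega>" "\<And>j. j < N \<Longrightarrow> \<phi> j \<in> L2 \<Omega>"
    and gram: "\<And>i j. i < N \<Longrightarrow> j < N \<Longrightarrow> \<bar>L2_inner \<Omega> (\<phi> i) (\<phi> j) - (if i = j then 1 else 0)\<bar> \<le> 1 / real N"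
  shows "(\<Sum>j<N. (L2_inner \<Omega> w (\<phi> j))\<^sup>2) \<le> 2 * L2_inner \<Omega> w w"
proof (cases "N = 0")
  case False
  define c where "c j = L2_inner \<Omega> w (\<phi> j)" for j
  define S where "S = (\<Sum>j<N. (c j)\<^sup>2)"
  define p where "p x = (\<Sum>j<N. c j *\<^sub>R \<phi> j x)" for x
  have p: "p \<in> L2 \<Omega>"
    unfolding p_def[abs_def] using assms(2) by (intro L2_sum L2_scaleR) auto
  have wp: "L2_inner \<Omega> w p = S"
    unfolding p_def[abs_def] S_def using assms(1,2)
    by (subst L2_inner_sum_right) (auto simp: L2_scaleR L2_inner_scaleR_right c_def power2_eq_square)
  have right: "L2_inner \<Omega> v p = (\<Sum>j<N. c j * L2_inner \<Omega> v (\<phi> j))" if "v \<in> L2 \<Omega>" for v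
    unfolding p_def[abs_def] using assms(2) that
    by (subst L2_inner_sum_right) (auto simp: L2_scaleR L2_inner_scaleR_right)
  have "L2_inner \<Omega> p p = (\<Sum>i<N. c i * L2_inner \<Omega> (\<phi> i) p)"
    by (simp only: right[OF p] L2_inner_commute[of \<Omega> p "\<phi> _"])
  also have "\<dots> = (\<Sum>i<N. \<Sum>j<N. c i * c j * L2_inner \<Omega> (\<phi> i) (\<phi> j))"
    using assms(2) right by (simp add: sum_distrib_left mult.assoc)
  also have "\<dots> \<le> (\<Sum>i<N. \<Sum>j<N. c i * c j * (if i = j then 1 else 0) + \<bar>c i\<bar> * \<bar>c j\<bar> * (1 / real N))"
  proof (intro sum_mono)
    fix i j assume ij: "i \<in> {..<N}" "j \<in> {..<N}"
    define d where "d = L2_inner \<Omega> (\<phi> i) (\<phi> j) - (if i = j then 1 else 0)"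
    have "c i * c j * d \<le> \<bar>c i * c j\<bar> * \<bar>d\<bar>"
      by (metis abs_ge_self abs_mult)
    also have "\<dots> \<le> \<bar>c i * c j\<bar> * (1 / real N)"
      using gram[of i j] ij by (intro mult_left_mono) (auto simp: d_def)
    finally show "c i * c j * L2_inner \<Omega> (\<phi> i) (\<phi> j) \<le>
        c i * c j * (if i = j then 1 else 0) + \<bar>c i\<bar> * \<bar>c j\<bar> * (1 / real N)"
      by (simp add: d_def abs_mult right_diff_distrib)
  qed
  also have "\<dots> = S + (\<Sum>i<N. \<bar>c i\<bar>)\<^sup>2 / real N"
  proof -
    have "(\<Sum>j<N. c i * c j * (if i = j then 1 else 0)) = (c i)\<^sup>2" if "i < N" for i
      using that by (simp add: power2_eq_square if_distrib[of "\<lambda>t. _ * t"] cong: if_cong)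
    then show ?thesis
      by (simp add: sum.distrib S_def power2_eq_square sum_product flip: sum_divide_distrib)
  qed
  also have "(\<Sum>i<N. \<bar>c i\<bar>)\<^sup>2 \<le> S * real N"
    using sum_squared_le_sum_of_squares[of "\<lambda>i. \<bar>c i\<bar>" "{..<N}"] by (simp add: S_def)
  then have "S + (\<Sum>i<N. \<bar>c i\<bar>)\<^sup>2 / real N \<le> 2 * S"
    using False by (simp add: divide_le_eq)
  finally have pp: "L2_inner \<Omega> p p \<le> 2 * S" .
  \<comment> \<open>The coefficient \<open>- 1 / 2\<close> minimises
    \<open>2 t S + 2 t\<^sup>2 S\<close>, the worst case under the bound on
    \<open>\<langle>p, p\<rangle>\<close>.\<close>
  have "0 \<le> L2_inner \<Omega> w w + 2 * (- 1 / 2) * S + (- 1 / 2)\<^sup>2 * L2_inner \<Omega> p p"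
    unfolding wp[symmetric] L2_inner_quadratic[OF assms(1) p, symmetric]
    by (rule L2_inner_self_nonneg)
  then show ?thesis
    using pp by (simp add: power2_eq_square S_def c_def)
qed (simp add: L2_inner_self_nonneg)

text \<open>
  A function of bounded energy correlates with its small translates. Averaged over translates in a
  ball, the correlations pair each function with its mean values over balls, and these are controlled
  for all functions at once by Bessel's inequality for the indicator functions of the balls.
\<close>

lemma almost_orthonormal_card_bound:
  fixes \<phi> :: "nat \<Rightarrow> real ^ 'n::finite \<Rightarrow> 'b::euclidean_space"
  assumes \<Omega>: "open \<Omega>" "bounded \<Omega>" and "0 < E" "2 \<le> N"
    and test: "\<And>j. j < N \<Longrightarrow> \<phi> j \<in> test_functions \<Omega>"
    and energy: "\<And>j. j < N \<Longrightarrow> dirichlet \<Omega> (\<phi> j) (\<phi> j) \<le> E"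
    and gram: "\<And>i j. i < N \<Longrightarrow> j < N \<Longrightarrow> \<bar>L2_inner \<Omega> (\<phi> i) (\<phi> j) - (if i = j then 1 else 0)\<bar> \<le> 1 / real N"
  shows "real N * measure lborel (cball (0::real ^ 'n) (1 / sqrt (2 * E))) \<le>
    64 * real DIM('b) * measure lebesgue \<Omega>"
proof -
  \<comment> \<open>With \<open>\<rho>\<^sup>2 E = 1 / 2\<close>, a function of squared norm at
    least \<open>1 / 2\<close> and energy at most \<open>E\<close> has correlation at least
    \<open>1 / 2 - 1 / 4\<close> with each translate by a vector in \<open>Q\<close>.\<close>
  define \<rho> where "\<rho> = 1 / sqrt (2 * E)"
  define Q where "Q = cball (0::real ^ 'n) \<rho>"
  define V where "V = measure lborel Q"
  have "\<rho> > 0"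
    using \<open>0 < E\<close> by (simp add: \<rho>_def)
  have V: "V > 0" "measure lborel (cball x \<rho>) = V" for x :: "real ^ 'n"
    using \<open>\<rho> > 0\<close> by (simp_all add: V_def Q_def content_cball)
  have \<rho>E: "\<rho>\<^sup>2 * E = 1 / 2"
    using \<open>0 < E\<close> by (simp add: \<rho>_def power_divide)
  have \<Omega>': "\<Omega> \<in> sets lebesgue" "\<Omega> \<in> lmeasurable"
    using \<Omega> by (auto intro: lmeasurable_open)
  define K where "K = closure \<Omega>"
  have "compact K"
    using \<Omega>(2) by (simp add: K_def)
  have zero: "\<phi> j x = 0" if "j < N" "x \<notin> \<Omega>" for j x
    using test[OF that(1)] that(2) by (metis subsetD test_functionsE)
  have zero_K: "\<phi> j x = 0" if "j < N" "x \<notin> K" for j x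
    using zero that closure_subset[of \<Omega>] by (auto simp: K_def)
  have cont: "continuous_on UNIV (\<phi> j)" if "j < N" for j
    using test_functions_Ck[OF test[OF that]] by (rule Ck_imp_continuous_on)
  have cont_shift: "continuous_on UNIV (\<lambda>x. \<phi> j (x + y))" if "j < N" for j y
    by (rule continuous_on_compose2[OF cont[OF that]]) (auto intro: continuous_intros)
  define g where "g j x y = \<phi> j x \<bullet> \<phi> j (x + y)" for j x y
  \<comment> \<open>The indicator of the compact set \<open>K \<times> Q\<close> makes the integrand
    integrable in both variables, as Fubini's theorem requires.\<close>
  define f where "f x y = indicator (K \<times> Q) (x, y) *\<^sub>R (\<Sum>j<N. g j x y)" for x y
  have "continuous_on UNIV (\<lambda>p. \<phi> j (fst p) \<bullet> \<phi> j (fst p + snd p))" if "j < N" for j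
    by (intro continuous_intros continuous_on_compose2[OF cont[OF that]]) auto
  then have "continuous_on UNIV (\<lambda>p. \<Sum>j<N. g j (fst p) (snd p))"
    unfolding g_def by (intro continuous_on_sum) auto
  then have "integrable lborel (\<lambda>p. indicator (K \<times> Q) p *\<^sub>R (\<Sum>j<N. g j (fst p) (snd p)))"
    by (intro borel_integrable_compact compact_Times \<open>compact K\<close>)
      (auto simp: Q_def intro: continuous_on_subset)
  moreover have "(\<lambda>p. indicator (K \<times> Q) p *\<^sub>R (\<Sum>j<N. g j (fst p) (snd p))) = case_prod f"
    by (auto simp: f_def)
  ultimately have intf: "integrable (lborel \<Otimes>\<^sub>M lborel) (case_prod f)"
    by (simp add: lborel_prod)
  have norm1: "1 / 2 \<le> L2_inner \<Omega> (\<phi> j) (\<phi> j)" "L2_inner \<Omega> (\<phi> j) (\<phi> j) \<le> 2" if "j < N" for j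
  proof -
    have "1 / real N \<le> 1 / 2"
      using \<open>2 \<le> N\<close> by (simp add: field_simps)
    then have "\<bar>L2_inner \<Omega> (\<phi> j) (\<phi> j) - 1\<bar> \<le> 1 / 2"
      using gram[OF that that] by simp
    then show "1 / 2 \<le> L2_inner \<Omega> (\<phi> j) (\<phi> j)" "L2_inner \<Omega> (\<phi> j) (\<phi> j) \<le> 2"
      by linarith+
  qed
  have int_g: "integrable lborel (\<lambda>x. g j x y)" if "j < N" for j y
    unfolding g_def
    by (rule integrable_continuous_compact_support[OF _ \<open>compact K\<close>])
      (use that zero_K in \<open>auto intro!: continuous_intros cont cont_shift\<close>)
  have lower: "indicator Q y * (real N / 4) \<le> (LINT x|lborel. f x y)" for y
  proof (cases "y \<in> Q")
    case True
    then have "(norm y)\<^sup>2 \<le> \<rho>\<^sup>2"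
      by (auto simp: Q_def intro: power_mono)
    have 1: "1 / 4 \<le> (LINT x|lborel. g j x y)" if "j < N" for j
    proof -
      have "(norm y)\<^sup>2 * dirichlet \<Omega> (\<phi> j) (\<phi> j) \<le> \<rho>\<^sup>2 * E"
        using \<open>(norm y)\<^sup>2 \<le> \<rho>\<^sup>2\<close> energy[OF that] by (intro mult_mono dirichlet_nonneg) auto
      then show ?thesis
        using autocorrelation_ge[OF \<Omega>(1) test[OF that], of y] norm1[OF that] \<rho>E
        by (simp add: g_def)
    qed
    have "f x y = (\<Sum>j<N. g j x y)" for x
      using True zero_K by (cases "x \<in> K") (auto simp: f_def g_def)
    then have "(LINT x|lborel. f x y) = (\<Sum>j<N. LINT x|lborel. g j x y)"
      using int_g by simp
    also have "\<dots> \<ge> (\<Sum>j<N. 1 / 4)"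
      using 1 by (intro sum_mono) auto
    finally show ?thesis
      using True by simp
  qed (simp add: f_def)
  have "V * (real N / 4) = (LINT y|lborel. indicator Q y * (real N / 4))"
    by (simp add: V_def Q_def mult.commute)
  also have "\<dots> \<le> (LINT y|lborel. (LINT x|lborel. f x y))"
  proof (intro integral_mono lower)
    show "integrable lborel (\<lambda>y. indicator Q y * (real N / 4))"
      using integrable_indicator_cball[of "real N / 4" 0 \<rho>] by (simp add: Q_def mult.commute)
  qed (rule lborel_pair.integrable_snd[OF intf])
  also have "\<dots> = (LINT x|lborel. (LINT y|lborel. f x y))"
    by (rule lborel_pair.Fubini_integral[OF intf])
  \<comment> \<open>The weight \<open>V / 16\<close> is small enough for absorption: the squared
    norms are at most 2, so the first term integrates to at most \<open>V N / 8\<close>, half of the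
    left side \<open>V N / 4\<close>.\<close>
  also have "\<dots> \<le> (LINT x|lborel. V / 16 * (\<Sum>j<N. (norm (\<phi> j x))\<^sup>2) + indicator \<Omega> x * (8 * real DIM('b)))"
  proof (rule integral_mono)
    show "integrable lborel (\<lambda>x. LINT y|lborel. f x y)"
      by (rule lborel_pair.integrable_fst'[OF intf, simplified])
    have "integrable lborel (\<lambda>x. indicator \<Omega> x * (8 * real DIM('b)))"
      using \<Omega> emeasure_bounded_finite[OF \<Omega>(2)]
      by (intro integrable_mult_left integrable_real_indicator) (auto simp: top.not_eq_extremum)
    moreover have "integrable lborel (\<lambda>x. (norm (\<phi> j x))\<^sup>2)" if "j < N" for j
      by (rule integrable_continuous_compact_support[OF _ \<open>compact K\<close>])
        (use that zero_K in \<open>auto intro!: continuous_intros cont\<close>)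
    ultimately show "integrable lborel
        (\<lambda>x. V / 16 * (\<Sum>j<N. (norm (\<phi> j x))\<^sup>2) + indicator \<Omega> x * (8 * real DIM('b)))"
      by (intro Bochner_Integration.integrable_add integrable_mult_right Bochner_Integration.integrable_sum) auto
    fix x
    show "(LINT y|lborel. f x y) \<le>
        V / 16 * (\<Sum>j<N. (norm (\<phi> j x))\<^sup>2) + indicator \<Omega> x * (8 * real DIM('b))"
    proof (cases "x \<in> \<Omega>")
      case False
      then show ?thesis
        using zero V by (simp add: f_def g_def)
    next
      case True
      then have "x \<in> K"
        using closure_subset by (auto simp: K_def)
      \<comment> \<open>Pairing with \<open>w b\<close> gives the \<open>b\<close>-component of the
        integral over the ball around \<open>x\<close>; summing over \<open>b\<close> turns the
        average over translates into inner products to which Bessel's inequality applies.\<close>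
      define w where "w b z = indicator (cball x \<rho>) z *\<^sub>R b" for z and b :: 'b
      have int_w: "integrable lborel (\<lambda>z. indicator (cball x \<rho>) z :: real)"
        using integrable_indicator_cball[of 1] by simp
      have w: "w b \<in> L2 \<Omega>" "L2_inner \<Omega> (w b) (w b) \<le> V" if "b \<in> Basis" for b
      proof -
        have sq: "w b z \<bullet> w b z = indicator (cball x \<rho>) z" "(norm (w b z))\<^sup>2 = indicator (cball x \<rho>) z" for z
          using that by (auto simp: w_def indicator_def norm_Basis)
        have "w b \<in> borel_measurable (lebesgue_on \<Omega>)"
          unfolding w_def[abs_def]
          using borel_measurable_integrable[OF integrable_lebesgue_on[OF int_w \<Omega>'(1)]]
          by (intro borel_measurable_scaleR) auto
        then show "w b \<in> L2 \<Omega>"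
          using integrable_lebesgue_on[OF int_w \<Omega>'(1)] by (simp add: L2_def sq)
        have "L2_inner \<Omega> (w b) (w b) = (LINT z|lebesgue. indicator \<Omega> z *\<^sub>R indicator (cball x \<rho>) z)"
          unfolding L2_inner_def sq by (rule integral_restrict_space) (use \<Omega>'(1) in simp)
        also have "\<dots> \<le> (LINT z|lebesgue. indicator (cball x \<rho>) z)"
          using int_w \<Omega>'(1) by (intro integral_mono' ) (auto simp: integrable_completion indicator_def)
        also have "\<dots> = V"
          by (simp add: V(2)[symmetric, of x] integral_completion)
        finally show "L2_inner \<Omega> (w b) (w b) \<le> V" .
      qed
      have L2: "\<phi> j \<in> L2 \<Omega>" if "j < N" for j
        using test[OF that] \<Omega>(1) by (rule test_functions_L2[rotated])
      have int_s: "integrable lborel (\<lambda>z. indicator (cball x \<rho>) z *\<^sub>R (\<phi> j z \<bullet> b))" if "j < N" for j b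
        by (intro borel_integrable_compact compact_cball continuous_intros
            continuous_on_subset[OF cont[OF that]]) auto
      have s: "(LINT y|lborel. indicator Q y *\<^sub>R (\<phi> j (y + x) \<bullet> b)) = L2_inner \<Omega> (w b) (\<phi> j)"
        "integrable lborel (\<lambda>y. indicator Q y *\<^sub>R (\<phi> j (y + x) \<bullet> b))" if "j < N" for j b
      proof -
        have ind: "indicator (cball x \<rho>) (y + x) = (indicator Q y :: real)" for y
          by (simp add: Q_def indicator_def dist_norm norm_minus_commute)
        have "L2_inner \<Omega> (w b) (\<phi> j) = (LINT z|lborel. indicator (cball x \<rho>) z *\<^sub>R (\<phi> j z \<bullet> b))"
          unfolding L2_inner_def w_def
          using zero[OF that] borel_measurable_integrable[OF int_s[OF that, of b]]
          by (subst integral_lebesgue_on_support[symmetric, OF _ \<Omega>'(1)]) (auto simp: inner_commute)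
        also have "\<dots> = (LINT y|lborel. indicator (cball x \<rho>) (y + x) *\<^sub>R (\<phi> j (y + x) \<bullet> b))"
          using borel_measurable_integrable[OF int_s[OF that, of b]]
          by (intro integral_lborel_translation[symmetric]) auto
        finally show "(LINT y|lborel. indicator Q y *\<^sub>R (\<phi> j (y + x) \<bullet> b)) = L2_inner \<Omega> (w b) (\<phi> j)"
          by (simp add: ind)
        show "integrable lborel (\<lambda>y. indicator Q y *\<^sub>R (\<phi> j (y + x) \<bullet> b))"
          using integrable_lborel_translation[OF int_s[OF that, of b], of x] by (simp add: ind)
      qed
      have "(LINT y|lborel. f x y) =
          (LINT y|lborel. (\<Sum>j<N. \<Sum>b\<in>Basis. (\<phi> j x \<bullet> b) * (indicator Q y *\<^sub>R (\<phi> j (y + x) \<bullet> b))))"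
      proof (intro Bochner_Integration.integral_cong refl)
        fix y
        show "f x y = (\<Sum>j<N. \<Sum>b\<in>Basis. (\<phi> j x \<bullet> b) * (indicator Q y *\<^sub>R (\<phi> j (y + x) \<bullet> b)))"
        proof -
          have "g j x y = (\<Sum>b\<in>Basis. (\<phi> j x \<bullet> b) * (\<phi> j (y + x) \<bullet> b))" for j
            unfolding g_def by (subst euclidean_inner) (simp only: add.commute)
          then show ?thesis
            using \<open>x \<in> K\<close> by (cases "y \<in> Q") (simp_all add: f_def)
        qed
      qed
      also have "\<dots> = (\<Sum>j<N. \<Sum>b\<in>Basis. (\<phi> j x \<bullet> b) * L2_inner \<Omega> (w b) (\<phi> j))"
        using s by (simp add: Bochner_Integration.integral_sum)
      \<comment> \<open>Young's inequality. The weight \<open>4 / V\<close> meets the Bessel bound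
        \<open>2 V\<close> for each \<open>b\<close>, whence the constant 8 per dimension.\<close>
      also have "\<dots> \<le> (\<Sum>j<N. \<Sum>b\<in>Basis. V / 16 * (\<phi> j x \<bullet> b)\<^sup>2 + 4 / V * (L2_inner \<Omega> (w b) (\<phi> j))\<^sup>2)"
      proof (intro sum_mono)
        have "p * q \<le> V / 16 * p\<^sup>2 + 4 / V * q\<^sup>2" for p q
        proof -
          have "0 \<le> (V * p - 8 * q)\<^sup>2 / (16 * V)"
            using V by simp
          also have "\<dots> = V / 16 * p\<^sup>2 + 4 / V * q\<^sup>2 - p * q"
            using V by (simp add: field_simps power2_eq_square)
          finally show ?thesis by simp
        qed
        then show "(\<phi> j x \<bullet> b) * L2_inner \<Omega> (w b) (\<phi> j) \<le>
            V / 16 * (\<phi> j x \<bullet> b)\<^sup>2 + 4 / V * (L2_inner \<Omega> (w b) (\<phi> j))\<^sup>2" for j b .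
      qed
      also have "\<dots> = V / 16 * (\<Sum>j<N. \<Sum>b\<in>Basis. (\<phi> j x \<bullet> b)\<^sup>2) +
          4 / V * (\<Sum>j<N. \<Sum>b\<in>Basis. (L2_inner \<Omega> (w b) (\<phi> j))\<^sup>2)"
        by (simp only: sum.distrib sum_distrib_left)
      also have "(\<Sum>j<N. \<Sum>b\<in>Basis. (\<phi> j x \<bullet> b)\<^sup>2) = (\<Sum>j<N. (norm (\<phi> j x))\<^sup>2)"
      proof -
        have "(\<Sum>b\<in>Basis. (v \<bullet> b)\<^sup>2) = (norm v)\<^sup>2" for v :: 'b
          unfolding power2_norm_eq_inner by (subst euclidean_inner) (simp add: power2_eq_square)
        then show ?thesis
          by simp
      qed
      also have "(\<Sum>j<N. \<Sum>b\<in>Basis. (L2_inner \<Omega> (w b) (\<phi> j))\<^sup>2) =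
          (\<Sum>b\<in>Basis. \<Sum>j<N. (L2_inner \<Omega> (w b) (\<phi> j))\<^sup>2)"
        by (rule sum.swap)
      also have "\<dots> \<le> (\<Sum>b\<in>(Basis :: 'b set). 2 * V)"
      proof (rule sum_mono)
        fix b :: 'b assume "b \<in> Basis"
        then show "(\<Sum>j<N. (L2_inner \<Omega> (w b) (\<phi> j))\<^sup>2) \<le> 2 * V"
          using almost_Bessel[OF w(1) L2 gram, of b] w(2)[of b] by simp
      qed
      then have "V / 16 * (\<Sum>j<N. (norm (\<phi> j x))\<^sup>2) +
            4 / V * (\<Sum>b\<in>Basis. \<Sum>j<N. (L2_inner \<Omega> (w b) (\<phi> j))\<^sup>2)
          \<le> V / 16 * (\<Sum>j<N. (norm (\<phi> j x))\<^sup>2) + 4 / V * (\<Sum>b\<in>(Basis :: 'b set). 2 * V)"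
        using V by (intro add_mono order_refl mult_left_mono) auto
      also have "\<dots> = V / 16 * (\<Sum>j<N. (norm (\<phi> j x))\<^sup>2) + indicator \<Omega> x * (8 * real DIM('b))"
        using True V by simp
      finally show ?thesis .
    qed
  qed
  also have "\<dots> = V / 16 * (\<Sum>j<N. L2_inner \<Omega> (\<phi> j) (\<phi> j)) + 8 * real DIM('b) * measure lebesgue \<Omega>"
  proof -
    have int: "integrable lborel (\<lambda>x. (norm (\<phi> j x))\<^sup>2)" if "j < N" for j
      by (rule integrable_continuous_compact_support[OF _ \<open>compact K\<close>])
        (use that zero_K in \<open>auto intro!: continuous_intros cont\<close>)
    have "L2_inner \<Omega> (\<phi> j) (\<phi> j) = (LINT x|lborel. (norm (\<phi> j x))\<^sup>2)" if "j < N" for j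
      unfolding L2_inner_def dot_square_norm
      by (rule integral_lebesgue_on_support)
        (use that zero \<Omega>' borel_measurable_integrable[OF int] in auto)
    moreover have "integrable lborel (\<lambda>x. indicator \<Omega> x * (8 * real DIM('b)))"
      using \<Omega> emeasure_bounded_finite[OF \<Omega>(2)]
      by (intro integrable_mult_left integrable_real_indicator) (auto simp: top.not_eq_extremum)
    moreover have "(LINT x|lborel. indicator \<Omega> x * (8 * real DIM('b))) = 8 * real DIM('b) * measure lebesgue \<Omega>"
      using \<Omega>(1) by simp
    moreover have "integrable lborel (\<lambda>x. \<Sum>j<N. (norm (\<phi> j x))\<^sup>2)"
      by (intro Bochner_Integration.integrable_sum int) simp
    ultimately show ?thesis
      using int by (subst Bochner_Integration.integral_add) (simp_all del: times_divide_eq_left)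
  qed
  also have "(\<Sum>j<N. L2_inner \<Omega> (\<phi> j) (\<phi> j)) \<le> (\<Sum>j<N. 2)"
    using norm1 by (intro sum_mono) auto
  then have "V / 16 * (\<Sum>j<N. L2_inner \<Omega> (\<phi> j) (\<phi> j)) + 8 * real DIM('b) * measure lebesgue \<Omega> \<le>
      V / 16 * (\<Sum>j<N. 2) + 8 * real DIM('b) * measure lebesgue \<Omega>"
    using V by (intro add_mono order_refl mult_left_mono) auto
  finally show ?thesis
    by (simp add: V_def Q_def \<rho>_def algebra_simps)
qed

lemma partial_scaleR:
  fixes f :: "real ^ 'n::finite \<Rightarrow> 'b::real_normed_vector"
  assumes "f differentiable (at x)"
  shows "partial i (\<lambda>x. c *\<^sub>R f x) x = c *\<^sub>R partial i f x"
  unfolding partial_def[of i f]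
  by (rule partial_eqI) (use assms frechet_derivative_works in \<open>auto intro!: derivative_eq_intros\<close>)

lemma dirichlet_scaleR:
  fixes \<phi> :: "real ^ 'n::finite \<Rightarrow> 'b::euclidean_space"
  assumes "\<phi> \<in> test_functions \<Omega>"
  shows "dirichlet \<Omega> (\<lambda>x. c *\<^sub>R \<phi> x) (\<lambda>x. c *\<^sub>R \<phi> x) = c\<^sup>2 * dirichlet \<Omega> \<phi> \<phi>"
proof -
  have "partial i (\<lambda>x. c *\<^sub>R \<phi> x) = (\<lambda>x. c *\<^sub>R partial i \<phi> x)" for i
    using partial_scaleR[OF test_functions_differentiable[OF assms]] by blast
  then show ?thesis
    by (simp add: dirichlet_def L2_inner_scaleR_left L2_inner_scaleR_right sum_distrib_left
        power2_eq_square mult.assoc)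
qed

lemma test_functions_scaleR:
  fixes \<phi> :: "real ^ 'n::finite \<Rightarrow> 'b::real_normed_vector"
  assumes "\<phi> \<in> test_functions \<Omega>"
  shows "(\<lambda>x. c *\<^sub>R \<phi> x) \<in> test_functions \<Omega>"
  using test_functions_add_scaleR[OF assms assms, of "c - 1"] by (simp add: algebra_simps)

text \<open>One eigenfunction is taken for each of \<open>N\<close> distinct eigenvalues. Their
  normalised approximants, all at one late index, are almost orthonormal with energies close to the
  eigenvalues, and \<open>N\<close> is chosen to contradict
  \<open>almost_orthonormal_card_bound\<close>.\<close>

theorem finite_weak_eigenvalues:
  fixes \<D> :: "(real ^ 'n::finite \<Rightarrow> 'b::euclidean_space) set"
  assumes \<Omega>: "open \<Omega>" "bounded \<Omega>" and \<D>: "\<D> \<subseteq> test_functions \<Omega>"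
  shows "finite {l. l \<le> E \<and> (\<exists>u. weak_eigenpair \<Omega> \<D> l u)}" (is "finite ?S")
proof (rule ccontr)
  assume "infinite ?S"
  \<comment> \<open>Positive, as the cardinality bound requires, and strictly above
    \<open>E\<close>, so that energies tending to an eigenvalue at most \<open>E\<close> end up
    below it.\<close>
  define E' where "E' = max 0 E + 1"
  define V where "V = measure lborel (cball (0::real ^ 'n) (1 / sqrt (2 * E')))"
  have "V > 0"
    by (simp add: V_def E'_def content_cball)
  \<comment> \<open>The summand 2 makes the violation of the bound strict and provides
    \<open>2 \<le> N\<close>.\<close>
  define N where "N = nat \<lceil>64 * real DIM('b) * measure lebesgue \<Omega> / V\<rceil> + 2"
  have "real N > 64 * real DIM('b) * measure lebesgue \<Omega> / V"
    unfolding N_def by linarith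
  then have N_big: "real N * V > 64 * real DIM('b) * measure lebesgue \<Omega>"
    using \<open>V > 0\<close> by (simp add: field_simps)
  have "N \<ge> 2"
    by (simp add: N_def)
  obtain T where T: "finite T" "card T = N" "T \<subseteq> ?S"
    using infinite_arbitrarily_large[OF \<open>infinite ?S\<close>] by blast
  obtain l where l: "bij_betw l {..<N} T"
    using ex_bij_betw_nat_finite[OF T(1)] T(2) by (auto simp: atLeast0LessThan)
  have "\<forall>j\<in>{..<N}. \<exists>u \<phi>. weak_eigenpair \<Omega> \<D> (l j) u \<and> energy_approx \<Omega> \<D> \<phi> u"
    using bij_betwE[OF l] T(3) by (fastforce simp: weak_eigenpair_def)
  then obtain u \<phi> where u: "\<And>j. j < N \<Longrightarrow> weak_eigenpair \<Omega> \<D> (l j) (u j)"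
    and \<phi>: "\<And>j. j < N \<Longrightarrow> energy_approx \<Omega> \<D> (\<phi> j) (u j)"
    by (metis lessThan_iff)
  have l_le: "l j \<le> E" if "j < N" for j
    using bij_betwE[OF l] T(3) that by auto
  have test: "\<phi> j k \<in> test_functions \<Omega>" if "j < N" for j k
    using \<phi>[OF that] \<D> by (auto simp: energy_approx_def)
  have uL2: "u j \<in> L2 \<Omega>" "L2_inner \<Omega> (u j) (u j) > 0" if "j < N" for j
    using u[OF that] L2_inner_self_pos by (auto simp: weak_eigenpair_def)
  define c where "c j = 1 / sqrt (L2_inner \<Omega> (u j) (u j))" for j
  define \<psi> where "\<psi> k j = (\<lambda>x. c j *\<^sub>R \<phi> j k x)" for k j
  have cu: "c i * c j * L2_inner \<Omega> (u i) (u j) = (if i = j then 1 else 0)" if "i < N" "j < N" for i j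
  proof (cases "i = j")
    case True
    then show ?thesis
      using uL2[OF that(1)] by (simp add: c_def field_simps)
  next
    case False
    then have "l i \<noteq> l j"
      using l that by (auto simp: bij_betw_def inj_on_def)
    then show ?thesis
      using weak_eigenpair_orthogonal[OF \<Omega>(1) \<D> u[OF that(1)] u[OF that(2)]] False by simp
  qed
  have gram: "\<forall>\<^sub>F k in sequentially. \<bar>L2_inner \<Omega> (\<psi> k i) (\<psi> k j) - (if i = j then 1 else 0)\<bar> \<le> 1 / real N"
    if "i < N" "j < N" for i j
  proof -
    have "(\<lambda>k. L2_inner \<Omega> (\<phi> i k) (\<phi> j k)) \<longlonglongrightarrow> L2_inner \<Omega> (u i) (u j)"
      using \<phi>[OF that(1)] \<phi>[OF that(2)]
      by (intro L2_inner_tendsto uL2 that test_functions_L2[OF \<Omega>(1) test]) (auto simp: energy_approx_def)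
    then have "(\<lambda>k. c i * c j * L2_inner \<Omega> (\<phi> i k) (\<phi> j k)) \<longlonglongrightarrow> (if i = j then 1 else 0)"
      unfolding cu[OF that, symmetric] by (rule tendsto_mult_left)
    then have "(\<lambda>k. L2_inner \<Omega> (\<psi> k i) (\<psi> k j)) \<longlonglongrightarrow> (if i = j then 1 else 0)"
      by (simp add: \<psi>_def L2_inner_scaleR_left L2_inner_scaleR_right mult_ac)
    then have "\<forall>\<^sub>F k in sequentially. dist (L2_inner \<Omega> (\<psi> k i) (\<psi> k j)) (if i = j then 1 else 0) < 1 / real N"
      using \<open>N \<ge> 2\<close> by (intro tendstoD) auto
    then show ?thesis
      by eventually_elim (simp add: dist_real_def)
  qed
  have energy: "\<forall>\<^sub>F k in sequentially. dirichlet \<Omega> (\<psi> k j) (\<psi> k j) \<le> E'" if "j < N" for j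
  proof -
    have "(\<lambda>k. dirichlet \<Omega> (\<phi> j k) (\<phi> j k)) \<longlonglongrightarrow> l j * L2_inner \<Omega> (u j) (u j)"
      using u[OF that] \<phi>[OF that] by (intro dirichlet_tendsto[OF \<Omega>(1) \<D>]) (auto simp: weak_eigenpair_def)
    then have "(\<lambda>k. (c j)\<^sup>2 * dirichlet \<Omega> (\<phi> j k) (\<phi> j k)) \<longlonglongrightarrow> (c j)\<^sup>2 * (l j * L2_inner \<Omega> (u j) (u j))"
      by (rule tendsto_mult_left)
    moreover have "(c j)\<^sup>2 * (l j * L2_inner \<Omega> (u j) (u j)) = l j * (c j * c j * L2_inner \<Omega> (u j) (u j))"
      by (simp only: power2_eq_square mult_ac)
    ultimately have "(\<lambda>k. dirichlet \<Omega> (\<psi> k j) (\<psi> k j)) \<longlonglongrightarrow> l j"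
      unfolding cu[OF that that] by (simp add: \<psi>_def dirichlet_scaleR test that)
    then have "\<forall>\<^sub>F k in sequentially. dirichlet \<Omega> (\<psi> k j) (\<psi> k j) < E'"
      using l_le[OF that] by (intro order_tendstoD(2)) (auto simp: E'_def)
    then show ?thesis
      by eventually_elim simp
  qed
  have "\<forall>\<^sub>F k in sequentially. \<forall>i\<in>{..<N}. \<forall>j\<in>{..<N}.
      \<bar>L2_inner \<Omega> (\<psi> k i) (\<psi> k j) - (if i = j then 1 else 0)\<bar> \<le> 1 / real N"
    using gram by (intro eventually_ball_finite ballI) auto
  moreover have "\<forall>\<^sub>F k in sequentially. \<forall>j\<in>{..<N}. dirichlet \<Omega> (\<psi> k j) (\<psi> k j) \<le> E'"
    using energy by (intro eventually_ball_finite ballI) auto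
  ultimately have "\<forall>\<^sub>F k in sequentially. (\<forall>i\<in>{..<N}. \<forall>j\<in>{..<N}.
      \<bar>L2_inner \<Omega> (\<psi> k i) (\<psi> k j) - (if i = j then 1 else 0)\<bar> \<le> 1 / real N) \<and>
      (\<forall>j\<in>{..<N}. dirichlet \<Omega> (\<psi> k j) (\<psi> k j) \<le> E')"
    by (rule eventually_conj)
  from eventually_happens'[OF sequentially_bot this]
  obtain k where k: "\<forall>i\<in>{..<N}. \<forall>j\<in>{..<N}.
      \<bar>L2_inner \<Omega> (\<psi> k i) (\<psi> k j) - (if i = j then 1 else 0)\<bar> \<le> 1 / real N"
      "\<forall>j\<in>{..<N}. dirichlet \<Omega> (\<psi> k j) (\<psi> k j) \<le> E'"
    by blast
  have "real N * V \<le> 64 * real DIM('b) * measure lebesgue \<Omega>"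
    unfolding V_def
    by (rule almost_orthonormal_card_bound[OF \<Omega>, of E' N "\<psi> k"])
      (use \<open>N \<ge> 2\<close> k in \<open>auto simp: E'_def \<psi>_def intro!: test_functions_scaleR test\<close>)
  then show False
    using N_big by simp
qed

section \<open>Lower bound on thin shells\<close>

lemma partial_radial_component:
  fixes g :: "real \<Rightarrow> real" and x :: "real ^ 'n::finite"
  assumes "(g has_real_derivative g') (at (x \<bullet> x))"
  shows "partial i (\<lambda>x. g (x \<bullet> x) * x $ i) x = 2 * g' * (x $ i)\<^sup>2 + g (x \<bullet> x)"
proof -
  have "((\<lambda>x. g (x \<bullet> x)) has_derivative (\<lambda>h. g' * (2 * (x \<bullet> h)))) (at x)"
  proof (rule has_derivative_compose[where f = "\<lambda>x. x \<bullet> x" and f' = "\<lambda>h. 2 * (x \<bullet> h)" and g' = "\<lambda>h. g' * h"])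
    show "((\<lambda>x. x \<bullet> x) has_derivative (\<lambda>h. 2 * (x \<bullet> h))) (at x)"
      using has_derivative_inner[OF has_derivative_ident has_derivative_ident, of x UNIV]
      by (simp add: inner_commute)
    show "(g has_derivative (\<lambda>h. g' * h)) (at (x \<bullet> x))"
      using assms by (simp add: has_field_derivative_def)
  qed
  from partial_eqI[OF has_derivative_mult[OF this bounded_linear_imp_has_derivative[OF bounded_linear_vec_nth]], of i i]
  show ?thesis
    by (simp add: inner_axis power2_eq_square algebra_simps)
qed

text \<open>
  The field \<open>G x = g (x \<bullet> x) x\<close> plays the role of the logarithmic gradient of a positive
  supersolution: \<open>\<nabla>\<phi> - \<phi> G\<close> has non-negative square, and \<open>div G + |G|\<^sup>2 \<le> - c\<close>.
\<close>

lemma dirichlet_ge_of_Riccati: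
  fixes \<phi> :: "real ^ 'n::finite \<Rightarrow> real"
  assumes \<Omega>: "open \<Omega>" and \<phi>: "\<phi> \<in> test_functions \<Omega>"
    and T: "open T" "\<And>x. x \<in> \<Omega> \<Longrightarrow> x \<bullet> x \<in> T"
    and g: "\<And>s. s \<in> T \<Longrightarrow> (g has_real_derivative g' s) (at s)" "continuous_on T g'"
    and Riccati: "\<And>x. x \<in> \<Omega> \<Longrightarrow>
      2 * (x \<bullet> x) * g' (x \<bullet> x) + real CARD('n) * g (x \<bullet> x) + (x \<bullet> x) * (g (x \<bullet> x))\<^sup>2 \<le> - c"
  shows "c * L2_inner \<Omega> \<phi> \<phi> \<le> dirichlet \<Omega> \<phi> \<phi>"
proof -
  obtain K where K: "\<And>k. Ck k UNIV \<phi>" "compact K" "K \<subseteq> \<Omega>" "\<And>x. x \<notin> K \<Longrightarrow> \<phi> x = 0"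
    using \<phi> by (rule test_functionsE) blast
  define G where "G i x = g (x \<bullet> x) * x $ i" for i and x :: "real ^ 'n"
  have "Ck 1 T g"
    unfolding One_nat_def
    by (rule Ck_SucI[where f' = "\<lambda>s v. g' s * v"])
      (use T g in \<open>auto simp: has_field_derivative_def intro!: continuous_intros\<close>)
  moreover have "Ck 1 \<Omega> (\<lambda>x. x \<bullet> x)"
    by (intro Ck_inner Ck_bounded_linear_id bounded_linear_ident \<Omega>)
  ultimately have "Ck 1 \<Omega> (\<lambda>x. g (x \<bullet> x))"
    by (rule Ck_compose_real[OF \<Omega>]) (use T in auto)
  then have CG: "Ck 1 \<Omega> (G i)" for i
    unfolding G_def[abs_def] by (rule Ck_mult[OF \<Omega> _ Ck_bounded_linear_id[OF \<Omega> bounded_linear_vec_nth]])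
  have C\<phi>: "Ck 1 \<Omega> (\<lambda>x. \<phi> x * \<phi> x)"
    by (intro Ck_mult \<Omega> test_functions_Ck[OF \<phi>])
  have K0: "\<phi> x * \<phi> x = 0" if "x \<notin> K" for x
    using K(4)[OF that] by simp
  note ibp = integration_by_parts[OF bounded_bilinear_mult \<Omega> C\<phi> CG K(2,3) K0]
  \<comment> \<open>The sum of \<open>?h i x\<close> over \<open>i\<close> is the divergence of
    \<open>\<phi>\<^sup>2 G\<close>, whose integral vanishes.\<close>
  let ?h = "\<lambda>i x. partial i (\<lambda>x. \<phi> x * \<phi> x) x * G i x + \<phi> x * \<phi> x * partial i (G i) x"
  have int_h: "integrable (lebesgue_on \<Omega>) (?h i)" "(LINT x|lebesgue_on \<Omega>. ?h i x) = 0" for i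
    using ibp[of i i] by auto
  have L2: "\<phi> \<in> L2 \<Omega>" "partial i \<phi> \<in> L2 \<Omega>" for i
    using test_functions_L2[OF \<Omega>] test_functions_partial \<phi> by blast+
  have pointwise: "(\<Sum>i\<in>UNIV. ?h i x) \<le> (\<Sum>i\<in>UNIV. partial i \<phi> x \<bullet> partial i \<phi> x) - c * (\<phi> x \<bullet> \<phi> x)"
    if x: "x \<in> \<Omega>" for x
  proof -
    let ?s = "x \<bullet> x"
    have s: "?s = (\<Sum>i\<in>UNIV. (x $ i)\<^sup>2)"
      by (simp add: inner_vec_def power2_eq_square)
    have eq: "?h i x = 2 * (partial i \<phi> x * (\<phi> x * g ?s * x $ i)) + (\<phi> x)\<^sup>2 * (2 * g' ?s * (x $ i)\<^sup>2 + g ?s)" for i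
      using partial_bilinear[OF bounded_bilinear_mult test_functions_differentiable[OF \<phi>]
          test_functions_differentiable[OF \<phi>], of i x]
        partial_radial_component[OF g(1)[OF T(2)[OF x]], of i, folded G_def]
      by (simp add: G_def[of i x] power2_eq_square algebra_simps)
    have le: "2 * (partial i \<phi> x * (\<phi> x * g ?s * x $ i)) \<le>
        (partial i \<phi> x)\<^sup>2 + (\<phi> x)\<^sup>2 * (g ?s)\<^sup>2 * (x $ i)\<^sup>2" for i
      using sum_squares_bound[of "partial i \<phi> x" "\<phi> x * g ?s * x $ i"]
      by (simp add: power_mult_distrib mult.assoc)
    have "?h i x \<le> (partial i \<phi> x)\<^sup>2 + (\<phi> x)\<^sup>2 * (g ?s)\<^sup>2 * (x $ i)\<^sup>2 +
        (\<phi> x)\<^sup>2 * (2 * g' ?s * (x $ i)\<^sup>2 + g ?s)" for i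
      unfolding eq by (intro add_right_mono le)
    then have "(\<Sum>i\<in>UNIV. ?h i x) \<le> (\<Sum>i\<in>UNIV. (partial i \<phi> x)\<^sup>2 + (\<phi> x)\<^sup>2 * (g ?s)\<^sup>2 * (x $ i)\<^sup>2 +
        (\<phi> x)\<^sup>2 * (2 * g' ?s * (x $ i)\<^sup>2 + g ?s))"
      by (rule sum_mono)
    also have "\<dots> = (\<Sum>i\<in>UNIV. (partial i \<phi> x)\<^sup>2) +
        (\<phi> x)\<^sup>2 * (2 * ?s * g' ?s + real CARD('n) * g ?s + ?s * (g ?s)\<^sup>2)"
    proof -
      have "(\<Sum>i\<in>UNIV. f i + p * q * (x $ i)\<^sup>2 + p * (2 * r * (x $ i)\<^sup>2 + t)) =
          (\<Sum>i\<in>UNIV. f i) + p * q * ?s + p * (2 * r * ?s + real CARD('n) * t)" for f p q r t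
        unfolding s by (simp add: sum.distrib sum_distrib_left distrib_left mult.assoc)
      from this[of "\<lambda>i. (partial i \<phi> x)\<^sup>2" "(\<phi> x)\<^sup>2" "(g ?s)\<^sup>2" "g' ?s" "g ?s"] show ?thesis
        by (simp only:) (simp add: algebra_simps)
    qed
    also have "\<dots> \<le> (\<Sum>i\<in>UNIV. (partial i \<phi> x)\<^sup>2) + (\<phi> x)\<^sup>2 * (- c)"
      using Riccati[OF x] by (intro add_mono mult_left_mono) auto
    finally show ?thesis
      by (simp add: power2_eq_square mult.commute)
  qed
  have "0 = (LINT x|lebesgue_on \<Omega>. (\<Sum>i\<in>UNIV. ?h i x))"
    using int_h by (subst Bochner_Integration.integral_sum) auto
  also have "\<dots> \<le> (LINT x|lebesgue_on \<Omega>. (\<Sum>i\<in>UNIV. partial i \<phi> x \<bullet> partial i \<phi> x) - c * (\<phi> x \<bullet> \<phi> x))"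
    using int_h L2 pointwise
    by (intro integral_mono Bochner_Integration.integrable_sum Bochner_Integration.integrable_diff
        integrable_mult_right L2_integrable_inner) auto
  also have "\<dots> = dirichlet \<Omega> \<phi> \<phi> - c * L2_inner \<Omega> \<phi> \<phi>"
  proof -
    have "integrable (lebesgue_on \<Omega>) (\<lambda>x. partial i \<phi> x \<bullet> partial i \<phi> x)"
        "integrable (lebesgue_on \<Omega>) (\<lambda>x. \<phi> x \<bullet> \<phi> x)" for i
      using L2 L2_integrable_inner by blast+
    then show ?thesis
      unfolding dirichlet_def L2_inner_def
      by (simp del: inner_real_def)
  qed
  finally show ?thesis by simp
qed

text \<open>Norm and energy both split into sums over an orthonormal basis of the codomain, so the
  scalar bound holds for fields with the same constant, in particular for solenoidal ones.\<close>

lemma dirichlet_ge_componentwise: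
  fixes \<phi> :: "real ^ 'n::finite \<Rightarrow> 'b::euclidean_space"
  assumes \<Omega>: "open \<Omega>" and \<phi>: "\<phi> \<in> test_functions \<Omega>"
    and c: "\<And>\<psi> :: real ^ 'n \<Rightarrow> real. \<psi> \<in> test_functions \<Omega> \<Longrightarrow> c * L2_inner \<Omega> \<psi> \<psi> \<le> dirichlet \<Omega> \<psi> \<psi>"
  shows "c * L2_inner \<Omega> \<phi> \<phi> \<le> dirichlet \<Omega> \<phi> \<phi>"
proof -
  have sum: "L2_inner \<Omega> \<psi> \<psi> = (\<Sum>b\<in>Basis. L2_inner \<Omega> (\<lambda>x. \<psi> x \<bullet> b) (\<lambda>x. \<psi> x \<bullet> b))"
    if \<psi>: "\<psi> \<in> test_functions \<Omega>" for \<psi> :: "real ^ 'n \<Rightarrow> 'b"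
  proof -
    have "integrable (lebesgue_on \<Omega>) (\<lambda>x. (\<psi> x \<bullet> b) \<bullet> (\<psi> x \<bullet> b))" for b
      by (intro L2_integrable_inner test_functions_L2 \<Omega> test_functions_inner \<psi>)
    then have "(LINT x|lebesgue_on \<Omega>. (\<Sum>b\<in>Basis. (\<psi> x \<bullet> b) \<bullet> (\<psi> x \<bullet> b))) =
        (\<Sum>b\<in>Basis. LINT x|lebesgue_on \<Omega>. (\<psi> x \<bullet> b) \<bullet> (\<psi> x \<bullet> b))"
      by (rule Bochner_Integration.integral_sum)
    moreover have "(\<Sum>b\<in>Basis. (\<psi> x \<bullet> b) \<bullet> (\<psi> x \<bullet> b)) = \<psi> x \<bullet> \<psi> x" for x
      unfolding inner_real_def by (rule euclidean_inner[symmetric])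
    ultimately show ?thesis
      unfolding L2_inner_def by (simp only:)
  qed
  have "partial i (\<lambda>x. \<phi> x \<bullet> b) = (\<lambda>x. partial i \<phi> x \<bullet> b)" for i b
    using partial_inner_const[OF test_functions_differentiable[OF \<phi>]] by blast
  then have "dirichlet \<Omega> \<phi> \<phi> = (\<Sum>b\<in>Basis. dirichlet \<Omega> (\<lambda>x. \<phi> x \<bullet> b) (\<lambda>x. \<phi> x \<bullet> b))"
    unfolding dirichlet_def
    by (subst sum.swap) (simp add: sum[OF test_functions_partial[OF \<phi>]])
  moreover have "(\<Sum>b\<in>Basis. c * L2_inner \<Omega> (\<lambda>x. \<phi> x \<bullet> b) (\<lambda>x. \<phi> x \<bullet> b)) \<le>
      (\<Sum>b\<in>Basis. dirichlet \<Omega> (\<lambda>x. \<phi> x \<bullet> b) (\<lambda>x. \<phi> x \<bullet> b))"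
    by (intro sum_mono c test_functions_inner \<phi>)
  ultimately show ?thesis
    by (simp add: sum[OF \<phi>] sum_distrib_left)
qed

section \<open>The lower bound on the shell\<close>

lemma open_annulus: "open (annulus A)"
proof -
  have "open ({x. A / 2 < norm x} \<inter> {x. norm x < 1 + A / 2})"
    by (intro open_Int open_Collect_less continuous_intros)
  then show ?thesis
    by (simp add: annulus_def Collect_conj_eq)
qed

lemma bounded_annulus: "bounded (annulus A)"
  by (rule bounded_subset[of "cball 0 (1 + A / 2)"]) (auto simp: annulus_def)

text \<open>
  The logarithmic derivative of \<open>cos (\<beta> (s - s\<^sub>0))\<close> in \<open>s = |x|\<^sup>2\<close>, with \<open>s\<^sub>0\<close> the mid point of the
  range of \<open>s\<close>; the range has length \<open>2 a + 1\<close>, so that \<open>\<beta> = w / (2 a + 1)\<close> with \<open>w < \<pi>\<close> keeps the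
  cosine away from zero.
\<close>

lemma annulus_dirichlet_ge:
  assumes "c < pi\<^sup>2"
  shows "\<forall>\<^sub>F A in at_top. \<forall>\<phi> \<in> test_functions (annulus A :: (real ^ 'n::finite) set).
    c * L2_inner (annulus A) \<phi> \<phi> \<le> dirichlet (annulus A) \<phi> (\<phi> :: real ^ 'n \<Rightarrow> 'b::euclidean_space)"
proof -
  \<comment> \<open>The maximum with 0 under the root is there because \<open>c\<close> may be
    negative.\<close>
  obtain w where w: "0 < w" "w < pi" "c < w\<^sup>2"
  proof -
    have "sqrt (max c 0) < pi"
      using assms by (intro real_less_lsqrt) auto
    then obtain w where "sqrt (max c 0) < w" "w < pi"
      using dense by blast
    moreover from this have "0 < w"
      using real_sqrt_ge_zero[of "max c 0"] by linarith
    moreover have "c < w\<^sup>2"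
      using calculation(1,3) real_less_rsqrt sqrt_le_D[of "w\<^sup>2"]
      by (metis max.cobounded1 not_less order.strict_trans1 real_sqrt_le_iff real_sqrt_unique less_imp_le max.coboundedI1 order_trans)
    ultimately show thesis
      using that by blast
  qed
  define n where "n = real CARD('n)"
  define M where "M = tan (w / 2)"
  \<comment> \<open>With \<open>\<beta> = w / (A + 1)\<close> the first term is the least value of
    \<open>4 s \<beta>\<^sup>2\<close> on the shell; the second bounds the contribution of the
    dimension, where \<open>M\<close> is the maximum of the tangent.\<close>
  have "((\<lambda>A. A\<^sup>2 * (w / (A + 1))\<^sup>2 - 2 * n * (w / (A + 1)) * M) \<longlongrightarrow> w\<^sup>2) at_top"
  proof -
    have "((\<lambda>A::real. A / (A + 1)) \<longlongrightarrow> 1) at_top" "((\<lambda>A::real. 1 / (A + 1)) \<longlongrightarrow> 0) at_top"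
      by real_asymp+
    then have "((\<lambda>A. (A / (A + 1))\<^sup>2 * w\<^sup>2 - 2 * n * (w * (1 / (A + 1))) * M) \<longlongrightarrow>
        1\<^sup>2 * w\<^sup>2 - 2 * n * (w * 0) * M) at_top"
      by (intro tendsto_intros)
    then show ?thesis
      by (simp add: power_divide)
  qed
  then have "\<forall>\<^sub>F A in at_top. c < A\<^sup>2 * (w / (A + 1))\<^sup>2 - 2 * n * (w / (A + 1)) * M"
    using w by (intro order_tendstoD(1)) auto
  moreover have "\<forall>\<^sub>F A::real in at_top. A > 0"
    by (rule eventually_gt_at_top)
  ultimately show ?thesis
  proof eventually_elim
    case (elim A)
    let ?\<Omega> = "annulus A :: (real ^ 'n) set"
    define \<beta> where "\<beta> = w / (A + 1)"
    define s0 where "s0 = ((A / 2)\<^sup>2 + (1 + A / 2)\<^sup>2) / 2"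
    define T where "T = {s. \<bar>\<beta> * (s - s0)\<bar> < pi / 2}"
    \<comment> \<open>The factor 2 is that of the gradient \<open>2 x\<close> of
      \<open>x \<bullet> x\<close>.\<close>
    define g where "g s = - 2 * \<beta> * tan (\<beta> * (s - s0))" for s
    define g' where "g' s = - 2 * \<beta>\<^sup>2 * (1 + (tan (\<beta> * (s - s0)))\<^sup>2)" for s
    have "\<beta> > 0"
      using w elim by (simp add: \<beta>_def)
    have cos: "cos (\<beta> * (s - s0)) > 0" if "s \<in> T" for s
      using that by (intro cos_gt_zero_pi) (auto simp: T_def)
    have range: "\<bar>\<beta> * (x \<bullet> x - s0)\<bar> \<le> w / 2" "(A / 2)\<^sup>2 \<le> x \<bullet> x" if x: "x \<in> ?\<Omega>" for x
    proof -
      have 1: "(A / 2)\<^sup>2 \<le> (norm x)\<^sup>2" "(norm x)\<^sup>2 \<le> (1 + A / 2)\<^sup>2"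
        using x elim by (auto simp: annulus_def intro!: power_mono)
      then have "\<bar>x \<bullet> x - s0\<bar> \<le> (A + 1) / 2"
        by (simp add: dot_square_norm s0_def power2_eq_square abs_le_iff field_simps)
      then have "\<beta> * \<bar>x \<bullet> x - s0\<bar> \<le> \<beta> * ((A + 1) / 2)"
        using \<open>\<beta> > 0\<close> by (intro mult_left_mono) auto
      then show "\<bar>\<beta> * (x \<bullet> x - s0)\<bar> \<le> w / 2"
        using \<open>\<beta> > 0\<close> elim w by (simp add: abs_mult \<beta>_def)
      show "(A / 2)\<^sup>2 \<le> x \<bullet> x"
        using 1 by (simp add: dot_square_norm)
    qed
    have main: "c * L2_inner ?\<Omega> \<psi> \<psi> \<le> dirichlet ?\<Omega> \<psi> \<psi>" if "\<psi> \<in> test_functions ?\<Omega>"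
      for \<psi> :: "real ^ 'n \<Rightarrow> real"
    proof (rule dirichlet_ge_of_Riccati[OF open_annulus that, of T g g'])
      show "open T"
        unfolding T_def by (intro open_Collect_less continuous_intros)
      show "x \<bullet> x \<in> T" if "x \<in> ?\<Omega>" for x
        using range(1)[OF that] w by (simp add: T_def)
      show "(g has_real_derivative g' s) (at s)" if "s \<in> T" for s
      proof -
        have "1 + (tan (\<beta> * (s - s0)))\<^sup>2 = inverse ((cos (\<beta> * (s - s0)))\<^sup>2)"
          using tan_sec[of "\<beta> * (s - s0)"] cos[OF that] by (simp add: power_inverse)
        then show ?thesis
          unfolding g_def[abs_def] g'_def using cos[OF that]
          by (auto intro!: derivative_eq_intros simp: power2_eq_square[of \<beta>])
      qed
      show "continuous_on T g'"
        unfolding g'_def[abs_def] using cos by (auto intro!: continuous_intros simp: less_imp_neq[symmetric])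
      fix x assume x: "x \<in> ?\<Omega>"
      let ?t = "tan (\<beta> * (x \<bullet> x - s0))"
      have "- M \<le> ?t"
      proof -
        have "tan (- (w / 2)) \<le> ?t"
          using range(1)[OF x] w by (intro tan_mono_le) auto
        then show ?thesis
          by (simp add: M_def)
      qed
      then have "2 * n * \<beta> * (- M) \<le> 2 * n * \<beta> * ?t"
        using \<open>\<beta> > 0\<close> by (intro mult_left_mono) (auto simp: n_def)
      then have "- (2 * n * \<beta> * ?t) \<le> 2 * n * \<beta> * M"
        unfolding mult_minus_right by linarith
      moreover have "4 * (A / 2)\<^sup>2 * \<beta>\<^sup>2 \<le> 4 * (x \<bullet> x) * \<beta>\<^sup>2"
        using range(2)[OF x] by (intro mult_right_mono) auto
      \<comment> \<open>The squared tangents coming from \<open>g'\<close> and from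
        \<open>g\<^sup>2\<close> cancel; this is the reason for a cosine in
        \<open>s\<close>.\<close>
      moreover have "2 * (x \<bullet> x) * g' (x \<bullet> x) + n * g (x \<bullet> x) + (x \<bullet> x) * (g (x \<bullet> x))\<^sup>2 =
          - (4 * (x \<bullet> x) * \<beta>\<^sup>2) - 2 * n * \<beta> * ?t"
        by (simp add: g_def g'_def power_mult_distrib algebra_simps)
      moreover have "c < 4 * (A / 2)\<^sup>2 * \<beta>\<^sup>2 - 2 * n * \<beta> * M"
        using elim(1) by (simp add: \<beta>_def power_divide)
      ultimately show "2 * (x \<bullet> x) * g' (x \<bullet> x) + real CARD('n) * g (x \<bullet> x) + (x \<bullet> x) * (g (x \<bullet> x))\<^sup>2 \<le> - c"
        unfolding n_def[symmetric] by linarith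
    qed
    show ?case
      using dirichlet_ge_componentwise[OF open_annulus _ main] by blast
  qed
qed

section \<open>The radial equation\<close>

text \<open>
  In the variable \<open>t = (|x|\<^sup>2 - a\<^sup>2) / (2 a)\<close>, with \<open>\<epsilon> = 1 / a\<close>, the radial eigenvalue equation in
  dimension \<open>m\<close> becomes \<open>(1 + 2 \<epsilon> t) y'' + m \<epsilon> y' + \<lambda> y = 0\<close>, and the spherical shell becomes
  \<open>0 < t < 1 + \<epsilon> / 2\<close>. These are the Taylor coefficients of the solution with \<open>y(0) = 0\<close>, \<open>y'(0) = 1\<close>.
\<close>

fun radial_coeff :: "real \<Rightarrow> real \<Rightarrow> real \<Rightarrow> nat \<Rightarrow> real" where
  "radial_coeff m \<epsilon> l 0 = 0"
| "radial_coeff m \<epsilon> l (Suc 0) = 1"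
| "radial_coeff m \<epsilon> l (Suc (Suc k)) =
     - (\<epsilon> * (2 * real k + m) / (real k + 2)) * radial_coeff m \<epsilon> l (Suc k)
     - l / ((real k + 1) * (real k + 2)) * radial_coeff m \<epsilon> l k"

definition radial_solution :: "real \<Rightarrow> real \<Rightarrow> real \<Rightarrow> real \<Rightarrow> real" where
  "radial_solution m \<epsilon> l t = (\<Sum>k. radial_coeff m \<epsilon> l k * t ^ k)"

text \<open>
  The constant 20 bounds the eigenvalue parameter \<open>l \<le> \<pi>\<^sup>2 + 1\<close>, because \<open>\<pi> < 4\<close>.
\<close>

fun coeff_bound :: "nat \<Rightarrow> real" where
  "coeff_bound 0 = 0"
| "coeff_bound (Suc 0) = 1"
| "coeff_bound (Suc (Suc k)) =
     1 / 4 * coeff_bound (Suc k) + 20 / ((real k + 1) * (real k + 2)) * coeff_bound k"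

lemma coeff_bound_nonneg: "0 \<le> coeff_bound k"
  by (induction k rule: coeff_bound.induct) (auto intro!: add_nonneg_nonneg mult_nonneg_nonneg divide_nonneg_nonneg)

text \<open>Once \<open>k \<ge> 12\<close> the factor \<open>20 / ((k + 1) (k + 2))\<close> is at
  most \<open>20 / 182 < 1 / 8\<close>, and \<open>1 / 4 * 1 / 2 + 1 / 8 = 1 / 4\<close> reproduces
  the ratio \<open>1 / 2\<close> per index. The constant \<open>C\<close> absorbs the 14 initial
  values. The resulting convergence for \<open>|t| < 2\<close> covers a neighbourhood of the closed
  shell.\<close>

lemma coeff_bound_geometric: "\<exists>C\<ge>0. \<forall>k. coeff_bound k \<le> C / 2 ^ k"
proof -
  define C where "C = (\<Sum>k<14. coeff_bound k * 2 ^ k)"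
  have "C \<ge> 0"
    by (simp add: C_def sum_nonneg coeff_bound_nonneg)
  have small: "coeff_bound k \<le> C / 2 ^ k" if "k < 14" for k
  proof -
    have "coeff_bound k * 2 ^ k \<le> C"
      unfolding C_def using that
      by (intro member_le_sum) (auto simp: coeff_bound_nonneg)
    then show ?thesis
      by (simp add: field_simps)
  qed
  have "coeff_bound k \<le> C / 2 ^ k" for k
  proof (induction k rule: coeff_bound.induct)
    case (3 k)
    show ?case
    proof (cases "Suc (Suc k) < 14")
      case False
      then have "real k \<ge> 12"
        by simp
      then have "13 * 14 \<le> (real k + 1) * (real k + 2)"
        by (intro mult_mono) auto
      then have "20 / ((real k + 1) * (real k + 2)) \<le> 1 / 8"
        by (simp add: divide_le_eq)
      then have "20 / ((real k + 1) * (real k + 2)) * coeff_bound k \<le> 1 / 8 * (C / 2 ^ k)"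
        using 3 by (intro mult_mono coeff_bound_nonneg) auto
      moreover have "1 / 4 * coeff_bound (Suc k) \<le> 1 / 4 * (C / 2 ^ Suc k)"
        using 3 by (intro mult_left_mono) auto
      ultimately have "coeff_bound (Suc (Suc k)) \<le> 1 / 4 * (C / 2 ^ Suc k) + 1 / 8 * (C / 2 ^ k)"
        by simp
      also have "\<dots> = C / 2 ^ Suc (Suc k)"
        by (simp add: field_simps)
      finally show ?thesis .
    qed (rule small)
  qed (rule small, simp)+
  then show ?thesis
    using \<open>C \<ge> 0\<close> by blast
qed

text \<open>From \<open>2 \<le> m\<close> follows \<open>2 k + m \<le> m (k + 2)\<close>, so the
  first coefficient of the recursion is at most \<open>\<epsilon> m \<le> 1 / 4\<close> for every
  \<open>k\<close>. The majorant depends neither on \<open>\<epsilon>\<close> nor on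
  \<open>l\<close>, which later gives uniform convergence in both.\<close>

lemma radial_coeff_le:
  assumes "2 \<le> m" "0 \<le> \<epsilon>" "\<epsilon> * m \<le> 1 / 4" "0 \<le> l" "l \<le> 20"
  shows "\<bar>radial_coeff m \<epsilon> l k\<bar> \<le> coeff_bound k"
proof (induction k rule: coeff_bound.induct)
  case (3 k)
  have "\<epsilon> * (2 * real k + m) \<le> \<epsilon> * (m * (real k + 2))"
    using assms(1,2) mult_right_mono[of 2 m "real k"]
    by (intro mult_left_mono) (simp_all add: algebra_simps)
  also have "\<dots> \<le> 1 / 4 * (real k + 2)"
    using assms(3) mult_right_mono[of "\<epsilon> * m" "1 / 4" "real k + 2"] by (simp add: mult.assoc)
  finally have "\<epsilon> * (2 * real k + m) / (real k + 2) \<le> 1 / 4"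
    by (simp add: divide_le_eq)
  then have 1: "\<bar>\<epsilon> * (2 * real k + m) / (real k + 2) * radial_coeff m \<epsilon> l (Suc k)\<bar> \<le>
      1 / 4 * coeff_bound (Suc k)"
    unfolding abs_mult[of _ "radial_coeff m \<epsilon> l (Suc k)"] using assms(1,2) 3
    by (intro mult_mono) (auto intro!: mult_nonneg_nonneg divide_nonneg_nonneg)
  have 2: "\<bar>l / ((real k + 1) * (real k + 2)) * radial_coeff m \<epsilon> l k\<bar> \<le>
      20 / ((real k + 1) * (real k + 2)) * coeff_bound k"
    unfolding abs_mult[of _ "radial_coeff m \<epsilon> l k"] using assms(4,5) 3
    by (intro mult_mono) (auto intro!: mult_nonneg_nonneg divide_right_mono)
  have "radial_coeff m \<epsilon> l (Suc (Suc k)) =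
      - (\<epsilon> * (2 * real k + m) / (real k + 2) * radial_coeff m \<epsilon> l (Suc k)) -
      l / ((real k + 1) * (real k + 2)) * radial_coeff m \<epsilon> l k"
    by simp
  moreover have "\<bar>z\<bar> \<le> p + q" if "z = - x - y" "\<bar>x\<bar> \<le> p" "\<bar>y\<bar> \<le> q" for x y z p q :: real
    using that by arith
  ultimately show ?case
    unfolding coeff_bound.simps using 1 2 by blast
qed auto

lemma radial_coeff_geometric:
  assumes "2 \<le> m"
  obtains C where "C \<ge> 0" "\<And>\<epsilon> l k. 0 \<le> \<epsilon> \<Longrightarrow> \<epsilon> * m \<le> 1 / 4 \<Longrightarrow> 0 \<le> l \<Longrightarrow> l \<le> 20 \<Longrightarrow>
    \<bar>radial_coeff m \<epsilon> l k\<bar> \<le> C / 2 ^ k"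
proof -
  obtain C where C: "C \<ge> 0" "\<And>k. coeff_bound k \<le> C / 2 ^ k"
    using coeff_bound_geometric by blast
  show thesis
    by (rule that[OF C(1)]) (rule order_trans[OF radial_coeff_le[OF assms] C(2)])
qed

lemma radial_coeff_summable:
  assumes "2 \<le> m" "0 \<le> \<epsilon>" "\<epsilon> * m \<le> 1 / 4" "0 \<le> l" "l \<le> 20" "\<bar>t\<bar> < 2"
  shows "summable (\<lambda>k. radial_coeff m \<epsilon> l k * t ^ k)"
proof -
  obtain C where C: "C \<ge> 0" "\<And>\<epsilon> l k. 0 \<le> \<epsilon> \<Longrightarrow> \<epsilon> * m \<le> 1 / 4 \<Longrightarrow> 0 \<le> l \<Longrightarrow> l \<le> 20 \<Longrightarrow>
    \<bar>radial_coeff m \<epsilon> l k\<bar> \<le> C / 2 ^ k"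
    using radial_coeff_geometric[OF assms(1)] by blast
  have "summable (\<lambda>k. C * (\<bar>t\<bar> / 2) ^ k)"
    using assms(6) by (intro summable_mult summable_geometric) simp
  then show ?thesis
  proof (rule summable_comparison_test'[where N = 0])
    show "norm (radial_coeff m \<epsilon> l k * t ^ k) \<le> C * (\<bar>t\<bar> / 2) ^ k" for k
      using mult_right_mono[OF C(2)[OF assms(2-5), of k], of "\<bar>t\<bar> ^ k"]
      by (simp add: abs_mult power_abs power_divide)
  qed
qed

lemma Ck_radial_solution:
  assumes "2 \<le> m" "0 \<le> \<epsilon>" "\<epsilon> * m \<le> 1 / 4" "0 \<le> l" "l \<le> 20"
  shows "Ck k {-2<..<2} (radial_solution m \<epsilon> l)"
  unfolding radial_solution_def[abs_def]
  by (rule Ck_powser) (rule radial_coeff_summable[OF assms])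

lemma radial_solution_ODE:
  assumes "2 \<le> m" "0 \<le> \<epsilon>" "\<epsilon> * m \<le> 1 / 4" "0 \<le> l" "l \<le> 20" and t: "t \<in> {-2<..<2}"
  shows "(1 + 2 * \<epsilon> * t) * deriv (deriv (radial_solution m \<epsilon> l)) t +
    m * \<epsilon> * deriv (radial_solution m \<epsilon> l) t + l * radial_solution m \<epsilon> l t = 0"
    and "deriv (radial_solution m \<epsilon> l) 0 = 1"
proof -
  let ?c = "radial_coeff m \<epsilon> l"
  have sm: "summable (\<lambda>k. ?c k * t ^ k)" if "norm t < 2" for t :: real
    using radial_coeff_summable[OF assms(1-5)] that by simp
  have sm1: "summable (\<lambda>k. diffs ?c k * t ^ k)" if "norm t < 2" for t :: real
    using termdiff_converges[OF that sm] by simp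
  have sm2: "summable (\<lambda>k. diffs (diffs ?c) k * t ^ k)" if "norm t < 2" for t :: real
    using termdiff_converges[OF that sm1] by simp
  have d1: "deriv (radial_solution m \<epsilon> l) t = (\<Sum>k. diffs ?c k * t ^ k)" if "norm t < 2" for t
    unfolding radial_solution_def[abs_def]
    using termdiffs_strong'[OF sm that] by (rule DERIV_imp_deriv)
  have d2: "deriv (deriv (radial_solution m \<epsilon> l)) t = (\<Sum>k. diffs (diffs ?c) k * t ^ k)" if t: "norm t < 2" for t
  proof (rule DERIV_imp_deriv)
    show "(deriv (radial_solution m \<epsilon> l) has_real_derivative (\<Sum>k. diffs (diffs ?c) k * t ^ k)) (at t)"
      by (rule has_field_derivative_transform_within_open[OF termdiffs_strong'[OF sm1 t], of "{-2<..<2}"])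
        (use t d1 in auto)
  qed
  have "deriv (radial_solution m \<epsilon> l) 0 = diffs ?c 0"
    by (subst d1) (simp_all add: powser_zero)
  then show "deriv (radial_solution m \<epsilon> l) 0 = 1"
    by (simp add: diffs_def)
  have t2: "norm t < 2"
    using t by auto
  have s0: "(\<lambda>k. ?c k * t ^ k) sums radial_solution m \<epsilon> l t"
    unfolding radial_solution_def using sm[OF t2] by (rule summable_sums)
  have s1: "(\<lambda>k. diffs ?c k * t ^ k) sums deriv (radial_solution m \<epsilon> l) t"
    unfolding d1[OF t2] using sm1[OF t2] by (rule summable_sums)
  have s2: "(\<lambda>k. diffs (diffs ?c) k * t ^ k) sums deriv (deriv (radial_solution m \<epsilon> l)) t"
    unfolding d2[OF t2] using sm2[OF t2] by (rule summable_sums)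
  \<comment> \<open>Multiplication by \<open>t\<close> shifts the index by one; the new term at
    \<open>k = 0\<close> vanishes because of the factor \<open>real k\<close>.\<close>
  have s3: "(\<lambda>k. real k * diffs ?c k * t ^ k) sums (t * deriv (deriv (radial_solution m \<epsilon> l)) t)"
  proof -
    have "(\<lambda>k. t * (diffs (diffs ?c) k * t ^ k)) sums (t * deriv (deriv (radial_solution m \<epsilon> l)) t)"
      by (rule sums_mult[OF s2])
    also have "(\<lambda>k. t * (diffs (diffs ?c) k * t ^ k)) = (\<lambda>k. real (Suc k) * diffs ?c (Suc k) * t ^ Suc k)"
      by (auto simp: diffs_def[of "diffs ?c"])
    finally show ?thesis
      using sums_Suc_iff[of "\<lambda>k. real k * diffs ?c k * t ^ k"] by simp
  qed
  have "(\<lambda>k. diffs (diffs ?c) k * t ^ k + 2 * \<epsilon> * (real k * diffs ?c k * t ^ k) +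
      m * \<epsilon> * (diffs ?c k * t ^ k) + l * (?c k * t ^ k)) sums
    (deriv (deriv (radial_solution m \<epsilon> l)) t + 2 * \<epsilon> * (t * deriv (deriv (radial_solution m \<epsilon> l)) t) +
     m * \<epsilon> * deriv (radial_solution m \<epsilon> l) t + l * radial_solution m \<epsilon> l t)"
    by (intro sums_add sums_mult s0 s1 s2 s3)
  moreover have "diffs (diffs ?c) k * t ^ k + 2 * \<epsilon> * (real k * diffs ?c k * t ^ k) +
      m * \<epsilon> * (diffs ?c k * t ^ k) + l * (?c k * t ^ k) = 0" for k
  proof -
    \<comment> \<open>The recursion with denominators cleared; it is the coefficient of
      \<open>t^k\<close> in the differential equation.\<close>
    have "(real k + 1) * (real k + 2) * ?c (Suc (Suc k)) =
        - (real k + 1) * (\<epsilon> * (2 * real k + m)) * ?c (Suc k) - l * ?c k"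
      by (simp add: divide_simps) (simp add: algebra_simps)
    then have "diffs (diffs ?c) k + 2 * \<epsilon> * (real k * diffs ?c k) + m * \<epsilon> * diffs ?c k + l * ?c k = 0"
      unfolding diffs_def by (simp add: algebra_simps del: radial_coeff.simps)
    then have "(diffs (diffs ?c) k + 2 * \<epsilon> * (real k * diffs ?c k) + m * \<epsilon> * diffs ?c k + l * ?c k) * t ^ k = 0"
      by simp
    then show ?thesis
      by (simp only: distrib_right mult.assoc)
  qed
  ultimately have "(\<lambda>k. 0 :: real) sums
    (deriv (deriv (radial_solution m \<epsilon> l)) t + 2 * \<epsilon> * (t * deriv (deriv (radial_solution m \<epsilon> l)) t) +
     m * \<epsilon> * deriv (radial_solution m \<epsilon> l) t + l * radial_solution m \<epsilon> l t)"
    by (simp only:)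
  from sums_unique2[OF this sums_zero]
  show "(1 + 2 * \<epsilon> * t) * deriv (deriv (radial_solution m \<epsilon> l)) t +
    m * \<epsilon> * deriv (radial_solution m \<epsilon> l) t + l * radial_solution m \<epsilon> l t = 0"
    by (simp add: algebra_simps)
qed

lemma continuous_on_radial_coeff:
  "continuous_on S (\<lambda>p. radial_coeff m (fst p) (snd p) k)"
  by (induction k rule: coeff_bound.induct) (auto intro!: continuous_intros)

text \<open>Continuity in \<open>\<epsilon>\<close> transfers signs from the limit case
  \<open>\<epsilon> = 0\<close>, continuity in \<open>l\<close> feeds the intermediate value
  theorem. The outer end point moves with \<open>\<epsilon>\<close> but stays below
  \<open>3 / 2\<close>, so the terms are dominated by \<open>(3 / 4)^k\<close>.\<close>

lemma continuous_on_radial_solution: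
  assumes "2 \<le> m"
  shows "continuous_on ({0..1 / (4 * m)} \<times> {0..20}) (\<lambda>p. radial_solution m (fst p) (snd p) (1 + fst p / 2))"
proof -
  obtain C where C: "C \<ge> 0" "\<And>\<epsilon> l k. 0 \<le> \<epsilon> \<Longrightarrow> \<epsilon> * m \<le> 1 / 4 \<Longrightarrow> 0 \<le> l \<Longrightarrow> l \<le> 20 \<Longrightarrow>
    \<bar>radial_coeff m \<epsilon> l k\<bar> \<le> C / 2 ^ k"
    using radial_coeff_geometric[OF assms(1)] by blast
  let ?S = "{0..1 / (4 * m)} \<times> {0..20::real}"
  have "uniform_limit ?S (\<lambda>n p. \<Sum>k<n. radial_coeff m (fst p) (snd p) k * (1 + fst p / 2) ^ k)
      (\<lambda>p. \<Sum>k. radial_coeff m (fst p) (snd p) k * (1 + fst p / 2) ^ k) sequentially"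
  proof (rule Weierstrass_m_test)
    show "summable (\<lambda>k. C * (3 / 4) ^ k)"
      by (intro summable_mult summable_geometric) simp
    fix k p assume p: "p \<in> ?S"
    then have 1: "0 \<le> fst p" "fst p * m \<le> 1 / 4" "0 \<le> snd p" "snd p \<le> 20"
      using assms by (auto simp: field_simps)
    have "1 / (4 * m) \<le> 1"
      using assms by (simp add: divide_le_eq)
    then have "\<bar>1 + fst p / 2\<bar> \<le> 3 / 2"
      using p by auto
    then have "\<bar>1 + fst p / 2\<bar> ^ k \<le> (3 / 2) ^ k"
      by (intro power_mono) auto
    then have "\<bar>radial_coeff m (fst p) (snd p) k\<bar> * \<bar>1 + fst p / 2\<bar> ^ k \<le> C / 2 ^ k * (3 / 2) ^ k"
      using C(2)[OF 1] C(1) by (intro mult_mono) auto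
    also have "C / 2 ^ k * (3 / 2) ^ k = C * (3 / 4) ^ k"
      by (simp add: power_divide flip: power_mult_distrib)
    finally show "norm (radial_coeff m (fst p) (snd p) k * (1 + fst p / 2) ^ k) \<le> C * (3 / 4) ^ k"
      by (simp add: abs_mult power_abs)
  qed
  then show ?thesis
    unfolding radial_solution_def
    by (rule uniform_limit_theorem[rotated])
      (auto intro!: always_eventually continuous_intros continuous_on_radial_coeff)
qed

text \<open>For \<open>\<epsilon> = 0\<close> the equation is \<open>y'' + w\<^sup>2 y = 0\<close>;
  multiplied by \<open>w\<close>, the coefficients satisfy the recursion of the sine series.\<close>

lemma radial_solution_0:
  assumes "0 < w"
  shows "radial_solution m 0 (w\<^sup>2) 1 = sin w / w"
proof -
  have "w * radial_coeff m 0 (w\<^sup>2) k = sin_coeff k * w ^ k" for k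
  proof (induction k rule: coeff_bound.induct)
    case (3 k)
    have "w * radial_coeff m 0 (w\<^sup>2) (Suc (Suc k)) =
        - (w\<^sup>2 / ((real k + 1) * (real k + 2))) * (w * radial_coeff m 0 (w\<^sup>2) k)"
      by simp
    also have "\<dots> = sin_coeff (Suc (Suc k)) * w ^ Suc (Suc k)"
      unfolding 3 by (simp add: sin_coeff_Suc cos_coeff_Suc power2_eq_square field_simps)
    finally show ?case .
  qed (auto simp: sin_coeff_def)
  then have "(\<lambda>k. w * (radial_coeff m 0 (w\<^sup>2) k * 1 ^ k)) sums sin w"
    using sin_converges[of w] by simp
  then have "(\<lambda>k. inverse w * (w * (radial_coeff m 0 (w\<^sup>2) k * 1 ^ k))) sums (inverse w * sin w)"
    by (rule sums_mult)
  then have "(\<lambda>k. radial_coeff m 0 (w\<^sup>2) k * 1 ^ k) sums (sin w / w)"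
    using assms by (simp add: mult.assoc[symmetric]) (simp add: divide_inverse mult.commute)
  then show ?thesis
    by (simp add: radial_solution_def sums_iff)
qed

text \<open>In the flat limit the end value is \<open>sin w / w\<close> with
  \<open>l = w\<^sup>2\<close>, which changes sign at \<open>w = \<pi>\<close>. The strict signs at
  \<open>\<pi>\<^sup>2 \<plusminus> \<delta>\<close> persist for small \<open>\<epsilon>\<close>,
  and a zero lies between.\<close>

lemma radial_eigenvalue_exists:
  assumes m: "2 \<le> m" and \<delta>: "0 < \<delta>" "\<delta> \<le> 1"
  shows "\<forall>\<^sub>F \<epsilon> in at_right 0. 0 < \<epsilon> \<and> \<epsilon> \<le> 1 / (4 * m) \<and>
    (\<exists>l\<in>{pi\<^sup>2 - \<delta>..pi\<^sup>2 + \<delta>}. radial_solution m \<epsilon> l (1 + \<epsilon> / 2) = 0)"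
proof -
  define H where "H \<epsilon> l = radial_solution m \<epsilon> l (1 + \<epsilon> / 2)" for \<epsilon> l
  define \<epsilon>0 where "\<epsilon>0 = 1 / (4 * m)"
  have "\<epsilon>0 > 0"
    using m by (simp add: \<epsilon>0_def)
  note cont = continuous_on_radial_solution[OF m, folded \<epsilon>0_def H_def]
  have pi2: "4 \<le> pi\<^sup>2" "pi\<^sup>2 \<le> 16"
    using power_mono[OF pi_ge_two, of 2] power_mono[OF less_imp_le[OF pi_less_4], of 2] by simp_all
  define w1 w2 where "w1 = sqrt (pi\<^sup>2 - \<delta>)" and "w2 = sqrt (pi\<^sup>2 + \<delta>)"
  have w_sq: "w1\<^sup>2 = pi\<^sup>2 - \<delta>" "w2\<^sup>2 = pi\<^sup>2 + \<delta>"
    using pi2 \<delta> by (simp_all add: w1_def w2_def)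
  have w1: "0 < w1" "w1 < pi"
    using pi2 \<delta> by (auto simp: w1_def intro!: real_less_lsqrt)
  \<comment> \<open>The bound \<open>2 * pi\<close> keeps \<open>w2\<close> in the half-period where
    the sine is negative.\<close>
  have w2: "pi < w2" "w2 < 2 * pi"
    using pi2 \<delta> by (auto simp: w2_def power_mult_distrib intro!: real_less_lsqrt real_less_rsqrt)
  have lim: "((\<lambda>\<epsilon>. H \<epsilon> l) \<longlongrightarrow> H 0 l) (at_right 0)" if "l \<in> {0..20}" for l
  proof -
    have "continuous_on {0..\<epsilon>0} (\<lambda>\<epsilon>. H (fst (\<epsilon>, l)) (snd (\<epsilon>, l)))"
      using that by (intro continuous_on_compose2[OF cont] continuous_intros) auto
    then show ?thesis
      using \<open>\<epsilon>0 > 0\<close> by (intro continuous_on_Icc_at_rightD[of 0 \<epsilon>0]) auto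
  qed
  have "H 0 (pi\<^sup>2 - \<delta>) > 0"
    using radial_solution_0[OF w1(1), of m] w1 sin_gt_zero[OF w1] by (simp add: H_def w_sq)
  then have "\<forall>\<^sub>F \<epsilon> in at_right 0. H \<epsilon> (pi\<^sup>2 - \<delta>) > 0"
    using pi2 \<delta> by (intro order_tendstoD(1)[OF lim]) auto
  moreover have "H 0 (pi\<^sup>2 + \<delta>) < 0"
    using radial_solution_0[of w2 m] w2 sin_lt_zero[OF w2] pi_gt_zero
    by (simp add: H_def w_sq divide_neg_pos)
  then have "\<forall>\<^sub>F \<epsilon> in at_right 0. H \<epsilon> (pi\<^sup>2 + \<delta>) < 0"
    using pi2 \<delta> by (intro order_tendstoD(2)[OF lim]) auto
  moreover have "\<forall>\<^sub>F \<epsilon> in at_right 0. \<epsilon> < \<epsilon>0" "\<forall>\<^sub>F \<epsilon>::real in at_right 0. 0 < \<epsilon>"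
    using \<open>\<epsilon>0 > 0\<close> by (auto simp: eventually_at_right_less eventually_at_right_field)
  ultimately show ?thesis
  proof eventually_elim
    case (elim \<epsilon>)
    have "continuous_on {pi\<^sup>2 - \<delta>..pi\<^sup>2 + \<delta>} (\<lambda>l. H (fst (\<epsilon>, l)) (snd (\<epsilon>, l)))"
      using elim pi2 \<delta> by (intro continuous_on_compose2[OF cont] continuous_intros) auto
    then have "\<exists>l\<ge>pi\<^sup>2 - \<delta>. l \<le> pi\<^sup>2 + \<delta> \<and> H \<epsilon> l = 0"
      using elim \<delta> by (intro IVT2') auto
    then show ?case
      using elim by (auto simp: H_def \<epsilon>0_def)
  qed
qed

section \<open>Weak derivatives\<close>

lemma L2_integrable_scaleR:
  fixes f :: "real ^ 'n::finite \<Rightarrow> real" and g :: "real ^ 'n \<Rightarrow> 'b::euclidean_space"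
  assumes "f \<in> L2 \<Omega>" "g \<in> L2 \<Omega>"
  shows "integrable (lebesgue_on \<Omega>) (\<lambda>x. f x *\<^sub>R g x)"
proof (rule Bochner_Integration.integrable_bound)
  show "integrable (lebesgue_on \<Omega>) (\<lambda>x. (norm (f x))\<^sup>2 + (norm (g x))\<^sup>2)"
    using assms by (auto simp: L2_def)
  show "(\<lambda>x. f x *\<^sub>R g x) \<in> borel_measurable (lebesgue_on \<Omega>)"
    using assms by (intro borel_measurable_scaleR L2_measurable)
  show "AE x in lebesgue_on \<Omega>. norm (f x *\<^sub>R g x) \<le> norm ((norm (f x))\<^sup>2 + (norm (g x))\<^sup>2)"
  proof (rule AE_I2)
    fix x
    show "norm (f x *\<^sub>R g x) \<le> norm ((norm (f x))\<^sup>2 + (norm (g x))\<^sup>2)"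
      using sum_squares_bound[of "norm (f x)" "norm (g x)"]
        mult_nonneg_nonneg[OF norm_ge_zero[of "f x"] norm_ge_zero[of "g x"]]
      by (simp del: mult_nonneg_nonneg)
  qed
qed

lemma L2_const:
  fixes c :: "'b::euclidean_space" and \<Omega> :: "(real ^ 'n::finite) set"
  assumes "open \<Omega>" "bounded \<Omega>"
  shows "(\<lambda>x. c) \<in> L2 \<Omega>"
  by (rule L2_bounded_continuous[OF assms, of _ "norm c"]) auto

lemma L2_integrable:
  fixes g :: "real ^ 'n::finite \<Rightarrow> 'b::euclidean_space"
  assumes "open \<Omega>" "bounded \<Omega>" "g \<in> L2 \<Omega>"
  shows "integrable (lebesgue_on \<Omega>) g"
  using L2_integrable_scaleR[OF L2_const[OF assms(1,2), of 1] assms(3)] by simp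

section \<open>The fundamental lemma of the calculus of variations\<close>

lemma box_approximation:
  fixes c d :: "real ^ 'n::finite"
  assumes "cbox c d \<subseteq> \<Omega>"
  obtains \<phi> :: "nat \<Rightarrow> real ^ 'n \<Rightarrow> real" where
    "\<And>k. \<phi> k \<in> test_functions \<Omega>" "\<And>k x. \<bar>\<phi> k x\<bar> \<le> 1"
    "\<And>x. (\<lambda>k. \<phi> k x) \<longlonglongrightarrow> indicator (box c d) x"
proof -
  \<comment> \<open>A step in \<open>k (x\<^sub>i - c\<^sub>i)\<close> times one in
    \<open>k (d\<^sub>i - x\<^sub>i)\<close>: zero off the open interval for every \<open>k\<close>,
    and 1 as soon as \<open>k\<close> exceeds the inverse distances to both faces.\<close>
  define p where "p k x i = step (real k * x $ i + (- real k * c $ i)) *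
      step ((- real k) * x $ i + real k * d $ i)" for k :: nat and x :: "real ^ 'n" and i
  define \<phi> where "\<phi> k x = (\<Prod>i\<in>UNIV. p k x i)" for k x
  have p01: "0 \<le> p k x i" "p k x i \<le> 1" for k x i
    by (auto simp: p_def step_nonneg step_le_1 intro: mult_le_one)
  have zero: "\<phi> k x = 0" if "x $ i \<le> c $ i \<or> d $ i \<le> x $ i" for k x i
  proof -
    have "real k * x $ i \<le> real k * c $ i \<or> real k * d $ i \<le> real k * x $ i"
      using that by (auto intro: mult_left_mono)
    then have "p k x i = 0"
      by (auto simp: p_def step_eq_0)
    then show ?thesis
      by (auto simp: \<phi>_def)
  qed
  have "\<phi> k \<in> test_functions \<Omega>" for k
  proof (rule test_functionsI[of _ "cbox c d"])
    fix j
    have "Ck j UNIV (\<lambda>x. step (r * x $ i + t))" for r t i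
      by (rule Ck_compose_real[OF open_UNIV Ck_step])
        (intro Ck_add Ck_mult Ck_const open_UNIV Ck_bounded_linear_id[OF open_UNIV bounded_linear_vec_nth]
          subset_UNIV)+
    then show "Ck j UNIV (\<phi> k)"
      unfolding \<phi>_def[abs_def] p_def[abs_def] by (intro Ck_prod Ck_mult open_UNIV)
    show "\<phi> k x = 0" if x: "x \<notin> cbox c d" for x
    proof -
      obtain i where "x $ i \<le> c $ i \<or> d $ i \<le> x $ i"
        using x by (auto simp: mem_box_cart not_le intro: less_imp_le)
      then show ?thesis
        by (rule zero)
    qed
  qed (use assms in auto)
  moreover have "\<bar>\<phi> k x\<bar> \<le> 1" for k x
  proof -
    have "0 \<le> \<phi> k x" "\<phi> k x \<le> 1"
      unfolding \<phi>_def using p01 by (auto intro!: prod_nonneg prod_le_1)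
    then show ?thesis by simp
  qed
  moreover have "(\<lambda>k. \<phi> k x) \<longlonglongrightarrow> indicator (box c d) x" for x
  proof (cases "x \<in> box c d")
    case True
    have "(\<lambda>k. p k x i) \<longlonglongrightarrow> 1" for i
    proof (rule tendsto_eventually)
      have i: "c $ i < x $ i" "x $ i < d $ i"
        using True by (auto simp: mem_box_cart)
      have "\<forall>\<^sub>F k in sequentially. real k > max (1 / (x $ i - c $ i)) (1 / (d $ i - x $ i))"
        using filterlim_real_sequentially filterlim_at_top_dense[of real sequentially] by blast
      then show "\<forall>\<^sub>F k in sequentially. p k x i = 1"
      proof eventually_elim
        case (elim k)
        then have "1 < real k * (x $ i - c $ i)" "1 < real k * (d $ i - x $ i)"
          using i by (auto simp: field_simps)
        then show ?case
          by (simp add: p_def step_eq_1 algebra_simps)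
      qed
    qed
    then have "(\<lambda>k. \<phi> k x) \<longlonglongrightarrow> (\<Prod>i\<in>(UNIV :: 'n set). 1)"
      unfolding \<phi>_def by (intro tendsto_prod)
    then show ?thesis
      using True by simp
  next
    case False
    then obtain i where "x $ i \<le> c $ i \<or> d $ i \<le> x $ i"
      by (auto simp: mem_box_cart not_less)
    then have "\<phi> k x = 0" for k
      by (rule zero)
    then show ?thesis
      using False by simp
  qed
  ultimately show thesis
    using that by blast
qed

lemma integral_box_eq_0:
  fixes f :: "real ^ 'n::finite \<Rightarrow> 'b::euclidean_space"
  assumes f: "integrable (lebesgue_on \<Omega>) f"
    and zero: "\<And>\<phi>. \<phi> \<in> test_functions \<Omega> \<Longrightarrow> (LINT x|lebesgue_on \<Omega>. \<phi> x *\<^sub>R f x) = 0"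
    and "cbox c d \<subseteq> \<Omega>"
  shows "(LINT x|lebesgue_on \<Omega>. indicator (box c d) x *\<^sub>R f x) = 0"
proof -
  obtain \<phi> :: "nat \<Rightarrow> real ^ 'n \<Rightarrow> real" where \<phi>: "\<And>k. \<phi> k \<in> test_functions \<Omega>" "\<And>k x. \<bar>\<phi> k x\<bar> \<le> 1"
    "\<And>x. (\<lambda>k. \<phi> k x) \<longlonglongrightarrow> indicator (box c d) x"
    using box_approximation[OF assms(3)] by blast
  have "(\<lambda>k. LINT x|lebesgue_on \<Omega>. \<phi> k x *\<^sub>R f x) \<longlonglongrightarrow> (LINT x|lebesgue_on \<Omega>. indicator (box c d) x *\<^sub>R f x)"
  proof (rule integral_dominated_convergence)
    show "integrable (lebesgue_on \<Omega>) (\<lambda>x. norm (f x))"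
      using f by simp
    have "\<phi> k \<in> borel_measurable borel" for k
      using Ck_imp_continuous_on[OF test_functions_Ck[OF \<phi>(1)]] by (rule borel_measurable_continuous_onI)
    then have "\<phi> k \<in> borel_measurable (lebesgue_on \<Omega>)" for k
      by (intro measurable_restrict_space1 measurable_completion) auto
    then show "(\<lambda>x. \<phi> k x *\<^sub>R f x) \<in> borel_measurable (lebesgue_on \<Omega>)" for k
      using f by (intro borel_measurable_scaleR) auto
    have "box c d \<in> sets lebesgue"
      by simp
    then have "(\<lambda>x. indicator (box c d) x :: real) \<in> borel_measurable (lebesgue_on \<Omega>)"
      by (intro measurable_restrict_space1 borel_measurable_indicator)
    then show "(\<lambda>x. indicator (box c d) x *\<^sub>R f x) \<in> borel_measurable (lebesgue_on \<Omega>)"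
      using f by (intro borel_measurable_scaleR) auto
    show "AE x in lebesgue_on \<Omega>. (\<lambda>k. \<phi> k x *\<^sub>R f x) \<longlonglongrightarrow> indicator (box c d) x *\<^sub>R f x"
      using \<phi>(3) by (intro AE_I2 tendsto_scaleR tendsto_const)
    show "AE x in lebesgue_on \<Omega>. norm (\<phi> k x *\<^sub>R f x) \<le> norm (f x)" for k
      using \<phi>(2)[of k] by (intro AE_I2) (simp add: mult_left_le_one_le)
  qed
  then show ?thesis
    by (simp add: zero[OF \<phi>(1)] LIMSEQ_const_iff)
qed

text \<open>Open boxes are stable under intersection and generate the Borel sets, so on each fixed
  box the vanishing of the integrals spreads to all Borel sets and forces the function to vanish
  almost everywhere. Countably many closed boxes exhaust \<open>\<Omega>\<close>.\<close>

lemma AE_eq_0_of_box_integrals: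
  fixes F :: "real ^ 'n::finite \<Rightarrow> real"
  assumes F: "integrable lborel F" and "open \<Omega>"
    and zero: "\<And>c d. cbox c d \<subseteq> \<Omega> \<Longrightarrow> (LINT x|lborel. indicator (box c d) x *\<^sub>R F x) = 0"
  shows "AE x in lborel. x \<in> \<Omega> \<longrightarrow> F x = 0"
proof -
  have box: "AE x in lborel. x \<in> cbox c d \<longrightarrow> F x = 0" if cd: "cbox c d \<subseteq> \<Omega>" for c d
  proof -
    \<comment> \<open>Restriction to one box gives a function on the whole space with integral zero,
      which the complement step needs; intersecting with this box also keeps all boxes inside
      \<open>\<Omega>\<close>.\<close>
    define G where "G x = indicator (box c d) x *\<^sub>R F x" for x
    have G: "integrable lborel G"
      unfolding G_def[abs_def] by (intro integrable_mult_indicator F) auto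
    have int: "set_integrable lborel A G" if "A \<in> sets borel" for A
      unfolding set_integrable_def using that by (intro integrable_mult_indicator G) auto
    have sets: "sets (lborel :: (real ^ 'n) measure) = sigma_sets UNIV (range (\<lambda>(a, b). box a b))"
      by (simp add: borel_eq_box)
    have Int_stable_box: "Int_stable (range (\<lambda>(a, b). box a b :: (real ^ 'n) set))"
      by (auto simp: Int_stable_def box_Int_box)
    have subset_Pow_UNIV: "range (\<lambda>(a, b). box a b) \<subseteq> Pow (UNIV :: (real ^ 'n) set)"
      by simp
    have G0: "set_lebesgue_integral lborel A G = 0" if "A \<in> sigma_sets UNIV (range (\<lambda>(a, b). box a b))" for A
      using Int_stable_box subset_Pow_UNIV that
    proof (induction rule: sigma_sets_induct_disjoint)
      case (basic A)
      then obtain a b where A: "A = box a b" by auto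
      obtain a' b' where ab: "box a b \<inter> box c d = box a' b'"
        unfolding box_Int_box by blast
      have "set_lebesgue_integral lborel A G = (LINT x|lborel. indicator (box a' b') x *\<^sub>R F x)"
        unfolding set_lebesgue_integral_def G_def A ab[symmetric]
        by (intro Bochner_Integration.integral_cong) (auto simp: indicator_def)
      also have "\<dots> = 0"
      proof (cases "box a' b' = {}")
        case False
        then have "cbox a' b' = closure (box a' b')"
          by (simp add: closure_box)
        also have "\<dots> \<subseteq> closure (box c d)"
          using ab by (intro closure_mono) auto
        also have "\<dots> \<subseteq> cbox c d"
          by (intro closure_minimal box_subset_cbox closed_cbox)
        finally show ?thesis
          using cd by (intro zero) auto
      qed simp
      finally show ?case .
    next
      case empty
      then show ?case
        by (simp add: set_lebesgue_integral_def)
    next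
      case (compl A)
      then have A: "A \<in> sets borel"
        by (simp add: borel_eq_box)
      have "set_lebesgue_integral lborel (UNIV - A) G =
          (LINT x|lborel. G x - indicator A x *\<^sub>R G x)"
        unfolding set_lebesgue_integral_def
        by (intro Bochner_Integration.integral_cong) (auto simp: indicator_def)
      also have "\<dots> = (LINT x|lborel. G x) - set_lebesgue_integral lborel A G"
        using G int[OF A] by (simp add: set_lebesgue_integral_def set_integrable_def)
      also have "\<dots> = 0"
      proof -
        have "(LINT x|lborel. G x) = 0"
          using zero[OF cd] by (simp add: G_def)
        with compl show ?thesis by simp
      qed
      finally show ?case .
    next
      case (union A)
      then have A: "A i \<in> sets lborel" for i
        using sets by auto
      have "set_lebesgue_integral lborel (\<Union>i. A i) G = (\<Sum>i. set_lebesgue_integral lborel (A i) G)"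
        by (rule lebesgue_integral_countable_add)
          (use A union int in \<open>auto simp: disjoint_family_on_def\<close>)
      then show ?case
        using union by simp
    qed
    have "AE x in lborel. G x = 0"
    proof (rule density_unique_real[OF G integrable_zero])
      fix A :: "(real ^ 'n) set" assume "A \<in> sets lborel"
      then show "set_lebesgue_integral lborel A G = set_lebesgue_integral lborel A (\<lambda>x. 0)"
        using G0[OF \<open>A \<in> sets lborel\<close>[unfolded sets]] by (simp add: set_lebesgue_integral_def)
    qed
    \<comment> \<open>The faces, missed by the open box, are a null set; closed boxes are needed for
      the exhaustion.\<close>
    moreover have "AE x in lborel. x \<notin> cbox c d - box c d"
    proof -
      have "cbox c d - box c d \<in> null_sets lebesgue"
        using negligible_frontier_interval negligible_iff_null_sets by blast
      then have "AE x in lebesgue. x \<notin> cbox c d - box c d"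
        by (rule AE_not_in)
      then show ?thesis
        by (simp add: AE_completion_iff)
    qed
    ultimately show ?thesis
      by eventually_elim (auto simp: G_def indicator_def split: if_splits)
  qed
  obtain \<D> where \<D>: "countable \<D>" "\<D> \<subseteq> Pow \<Omega>" "\<And>X. X \<in> \<D> \<Longrightarrow> \<exists>a b. X = cbox a b" "\<Union>\<D> = \<Omega>"
    using open_countable_Union_open_cbox[OF \<open>open \<Omega>\<close>] by metis
  have "AE x in lborel. \<forall>X\<in>\<D>. x \<in> X \<longrightarrow> F x = 0"
    unfolding AE_ball_countable[OF \<D>(1)]
  proof
    fix X assume X: "X \<in> \<D>"
    then obtain a b where "X = cbox a b"
      using \<D>(3) by blast
    then show "AE x in lborel. x \<in> X \<longrightarrow> F x = 0"
      using box[of a b] X \<D>(2) by auto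
  qed
  then show ?thesis
    by eventually_elim (use \<D>(4) in auto)
qed

text \<open>Each component is replaced by a Borel function equal to it almost everywhere, since the
  argument with boxes runs over Borel sets while \<open>f\<close> is only Lebesgue measurable on
  \<open>\<Omega>\<close>.\<close>

lemma fundamental_lemma:
  fixes f :: "real ^ 'n::finite \<Rightarrow> 'b::euclidean_space"
  assumes \<Omega>: "open \<Omega>" and f: "integrable (lebesgue_on \<Omega>) f"
    and zero: "\<And>\<phi>. \<phi> \<in> test_functions \<Omega> \<Longrightarrow> (LINT x|lebesgue_on \<Omega>. \<phi> x *\<^sub>R f x) = 0"
  shows "AE x in lebesgue_on \<Omega>. f x = 0"
proof -
  have \<Omega>': "\<Omega> \<inter> space lebesgue \<in> sets lebesgue"
    using \<Omega> by simp
  have comp: "AE x in lebesgue_on \<Omega>. f x \<bullet> b = 0" for b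
  proof -
    define f0 where "f0 x = indicator \<Omega> x *\<^sub>R (f x \<bullet> b)" for x
    have "integrable (lebesgue_on \<Omega>) (\<lambda>x. f x \<bullet> b)"
      using f by simp
    then have f0: "integrable lebesgue f0"
      unfolding f0_def[abs_def] by (subst (asm) integrable_restrict_space) (use \<Omega>' in auto)
    then obtain F where F: "F \<in> borel_measurable lborel" "AE x in lborel. f0 x = F x"
      using completion_ex_borel_measurable_real[of f0 lborel] by (auto dest: borel_measurable_integrable)
    have F_leb: "AE x in lebesgue. f0 x = F x"
      using F(2) by (simp add: AE_completion_iff AE_completion)
    have F_meas: "F \<in> borel_measurable lebesgue"
      using F(1) by (rule measurable_completion)
    have "integrable lebesgue F"
      using f0 F_leb F_meas by (subst integrable_cong_AE[of F _ f0]) (auto dest: borel_measurable_integrable)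
    then have intF: "integrable lborel F"
      using F(1) by (simp add: integrable_completion)
    have "AE x in lborel. x \<in> \<Omega> \<longrightarrow> F x = 0"
    proof (rule AE_eq_0_of_box_integrals[OF intF \<Omega>])
      fix c d :: "real ^ 'n" assume cd: "cbox c d \<subseteq> \<Omega>"
      have "(LINT x|lborel. indicator (box c d) x *\<^sub>R F x) = (LINT x|lebesgue. indicator (box c d) x *\<^sub>R F x)"
        using F(1) by (subst integral_completion) auto
      also have "\<dots> = (LINT x|lebesgue. indicator (box c d) x *\<^sub>R f0 x)"
        using F_leb F_meas f0
        by (intro integral_cong_AE)
          (auto intro!: borel_measurable_times borel_measurable_indicator dest: borel_measurable_integrable)
      also have "\<dots> = (LINT x|lebesgue. indicator \<Omega> x *\<^sub>R (indicator (box c d) x *\<^sub>R (f x \<bullet> b)))"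
        by (simp add: f0_def mult_ac)
      also have "\<dots> = (LINT x|lebesgue_on \<Omega>. indicator (box c d) x *\<^sub>R (f x \<bullet> b))"
        using \<Omega>' by (simp add: integral_restrict_space)
      also have "\<dots> = (LINT x|lebesgue_on \<Omega>. (indicator (box c d) x *\<^sub>R f x) \<bullet> b)"
        by simp
      also have "\<dots> = (LINT x|lebesgue_on \<Omega>. indicator (box c d) x *\<^sub>R f x) \<bullet> b"
      proof (rule integral_inner_left)
        have "(\<lambda>x. indicator (box c d) x :: real) \<in> borel_measurable (lebesgue_on \<Omega>)"
          by (intro measurable_restrict_space1 borel_measurable_indicator) simp
        then show "integrable (lebesgue_on \<Omega>) (\<lambda>x. indicator (box c d) x *\<^sub>R f x)"
          by (intro Bochner_Integration.integrable_bound[OF f] borel_measurable_scaleR AE_I2)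
            (use f in \<open>auto simp: indicator_def\<close>)
      qed
      also have "\<dots> = 0"
        by (simp only: integral_box_eq_0[OF f zero cd] inner_zero_left)
      finally show "(LINT x|lborel. indicator (box c d) x *\<^sub>R F x) = 0" .
    qed
    then have "AE x in lebesgue. x \<in> \<Omega> \<longrightarrow> F x = 0"
      by (rule AE_completion)
    with F_leb have "AE x in lebesgue. x \<in> \<Omega> \<longrightarrow> f x \<bullet> b = 0"
      by eventually_elim (auto simp: f0_def)
    then show ?thesis
      using \<Omega>' by (simp add: AE_restrict_space_iff)
  qed
  have "AE x in lebesgue_on \<Omega>. \<forall>b\<in>Basis. f x \<bullet> b = 0"
    using comp by (intro AE_finite_allI) auto
  then show ?thesis
    by eventually_elim (simp only: euclidean_all_zero_iff)
qed

section \<open>Uniqueness of weak derivatives, and those of smooth functions\<close>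

lemma weak_deriv_L2_has:
  assumes "p \<in> L2 \<Omega>" "has_weak_deriv \<Omega> is v p"
  shows "weak_deriv \<Omega> is v \<in> L2 \<Omega>" "has_weak_deriv \<Omega> is v (weak_deriv \<Omega> is v)"
  using someI[of "\<lambda>g. g \<in> L2 \<Omega> \<and> has_weak_deriv \<Omega> is v g" p] assms
  by (auto simp: weak_deriv_def)

text \<open>Makes the choice in \<open>weak_deriv\<close> harmless: two candidates have the same
  integrals against test functions. Boundedness of \<open>\<Omega>\<close> puts their difference
  among the integrable functions.\<close>

lemma weak_deriv_AE:
  fixes v p :: "real ^ 'n::finite \<Rightarrow> 'b::euclidean_space"
  assumes \<Omega>: "open \<Omega>" "bounded \<Omega>" and p: "p \<in> L2 \<Omega>" "has_weak_deriv \<Omega> is v p"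
  shows "AE x in lebesgue_on \<Omega>. weak_deriv \<Omega> is v x = p x"
proof -
  let ?g = "weak_deriv \<Omega> is v"
  note g = weak_deriv_L2_has[OF p]
  have "AE x in lebesgue_on \<Omega>. ?g x - p x = 0"
  proof (rule fundamental_lemma[OF \<Omega>(1)])
    show "integrable (lebesgue_on \<Omega>) (\<lambda>x. ?g x - p x)"
      by (intro L2_integrable \<Omega> L2_diff g p)
    fix \<phi> :: "real ^ 'n \<Rightarrow> real" assume \<phi>: "\<phi> \<in> test_functions \<Omega>"
    have "(-1) ^ length is *\<^sub>R (LINT x|lebesgue_on \<Omega>. \<phi> x *\<^sub>R ?g x) =
        (-1 :: real) ^ length is *\<^sub>R (LINT x|lebesgue_on \<Omega>. \<phi> x *\<^sub>R p x)"
      using g(2) p(2) \<phi> by (simp add: has_weak_deriv_def)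
    then have "(LINT x|lebesgue_on \<Omega>. \<phi> x *\<^sub>R ?g x) = (LINT x|lebesgue_on \<Omega>. \<phi> x *\<^sub>R p x)"
      by simp
    then show "(LINT x|lebesgue_on \<Omega>. \<phi> x *\<^sub>R (?g x - p x)) = 0"
      using Bochner_Integration.integral_diff[OF L2_integrable_scaleR[OF test_functions_L2[OF \<Omega>(1) \<phi>] g(1)]
          L2_integrable_scaleR[OF test_functions_L2[OF \<Omega>(1) \<phi>] p(1)]]
      by (simp add: scaleR_diff_right)
  qed
  then show ?thesis
    by eventually_elim simp
qed

lemma L2_norm_cong_AE:
  assumes "AE x in lebesgue_on \<Omega>. u x = v x" "u \<in> L2 \<Omega>" "v \<in> L2 \<Omega>"
  shows "L2_norm \<Omega> u = L2_norm \<Omega> v"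
  using L2_inner_cong_AE[OF assms(1,1) assms(2,3,2,3)] by (simp add: L2_norm_def)

lemma L2_norm_weak_deriv:
  fixes v p :: "real ^ 'n::finite \<Rightarrow> 'b::euclidean_space"
  assumes "open \<Omega>" "bounded \<Omega>" "p \<in> L2 \<Omega>" "has_weak_deriv \<Omega> is v p"
  shows "L2_norm \<Omega> (weak_deriv \<Omega> is v) = L2_norm \<Omega> p"
  by (rule L2_norm_cong_AE[OF weak_deriv_AE[OF assms] weak_deriv_L2_has(1)[OF assms(3,4)] assms(3)])

lemma has_weak_deriv_diff:
  fixes u v p q :: "real ^ 'n::finite \<Rightarrow> 'b::euclidean_space"
  assumes "open \<Omega>" "u \<in> L2 \<Omega>" "v \<in> L2 \<Omega>" "p \<in> L2 \<Omega>" "q \<in> L2 \<Omega>"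
    "has_weak_deriv \<Omega> is u p" "has_weak_deriv \<Omega> is v q"
  shows "has_weak_deriv \<Omega> is (\<lambda>x. u x - v x) (\<lambda>x. p x - q x)"
  unfolding has_weak_deriv_def
proof
  fix \<phi> :: "real ^ 'n \<Rightarrow> real" assume \<phi>: "\<phi> \<in> test_functions \<Omega>"
  note \<phi>L2 = test_functions_L2[OF assms(1) \<phi>] test_functions_L2[OF assms(1) test_functions_partials[OF \<phi>]]
  show "(LINT x|lebesgue_on \<Omega>. partials is \<phi> x *\<^sub>R (u x - v x)) =
      (-1) ^ length is *\<^sub>R (LINT x|lebesgue_on \<Omega>. \<phi> x *\<^sub>R (p x - q x))"
    using Bochner_Integration.integral_diff[OF L2_integrable_scaleR[OF \<phi>L2(2) assms(2)] L2_integrable_scaleR[OF \<phi>L2(2) assms(3)]]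
      Bochner_Integration.integral_diff[OF L2_integrable_scaleR[OF \<phi>L2(1) assms(4)] L2_integrable_scaleR[OF \<phi>L2(1) assms(5)]]
      assms(6,7) \<phi>
    by (simp add: scaleR_diff_right has_weak_deriv_def)
qed

text \<open>
  Reversing the list avoids the symmetry of second derivatives.
\<close>

lemma has_weak_deriv_smooth:
  fixes v :: "real ^ 'n::finite \<Rightarrow> 'b::euclidean_space"
  assumes \<Omega>: "open \<Omega>" and v: "\<And>k. Ck k \<Omega> v"
  shows "has_weak_deriv \<Omega> is v (partials (rev is) v)"
  unfolding has_weak_deriv_def
proof
  fix \<phi> :: "real ^ 'n \<Rightarrow> real" assume \<phi>: "\<phi> \<in> test_functions \<Omega>"
  show "(LINT x|lebesgue_on \<Omega>. partials is \<phi> x *\<^sub>R v x) =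
      (-1) ^ length is *\<^sub>R (LINT x|lebesgue_on \<Omega>. \<phi> x *\<^sub>R partials (rev is) v x)"
    using v
  proof (induction "is" arbitrary: v)
    case (Cons i js)
    have \<psi>: "partials js \<phi> \<in> test_functions \<Omega>"
      using \<phi> by (rule test_functions_partials)
    obtain K where K: "\<And>k. Ck k UNIV (partials js \<phi>)" "compact K" "K \<subseteq> \<Omega>" "\<And>x. x \<notin> K \<Longrightarrow> partials js \<phi> x = 0"
      using \<psi> by (rule test_functionsE) blast
    have "(LINT x|lebesgue_on \<Omega>. partials (i # js) \<phi> x *\<^sub>R v x) =
        - (LINT x|lebesgue_on \<Omega>. partials js \<phi> x *\<^sub>R partial i v x)"
      unfolding partials.simps
      by (rule integration_by_parts[OF bounded_bilinear_scaleR \<Omega> test_functions_Ck[OF \<psi>] Cons.prems K(2-4)])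
    also have "(LINT x|lebesgue_on \<Omega>. partials js \<phi> x *\<^sub>R partial i v x) =
        (-1) ^ length js *\<^sub>R (LINT x|lebesgue_on \<Omega>. \<phi> x *\<^sub>R partials (rev js) (partial i v) x)"
      by (rule Cons.IH) (rule Ck_partial[OF Cons.prems])
    finally show ?case
      by (simp add: partials_append)
  qed simp
qed

lemma has_weak_deriv_Nil: "has_weak_deriv \<Omega> [] v v"
  by (simp add: has_weak_deriv_def)

text \<open>Regularity on a neighbourhood of the compact closure bounds every derivative on
  \<open>\<Omega>\<close>; regularity on \<open>\<Omega>\<close> alone would allow blow-up at the
  boundary.\<close>

lemma partials_L2:
  fixes v :: "real ^ 'n::finite \<Rightarrow> 'b::euclidean_space"
  assumes "open \<Omega>" "bounded \<Omega>" "open T" "closure \<Omega> \<subseteq> T" "\<And>k. Ck k T v"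
  shows "partials is v \<in> L2 \<Omega>"
proof -
  have "continuous_on T (partials is v)"
    using Ck_imp_continuous_on[OF Ck_partials[OF assms(5)]] .
  then have cont: "continuous_on (closure \<Omega>) (partials is v)"
    using assms(4) continuous_on_subset by blast
  then have "bounded (partials is v ` closure \<Omega>)"
    using assms(2) by (intro compact_imp_bounded compact_continuous_image) auto
  then obtain C where "\<forall>x\<in>closure \<Omega>. norm (partials is v x) \<le> C"
    unfolding bounded_iff by auto
  then show ?thesis
    using closure_subset[of \<Omega>] cont
    by (intro L2_bounded_continuous[OF assms(1,2), of _ C]) (auto intro: continuous_on_subset)
qed

section \<open>Criteria for convergence in norm and in energy\<close>

lemma L2_norm_tendsto_0:
  fixes v :: "nat \<Rightarrow> real ^ 'n::finite \<Rightarrow> 'b::euclidean_space"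
  assumes "open \<Omega>" "bounded \<Omega>" "\<And>k. v k \<in> L2 \<Omega>"
    "\<And>k x. x \<in> \<Omega> \<Longrightarrow> norm (v k x) \<le> C"
    "\<And>x. x \<in> \<Omega> \<Longrightarrow> \<forall>\<^sub>F k in sequentially. v k x = 0"
  shows "(\<lambda>k. L2_norm \<Omega> (v k)) \<longlonglongrightarrow> 0"
proof -
  have "(\<lambda>k. LINT x|lebesgue_on \<Omega>. v k x \<bullet> v k x) \<longlonglongrightarrow> (LINT x|lebesgue_on \<Omega>. 0)"
  proof (rule integral_dominated_convergence)
    show "integrable (lebesgue_on \<Omega>) (\<lambda>x. C\<^sup>2)"
      using L2_integrable[OF assms(1,2) L2_const[OF assms(1,2), of "C\<^sup>2"]] .
    show "AE x in lebesgue_on \<Omega>. (\<lambda>k. v k x \<bullet> v k x) \<longlonglongrightarrow> 0"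
    proof (rule AE_I2)
      fix x assume "x \<in> space (lebesgue_on \<Omega>)"
      then have "\<forall>\<^sub>F k in sequentially. v k x \<bullet> v k x = 0"
        using assms(5)[of x] by (auto elim: eventually_mono)
      then show "(\<lambda>k. v k x \<bullet> v k x) \<longlonglongrightarrow> 0"
        by (rule tendsto_eventually)
    qed
    show "AE x in lebesgue_on \<Omega>. norm (v k x \<bullet> v k x) \<le> C\<^sup>2" for k
      using assms(4) by (intro AE_I2) (auto simp: dot_square_norm intro!: power_mono)
  qed (use L2_integrable_inner[OF assms(3,3)] in \<open>auto intro: borel_measurable_integrable\<close>)
  then have "(\<lambda>k. sqrt (L2_inner \<Omega> (v k) (v k))) \<longlonglongrightarrow> sqrt 0"
    by (intro tendsto_real_sqrt) (simp add: L2_inner_def)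
  then show ?thesis
    by (simp add: L2_norm_def)
qed

text \<open>Once each partial derivative converges in \<open>L\<^sub>2\<close> to some
  \<open>g i\<close>, the triangle inequality through \<open>g i\<close> makes the energy of the
  differences small.\<close>

lemma energy_approxI:
  fixes u :: "real ^ 'n::finite \<Rightarrow> 'b::euclidean_space"
  assumes \<Omega>: "open \<Omega>" and \<D>: "\<D> \<subseteq> test_functions \<Omega>" "\<And>k. \<phi> k \<in> \<D>"
    and "(\<lambda>k. L2_norm \<Omega> (\<lambda>x. \<phi> k x - u x)) \<longlonglongrightarrow> 0"
    and g: "\<And>i. g i \<in> L2 \<Omega>" "\<And>i. (\<lambda>k. L2_norm \<Omega> (\<lambda>x. partial i (\<phi> k) x - g i x)) \<longlonglongrightarrow> 0"
  shows "energy_approx \<Omega> \<D> \<phi> u"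
  unfolding energy_approx_def
proof (intro conjI allI impI)
  fix e :: real assume "e > 0"
  have test: "\<phi> k \<in> test_functions \<Omega>" for k
    using \<D> by auto
  define d where "d i k = L2_norm \<Omega> (\<lambda>x. partial i (\<phi> k) x - g i x)" for i k
  have D: "dirichlet \<Omega> (\<lambda>x. \<phi> k x - \<phi> m x) (\<lambda>x. \<phi> k x - \<phi> m x) \<le> (\<Sum>i\<in>UNIV. (d i k + d i m)\<^sup>2)" for k m
    unfolding dirichlet_def
  proof (rule sum_mono)
    fix i
    have "partial i (\<lambda>x. \<phi> k x - \<phi> m x) = (\<lambda>x. partial i (\<phi> k) x - partial i (\<phi> m) x)"
      using partial_diff[OF test_functions_differentiable[OF test] test_functions_differentiable[OF test]] by blast
    then have "L2_inner \<Omega> (partial i (\<lambda>x. \<phi> k x - \<phi> m x)) (partial i (\<lambda>x. \<phi> k x - \<phi> m x)) =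
        (L2_norm \<Omega> (\<lambda>x. partial i (\<phi> k) x - partial i (\<phi> m) x))\<^sup>2"
      by (simp add: L2_norm_power2)
    also have "\<dots> \<le> (d i k + d i m)\<^sup>2"
    proof (intro power_mono L2_norm_nonneg)
      have "L2_norm \<Omega> (\<lambda>x. partial i (\<phi> k) x - partial i (\<phi> m) x) \<le>
          L2_norm \<Omega> (\<lambda>x. partial i (\<phi> k) x - g i x) + L2_norm \<Omega> (\<lambda>x. g i x - partial i (\<phi> m) x)"
        by (intro L2_norm_diff_triangle g test_functions_L2 \<Omega> test_functions_partial test)
      also have "L2_norm \<Omega> (\<lambda>x. g i x - partial i (\<phi> m) x) = d i m"
        unfolding d_def by (rule L2_norm_minus_commute)
      finally show "L2_norm \<Omega> (\<lambda>x. partial i (\<phi> k) x - partial i (\<phi> m) x) \<le> d i k + d i m"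
        by (simp add: d_def)
    qed
    finally show "L2_inner \<Omega> (partial i (\<lambda>x. \<phi> k x - \<phi> m x)) (partial i (\<lambda>x. \<phi> k x - \<phi> m x)) \<le> (d i k + d i m)\<^sup>2" .
  qed
  \<comment> \<open>Here \<open>(2 s)\<^sup>2 = e / (n + 1)\<close>, so that the \<open>n\<close>
    partial derivatives together stay strictly below \<open>e\<close>.\<close>
  define s where "s = sqrt (e / (real CARD('n) + 1)) / 2"
  have "s > 0"
    using \<open>e > 0\<close> by (simp add: s_def add_nonneg_pos)
  have "\<forall>\<^sub>F k in sequentially. \<forall>i\<in>UNIV. d i k < s"
    using g(2) \<open>s > 0\<close>
    by (intro eventually_ball_finite ballI order_tendstoD(2)[of _ 0]) (auto simp: d_def)
  then obtain N where N: "\<And>k i. k \<ge> N \<Longrightarrow> d i k < s"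
    by (auto simp: eventually_sequentially)
  have "dirichlet \<Omega> (\<lambda>x. \<phi> k x - \<phi> m x) (\<lambda>x. \<phi> k x - \<phi> m x) < e" if "k \<ge> N" "m \<ge> N" for k m
  proof -
    have "(\<Sum>i\<in>(UNIV :: 'n set). (d i k + d i m)\<^sup>2) \<le> (\<Sum>i\<in>(UNIV :: 'n set). (2 * s)\<^sup>2)"
    proof (intro sum_mono power_mono)
      show "d i k + d i m \<le> 2 * s" for i
        using N[OF that(1), of i] N[OF that(2), of i] by simp
      show "0 \<le> d i k + d i m" for i
        by (simp add: d_def L2_norm_nonneg)
    qed
    also have "\<dots> = real CARD('n) * (e / (real CARD('n) + 1))"
      using \<open>e > 0\<close> by (simp add: s_def)
    also have "\<dots> < e"
      using \<open>e > 0\<close> by (simp add: field_simps)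
    finally show ?thesis
      using D[of k m] by simp
  qed
  then show "\<exists>N. \<forall>k\<ge>N. \<forall>m\<ge>N. dirichlet \<Omega> (\<lambda>x. \<phi> k x - \<phi> m x) (\<lambda>x. \<phi> k x - \<phi> m x) < e"
    by blast
qed (use assms in auto)

section \<open>From eigenvalues of the operators to weak eigenpairs\<close>

lemma laplacian_diff:
  fixes \<phi> \<psi> :: "real ^ 'n::finite \<Rightarrow> 'b::euclidean_space"
  assumes "\<phi> \<in> test_functions \<Omega>" "\<psi> \<in> test_functions \<Omega>"
  shows "laplacian (\<lambda>x. \<phi> x - \<psi> x) x = laplacian \<phi> x - laplacian \<psi> x"
proof -
  have "partial i (\<lambda>x. \<phi> x - \<psi> x) = (\<lambda>x. partial i \<phi> x - partial i \<psi> x)"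
    if "\<phi> \<in> test_functions \<Omega>" "\<psi> \<in> test_functions \<Omega>" for i and \<phi> \<psi> :: "real ^ 'n \<Rightarrow> 'b"
    using partial_diff[OF test_functions_differentiable[OF that(1)] test_functions_differentiable[OF that(2)]]
    by blast
  then show ?thesis
    using assms by (simp add: laplacian_def test_functions_partial sum_subtractf)
qed

text \<open>The adjoint condition is the weak equation, with \<open>f\<close> replaced by
  \<open>l u\<close> almost everywhere. In the energy space the Cauchy condition involves
  \<open>\<langle>- \<Delta> \<eta>, \<eta>\<rangle>\<close> for differences \<open>\<eta>\<close>
  of test functions, which is the Dirichlet form.\<close>

lemma laplace_operator_weak_eigenpair:
  fixes \<Omega> :: "(real ^ 'n::finite) set"
  assumes \<Omega>: "open \<Omega>" and l: "is_eigenvalue \<Omega> (laplace_operator \<Omega>) l"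
  shows "\<exists>u :: real ^ 'n \<Rightarrow> real. weak_eigenpair \<Omega> (test_functions \<Omega>) l u"
proof -
  let ?S = "{(\<phi>, \<lambda>x. - laplacian \<phi> x) |\<phi>. \<phi> \<in> test_functions \<Omega>} ::
    ((real ^ 'n \<Rightarrow> real) \<times> (real ^ 'n \<Rightarrow> real)) set"
  obtain u f where uf: "(u, f) \<in> adjoint_graph \<Omega> ?S" "u \<in> energy_space \<Omega> ?S"
      "\<not> (AE x in lebesgue_on \<Omega>. u x = 0)" "AE x in lebesgue_on \<Omega>. f x = l *\<^sub>R u x"
    using l by (auto simp: is_eigenvalue_def laplace_operator_def friedrichs_extension_def)
  have L2: "u \<in> L2 \<Omega>" "f \<in> L2 \<Omega>"
    using uf(1) by (auto simp: adjoint_graph_def)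
  have weak: "L2_inner \<Omega> (\<lambda>x. - laplacian \<phi> x) u = l * L2_inner \<Omega> \<phi> u" if \<phi>: "\<phi> \<in> test_functions \<Omega>" for \<phi>
  proof -
    have "(\<lambda>x. l *\<^sub>R u x) \<in> L2 \<Omega>"
      using L2(1) by (rule L2_scaleR)
    note L2 = L2 this
    have "L2_inner \<Omega> (\<lambda>x. - laplacian \<phi> x) u = L2_inner \<Omega> \<phi> f"
      using uf(1) \<phi> by (auto simp: adjoint_graph_def)
    also have "\<dots> = L2_inner \<Omega> \<phi> (\<lambda>x. l *\<^sub>R u x)"
      by (rule L2_inner_cong_AE[OF AE_I2[OF refl] uf(4)]) (intro L2 test_functions_L2[OF \<Omega> \<phi>])+
    finally show ?thesis
      by (simp only: L2_inner_scaleR_right)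
  qed
  obtain \<phi> \<psi> where \<phi>\<psi>: "\<And>k::nat. (\<phi> k, \<psi> k) \<in> ?S" "(\<lambda>k. L2_norm \<Omega> (\<lambda>x. \<phi> k x - u x)) \<longlonglongrightarrow> 0"
      "\<And>e. e > 0 \<Longrightarrow> \<exists>N. \<forall>k\<ge>N. \<forall>m\<ge>N. \<bar>L2_inner \<Omega> (\<lambda>x. \<psi> k x - \<psi> m x) (\<lambda>x. \<phi> k x - \<phi> m x)\<bar> < e"
    using uf(2) unfolding energy_space_def by blast
  have test: "\<phi> k \<in> test_functions \<Omega>" and \<psi>: "\<psi> k = (\<lambda>x. - laplacian (\<phi> k) x)" for k
    using \<phi>\<psi>(1)[of k] by auto
  have "L2_inner \<Omega> (\<lambda>x. \<psi> k x - \<psi> m x) (\<lambda>x. \<phi> k x - \<phi> m x) =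
      dirichlet \<Omega> (\<lambda>x. \<phi> k x - \<phi> m x) (\<lambda>x. \<phi> k x - \<phi> m x)" for k m
  proof -
    have "(\<lambda>x. \<psi> k x - \<psi> m x) = (\<lambda>x. - laplacian (\<lambda>x. \<phi> k x - \<phi> m x) x)"
      using laplacian_diff[OF test test] by (auto simp: \<psi>)
    then show ?thesis
      by (simp only: L2_inner_laplacian[OF \<Omega> test_functions_diff[OF test test] test_functions_diff[OF test test]])
  qed
  then have approx: "energy_approx \<Omega> (test_functions \<Omega>) \<phi> u"
    unfolding energy_approx_def using \<phi>\<psi>(2,3) test
    by (simp add: abs_of_nonneg[OF dirichlet_nonneg])
  show ?thesis
    unfolding weak_eigenpair_def
    by (intro exI[of _ u] conjI ballI weak L2 uf(3) exI[of _ \<phi>] approx)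
qed

lemma solenoidal_subset: "solenoidal_test_fields \<Omega> \<subseteq> test_functions \<Omega>"
  by (auto simp: solenoidal_test_fields_def)

lemma finite_lists_le_1: "finite {is :: 'n::finite list. length is \<le> 1}"
  using finite_lists_length_le[of "UNIV :: 'n set" 1] by simp

lemma sobolev_norm_tendsto_0_iff:
  fixes v :: "nat \<Rightarrow> real ^ 'n::finite \<Rightarrow> 'b::euclidean_space"
  shows "(\<lambda>k. sobolev_norm 1 \<Omega> (v k)) \<longlonglongrightarrow> 0 \<longleftrightarrow>
    (\<forall>is. length is \<le> 1 \<longrightarrow> (\<lambda>k. L2_norm \<Omega> (weak_deriv \<Omega> is (v k))) \<longlonglongrightarrow> 0)"
proof (intro iffI allI impI)
  fix "is" :: "'n list"
  assume lim: "(\<lambda>k. sobolev_norm 1 \<Omega> (v k)) \<longlonglongrightarrow> 0" and "is": "length is \<le> 1"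
  have "L2_norm \<Omega> (weak_deriv \<Omega> is (v k)) \<le> sobolev_norm 1 \<Omega> (v k)" for k
    unfolding sobolev_norm_def
  proof (rule real_le_rsqrt)
    show "(L2_norm \<Omega> (weak_deriv \<Omega> is (v k)))\<^sup>2 \<le> (\<Sum>is | length is \<le> 1. (L2_norm \<Omega> (weak_deriv \<Omega> is (v k)))\<^sup>2)"
      by (rule member_le_sum) (use "is" finite_lists_le_1 in auto)
  qed
  then show "(\<lambda>k. L2_norm \<Omega> (weak_deriv \<Omega> is (v k))) \<longlonglongrightarrow> 0"
    by (intro tendsto_sandwich[OF _ _ tendsto_const lim]) (auto simp: L2_norm_nonneg)
next
  assume lim: "\<forall>is. length is \<le> 1 \<longrightarrow> (\<lambda>k. L2_norm \<Omega> (weak_deriv \<Omega> is (v k))) \<longlonglongrightarrow> 0"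
  have "(\<lambda>k. sqrt (\<Sum>is | length is \<le> 1. (L2_norm \<Omega> (weak_deriv \<Omega> is (v k)))\<^sup>2)) \<longlonglongrightarrow>
      sqrt (\<Sum>is :: 'n list | length is \<le> 1. 0\<^sup>2)"
    by (intro tendsto_real_sqrt tendsto_sum tendsto_power) (use lim in auto)
  then show "(\<lambda>k. sobolev_norm 1 \<Omega> (v k)) \<longlonglongrightarrow> 0"
    by (simp add: sobolev_norm_def)
qed

lemma solenoidal_test_fields_L2:
  assumes "open \<Omega>" "\<phi> \<in> solenoidal_test_fields \<Omega>"
  shows "\<phi> \<in> solenoidal_L2 \<Omega>"
proof -
  have "\<phi> \<in> L2 \<Omega>"
    using assms solenoidal_subset test_functions_L2 by blast
  moreover have "L2_norm \<Omega> (\<lambda>x. \<phi> x - \<phi> x) = 0"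
    by (simp add: L2_norm_def L2_inner_def)
  ultimately show ?thesis
    using assms(2) by (auto simp: solenoidal_L2_def intro!: exI[of _ "\<lambda>k. \<phi>"])
qed

text \<open>\<open>has_weak_deriv\<close> tests with scalar functions only. Applying it to each
  component of \<open>\<phi>\<close> and summing over the basis gives the identity for vector-valued
  test functions.\<close>

lemma weak_deriv_inner:
  fixes u g \<phi> :: "real ^ 'n::finite \<Rightarrow> 'b::euclidean_space"
  assumes \<Omega>: "open \<Omega>" and u: "u \<in> L2 \<Omega>" and g: "g \<in> L2 \<Omega>" "has_weak_deriv \<Omega> is u g"
    and \<phi>: "\<phi> \<in> test_functions \<Omega>"
  shows "L2_inner \<Omega> (partials is \<phi>) u = (-1) ^ length is * L2_inner \<Omega> \<phi> g"
proof -
  have comp: "partials is (\<lambda>x. \<phi> x \<bullet> b) = (\<lambda>x. partials is \<phi> x \<bullet> b)" for b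
  proof (induction "is")
    case (Cons i js)
    have "partial i (\<lambda>x. partials js \<phi> x \<bullet> b) = (\<lambda>x. partial i (partials js \<phi>) x \<bullet> b)"
      using partial_inner_const[OF test_functions_differentiable[OF test_functions_partials[OF \<phi>]]] by blast
    with Cons show ?case by simp
  qed simp
  have expand: "L2_inner \<Omega> \<psi> w = (\<Sum>b\<in>Basis. (LINT x|lebesgue_on \<Omega>. (\<psi> x \<bullet> b) *\<^sub>R w x) \<bullet> b)"
    if \<psi>: "\<psi> \<in> test_functions \<Omega>" and w: "w \<in> L2 \<Omega>" for \<psi> w :: "real ^ 'n \<Rightarrow> 'b"
  proof -
    have int: "integrable (lebesgue_on \<Omega>) (\<lambda>x. (\<psi> x \<bullet> b) *\<^sub>R w x)" for b
      by (rule L2_integrable_scaleR[OF test_functions_L2[OF \<Omega> test_functions_inner[OF \<psi>]] w])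
    have "(\<Sum>b\<in>Basis. (LINT x|lebesgue_on \<Omega>. (\<psi> x \<bullet> b) *\<^sub>R w x) \<bullet> b) =
        (\<Sum>b\<in>Basis. LINT x|lebesgue_on \<Omega>. ((\<psi> x \<bullet> b) *\<^sub>R w x) \<bullet> b)"
      using int by (intro sum.cong refl integral_inner_left[symmetric]) auto
    also have "\<dots> = (LINT x|lebesgue_on \<Omega>. (\<Sum>b\<in>Basis. ((\<psi> x \<bullet> b) *\<^sub>R w x) \<bullet> b))"
      using int by (intro Bochner_Integration.integral_sum[symmetric] integrable_inner_left) auto
    also have "\<dots> = L2_inner \<Omega> \<psi> w"
      unfolding L2_inner_def
    proof (intro Bochner_Integration.integral_cong refl)
      show "(\<Sum>b\<in>Basis. ((\<psi> x \<bullet> b) *\<^sub>R w x) \<bullet> b) = \<psi> x \<bullet> w x" for x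
        unfolding inner_scaleR_left by (rule euclidean_inner[symmetric])
    qed
    finally show ?thesis by simp
  qed
  have "(LINT x|lebesgue_on \<Omega>. (partials is \<phi> x \<bullet> b) *\<^sub>R u x) =
      (-1) ^ length is *\<^sub>R (LINT x|lebesgue_on \<Omega>. (\<phi> x \<bullet> b) *\<^sub>R g x)" for b
    using g(2) test_functions_inner[OF \<phi>, of b] by (auto simp: has_weak_deriv_def comp dest!: bspec)
  then show ?thesis
    by (simp add: expand[OF test_functions_partials[OF \<phi>] u] expand[OF \<phi> g(1)] sum_distrib_left)
qed

text \<open>Against a solenoidal test field the projection is invisible, because
  \<open>- \<Delta> u - f\<close> is orthogonal to \<open>solenoidal_L2\<close>; the two weak
  derivatives are then moved onto the test field. The approximants defining
  \<open>solenoidal_W12\<close> also converge in energy.\<close>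

lemma stokes_operator_weak_eigenpair:
  fixes \<Omega> :: "(real ^ 'n::finite) set"
  assumes \<Omega>: "open \<Omega>" "bounded \<Omega>" and l: "is_eigenvalue \<Omega> (stokes_operator \<Omega>) l"
  shows "\<exists>u. weak_eigenpair \<Omega> (solenoidal_test_fields \<Omega>) l u"
proof -
  obtain u f where uf: "u \<in> sobolev 2 \<Omega>" "u \<in> solenoidal_W12 \<Omega>"
      "((\<lambda>x. - weak_laplacian \<Omega> u x), f) \<in> solenoidal_projection \<Omega>"
      "\<not> (AE x in lebesgue_on \<Omega>. u x = 0)" "AE x in lebesgue_on \<Omega>. f x = l *\<^sub>R u x"
    using l by (auto simp: is_eigenvalue_def stokes_operator_def)
  have f: "f \<in> solenoidal_L2 \<Omega>" "(\<lambda>x. - weak_laplacian \<Omega> u x) \<in> L2 \<Omega>" "f \<in> L2 \<Omega>"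
    "\<And>h. h \<in> solenoidal_L2 \<Omega> \<Longrightarrow> L2_inner \<Omega> (\<lambda>x. - weak_laplacian \<Omega> u x - f x) h = 0"
    using uf(3) by (auto simp: solenoidal_projection_def solenoidal_L2_def)
  have uL2: "u \<in> L2 \<Omega>"
    using uf(1) by (simp add: sobolev_def)
  have g: "weak_deriv \<Omega> is u \<in> L2 \<Omega>" "has_weak_deriv \<Omega> is u (weak_deriv \<Omega> is u)" if len: "length is \<le> 2" for "is"
  proof -
    obtain p where "p \<in> L2 \<Omega>" "has_weak_deriv \<Omega> is u p"
      using uf(1) len unfolding sobolev_def by blast
    then show "weak_deriv \<Omega> is u \<in> L2 \<Omega>" "has_weak_deriv \<Omega> is u (weak_deriv \<Omega> is u)"
      by (rule weak_deriv_L2_has)+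
  qed
  have weak: "L2_inner \<Omega> (\<lambda>x. - laplacian \<phi> x) u = l * L2_inner \<Omega> \<phi> u" if \<phi>: "\<phi> \<in> solenoidal_test_fields \<Omega>" for \<phi>
  proof -
    have test: "\<phi> \<in> test_functions \<Omega>" and L2: "\<phi> \<in> L2 \<Omega>"
      using \<phi> solenoidal_subset test_functions_L2[OF \<Omega>(1)] by blast+
    have "L2_inner \<Omega> (\<lambda>x. - laplacian \<phi> x) u = - (\<Sum>i\<in>UNIV. L2_inner \<Omega> (partials [i, i] \<phi>) u)"
      unfolding laplacian_def L2_inner_minus_left
      by (subst L2_inner_sum_left) (intro refl test_functions_L2 \<Omega> uL2 test_functions_partials test)+
    also have "\<dots> = - (\<Sum>i\<in>UNIV. L2_inner \<Omega> \<phi> (weak_deriv \<Omega> [i, i] u))"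
    proof -
      have "L2_inner \<Omega> (partials [i, i] \<phi>) u = L2_inner \<Omega> \<phi> (weak_deriv \<Omega> [i, i] u)" for i
        using weak_deriv_inner[OF \<Omega>(1) uL2 g(1) g(2) test, of "[i, i]"] by simp
      then show ?thesis
        by (simp only:)
    qed
    also have "\<dots> = L2_inner \<Omega> (\<lambda>x. - weak_laplacian \<Omega> u x) \<phi>"
      unfolding weak_laplacian_def L2_inner_minus_left
      by (subst L2_inner_sum_left) (use g L2 in \<open>auto simp: L2_inner_commute[of \<Omega> \<phi>]\<close>)
    also have "\<dots> = L2_inner \<Omega> f \<phi>"
      using f(4)[OF solenoidal_test_fields_L2[OF \<Omega>(1) \<phi>]] by (simp add: L2_inner_diff_left[OF f(2,3) L2])
    also have "\<dots> = L2_inner \<Omega> (\<lambda>x. l *\<^sub>R u x) \<phi>"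
      by (rule L2_inner_cong_AE[OF uf(5)]) (use f uL2 L2 in \<open>auto intro: L2_scaleR\<close>)
    finally show ?thesis
      by (simp only: L2_inner_scaleR_left L2_inner_commute[of \<Omega> u])
  qed
  obtain \<phi> where \<phi>: "\<And>k::nat. \<phi> k \<in> solenoidal_test_fields \<Omega>"
      "(\<lambda>k. sobolev_norm 1 \<Omega> (\<lambda>x. \<phi> k x - u x)) \<longlonglongrightarrow> 0"
    using uf(2) by (auto simp: solenoidal_W12_def)
  have test: "\<phi> k \<in> test_functions \<Omega>" for k
    using \<phi>(1) solenoidal_subset by blast
  have L2: "\<phi> k \<in> L2 \<Omega>" "partials is (\<phi> k) \<in> L2 \<Omega>" for k "is"
    by (intro test_functions_L2 \<Omega> test test_functions_partials)+
  \<comment> \<open>\<open>sobolev_norm\<close> contains the chosen weak derivatives of a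
    difference; up to null sets they are the classical derivatives of \<open>\<phi> k\<close> minus
    the chosen ones of \<open>u\<close>.\<close>
  have norm: "L2_norm \<Omega> (weak_deriv \<Omega> is (\<lambda>x. \<phi> k x - u x)) =
      L2_norm \<Omega> (\<lambda>x. partials (rev is) (\<phi> k) x - weak_deriv \<Omega> is u x)" if "length is \<le> 1" for k "is"
    by (rule L2_norm_weak_deriv[OF \<Omega>])
      (use that in \<open>auto intro!: L2_diff L2 g has_weak_deriv_diff \<Omega> uL2 has_weak_deriv_smooth test_functions_Ck[OF test]\<close>)
  have lim: "(\<lambda>k. L2_norm \<Omega> (\<lambda>x. partials (rev is) (\<phi> k) x - weak_deriv \<Omega> is u x)) \<longlonglongrightarrow> 0" if "length is \<le> 1" for "is"
    using \<phi>(2) that unfolding sobolev_norm_tendsto_0_iff by (simp only: norm[OF that, symmetric])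
  have approx: "energy_approx \<Omega> (solenoidal_test_fields \<Omega>) \<phi> u"
  proof (rule energy_approxI[OF \<Omega>(1) solenoidal_subset \<phi>(1)])
    have "L2_norm \<Omega> (\<lambda>x. \<phi> k x - weak_deriv \<Omega> [] u x) = L2_norm \<Omega> (\<lambda>x. \<phi> k x - u x)" for k
    proof (rule L2_norm_cong_AE)
      show "AE x in lebesgue_on \<Omega>. \<phi> k x - weak_deriv \<Omega> [] u x = \<phi> k x - u x"
        using weak_deriv_AE[OF \<Omega> uL2 has_weak_deriv_Nil] by eventually_elim simp
    qed (auto intro!: L2_diff L2 uL2 g)
    then show "(\<lambda>k. L2_norm \<Omega> (\<lambda>x. \<phi> k x - u x)) \<longlonglongrightarrow> 0"
      using lim[of "[]"] by simp
    show "weak_deriv \<Omega> [i] u \<in> L2 \<Omega>" for i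
      by (rule g) simp
    show "(\<lambda>k. L2_norm \<Omega> (\<lambda>x. partial i (\<phi> k) x - weak_deriv \<Omega> [i] u x)) \<longlonglongrightarrow> 0" for i
      using lim[of "[i]"] by simp
  qed
  show ?thesis
    unfolding weak_eigenpair_def
    by (intro exI[of _ u] conjI ballI weak uL2 uf(4) exI[of _ \<phi>] approx)
qed

section \<open>Explicit eigenfunctions\<close>

lemma not_AE_eq_0_of_continuous:
  fixes u :: "real ^ 'n::finite \<Rightarrow> 'b::euclidean_space"
  assumes "open \<Omega>" "continuous_on \<Omega> u" "x \<in> \<Omega>" "u x \<noteq> 0"
  shows "\<not> (AE x in lebesgue_on \<Omega>. u x = 0)"
proof
  assume AE: "AE x in lebesgue_on \<Omega>. u x = 0"
  let ?U = "\<Omega> \<inter> u -` (- {0})"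
  have "open ?U"
    using assms(1,2) by (intro continuous_open_preimage) auto
  have "AE x in lebesgue. x \<in> \<Omega> \<longrightarrow> u x = 0"
    using AE assms(1) by (subst (asm) AE_restrict_space_iff) auto
  then have "AE x in lebesgue. x \<notin> ?U"
    by eventually_elim auto
  then have "?U \<in> null_sets lebesgue"
    using \<open>open ?U\<close> by (subst AE_iff_null_sets) auto
  then have "negligible ?U"
    by (simp add: negligible_iff_null_sets)
  moreover obtain r where "r > 0" "ball x r \<subseteq> ?U"
    using openE[OF \<open>open ?U\<close>, of x] assms(3,4) by auto
  ultimately have "measure lebesgue (ball x r) = 0"
    by (intro negligible_imp_measure0) (rule negligible_subset)
  then show False
    using content_ball_pos[OF \<open>r > 0\<close>, of x] by simp
qed

text \<open>
  Here \<open>P\<close> is homogeneous of degree \<open>deg \<in> {0, 1}\<close> with constant derivative \<open>P'\<close>; multiplication by \<open>P\<close>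
  turns the radial equation in dimension \<open>n\<close> into that in dimension \<open>m = n + 2 deg\<close>.
\<close>

locale shell_mode =
  fixes A m l :: real and F :: "real \<Rightarrow> real" and P P' :: "real ^ 'n::finite \<Rightarrow> 'b::euclidean_space"
    and deg :: real
  assumes A: "1 < A" and m: "m = real CARD('n) + 2 * deg"
    and F: "\<And>k. Ck k {-2<..<2} F" "F 0 = 0" "F (1 + 1 / A) = 0" "deriv F 0 = 1"
    and ODE: "\<And>t. t \<in> {-2<..<2} \<Longrightarrow>
      (1 + 2 * (2 / A) * t) * deriv (deriv F) t + m * (2 / A) * deriv F t + l * F t = 0"
    and P: "\<And>x. (P has_derivative P') (at x)"
    and Euler: "\<And>x. P' x = deg *\<^sub>R P x"
    and P_nonzero: "\<exists>v. norm v = 1 \<and> (\<forall>r>0. P (r *\<^sub>R v) \<noteq> 0)"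
begin

text \<open>With \<open>a = A / 2\<close> and \<open>\<epsilon> = 2 / A\<close> this is
  \<open>1 + \<epsilon> / 2\<close>, the value of \<open>tau\<close> on the outer sphere.\<close>

definition end_pt :: real where "end_pt = 1 + 1 / A"

definition tau :: "real ^ 'n \<Rightarrow> real" where "tau x = (x \<bullet> x - (A / 2)\<^sup>2) / A"

text \<open>The profile is left open so that the cut-off modes have the same form as the mode itself
  and share its algebraic properties.\<close>

definition radial :: "(real \<Rightarrow> real) \<Rightarrow> real ^ 'n \<Rightarrow> 'b" where "radial h x = h (tau x) *\<^sub>R P x"

abbreviation "mode \<equiv> radial F"

abbreviation "shell \<equiv> annulus A :: (real ^ 'n) set"

text \<open>Contains the closed shell in its interior, so that all derivatives of the mode are
  bounded on the shell.\<close>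

definition domain :: "(real ^ 'n) set" where "domain = {x. tau x \<in> {-2<..<2}}"

lemma end_pt: "1 < end_pt" "end_pt < 2" "F end_pt = 0"
  using A F(3) by (auto simp: end_pt_def)

lemma tau_eq: "x \<bullet> x = A * tau x + (A / 2)\<^sup>2"
  using A by (simp add: tau_def)

lemma Ck_tau: "open S \<Longrightarrow> Ck k S tau"
  unfolding tau_def[abs_def] divide_inverse
  by (intro Ck_mult Ck_diff Ck_inner Ck_const Ck_bounded_linear_id bounded_linear_ident)

lemma continuous_on_tau: "continuous_on S tau"
  unfolding tau_def[abs_def] using A by (intro continuous_intros) auto

lemma mem_shell: "x \<in> shell \<longleftrightarrow> 0 < tau x \<and> tau x < end_pt"
proof -
  have "A / 2 < norm x \<longleftrightarrow> (A / 2)\<^sup>2 < (norm x)\<^sup>2"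
    using A by (auto intro: power_strict_mono dest: power_less_imp_less_base)
  moreover have "norm x < 1 + A / 2 \<longleftrightarrow> (norm x)\<^sup>2 < (1 + A / 2)\<^sup>2"
    using A by (auto intro: power_strict_mono dest: power_less_imp_less_base)
  moreover have "(1 + A / 2)\<^sup>2 = A * end_pt + (A / 2)\<^sup>2"
    using A by (simp add: end_pt_def power2_eq_square field_simps)
  ultimately show ?thesis
    using A by (auto simp: annulus_def power2_norm_eq_inner tau_eq zero_less_mult_iff)
qed

lemma open_domain: "open domain"
proof -
  have "domain = tau -` {-2<..<2}"
    by (auto simp: domain_def)
  then show ?thesis
    using continuous_on_tau[of UNIV] by (simp add: open_vimage)
qed

lemma closure_shell: "closure shell \<subseteq> domain" "shell \<subseteq> domain"
proof -
  have "closed {x. tau x \<in> {0..end_pt}}"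
    using continuous_on_tau[of UNIV] closed_vimage[of "{0..end_pt}" tau] by (simp add: vimage_def)
  then have "closure shell \<subseteq> {x. tau x \<in> {0..end_pt}}"
    by (intro closure_minimal) (auto simp: mem_shell)
  then show "closure shell \<subseteq> domain"
    using end_pt by (force simp: domain_def)
  then show "shell \<subseteq> domain"
    using closure_subset by blast
qed

lemma P'_linear: "bounded_linear P'"
  using P[of 0] by (rule has_derivative_bounded_linear)

lemma Ck_P: "Ck k UNIV P"
proof (cases k)
  case 0
  then show ?thesis
    using P by (auto intro!: continuous_at_imp_continuous_on has_derivative_continuous)
next
  case (Suc j)
  have "Ck (Suc j) UNIV P"
    by (rule Ck_SucI[where f' = "\<lambda>x. P'"]) (use P in \<open>auto intro: Ck_const\<close>)
  then show ?thesis
    by (simp only: Suc)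
qed

lemma Ck_radial:
  assumes "open S" "Ck k S h"
  shows "Ck k {x. tau x \<in> S} (radial h)"
proof -
  have "open (tau -` S)"
    using continuous_on_tau[of UNIV] assms(1) by (simp add: open_vimage)
  then have o: "open {x. tau x \<in> S}"
    by (simp add: vimage_def)
  show ?thesis
    unfolding radial_def[abs_def]
    by (intro Ck_scaleR o Ck_compose_real[OF o assms(2)] Ck_tau Ck_subset[OF Ck_P]) auto
qed

lemma Ck_mode: "Ck k domain mode"
  unfolding domain_def by (rule Ck_radial[OF _ F(1)]) simp

lemma Ck_mode_shell: "Ck k shell mode"
  using Ck_subset[OF Ck_mode closure_shell(2)] .

lemma scalar_has_derivative:
  assumes "(h has_real_derivative h') (at (tau x))"
  shows "((\<lambda>x. h (tau x)) has_derivative (\<lambda>v. h' * (2 * (x \<bullet> v) / A))) (at x)"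
proof (rule has_derivative_compose[where f = tau and f' = "\<lambda>v. 2 * (x \<bullet> v) / A" and g' = "\<lambda>v. h' * v"])
  have "((\<lambda>x. x \<bullet> x) has_derivative (\<lambda>v. 2 * (x \<bullet> v))) (at x)"
    using has_derivative_inner[OF has_derivative_ident has_derivative_ident, of x UNIV]
    by (simp add: inner_commute)
  from has_derivative_mult_left[OF has_derivative_diff[OF this has_derivative_const[of "(A / 2)\<^sup>2"]], of "inverse A"]
  show "(tau has_derivative (\<lambda>v. 2 * (x \<bullet> v) / A)) (at x)"
    by (simp only: tau_def[abs_def] divide_inverse diff_zero)
  show "(h has_derivative (\<lambda>v. h' * v)) (at (tau x))"
    using assms by (simp add: has_field_derivative_def)
qed

lemma partial_radial:
  assumes "(h has_real_derivative h') (at (tau x))"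
  shows "partial i (radial h) x = (h' * (2 * x $ i / A)) *\<^sub>R P x + h (tau x) *\<^sub>R P' (axis i 1)"
  unfolding radial_def[abs_def]
  using partial_eqI[OF has_derivative_scaleR[OF scalar_has_derivative[OF assms] P], of i]
  by (simp add: inner_axis add.commute)

lemma F_deriv:
  assumes "t \<in> {-2<..<2}"
  shows "(F has_real_derivative deriv F t) (at t)" "(deriv F has_real_derivative deriv (deriv F) t) (at t)"
  using Ck_Suc_real_derivative[OF F(1) assms]
    Ck_Suc_real_derivative[OF Ck_deriv[OF _ F(1)] assms] by auto

lemma partial2_mode:
  assumes x: "x \<in> domain"
  shows "partials [i, i] mode x = (2 / A * deriv F (tau x)) *\<^sub>R P x +
    ((2 * x $ i / A)\<^sup>2 * deriv (deriv F) (tau x)) *\<^sub>R P x +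
    (2 * (2 / A) * deriv F (tau x)) *\<^sub>R (x $ i *\<^sub>R P' (axis i 1))"
proof -
  define G where "G x = (deriv F (tau x) * (2 * x $ i / A)) *\<^sub>R P x + F (tau x) *\<^sub>R P' (axis i 1)" for x
  have t: "tau x \<in> {-2<..<2}" if "x \<in> domain" for x
    using that by (simp add: domain_def)
  have "partial i (partial i mode) x = partial i G x"
    by (rule partial_cong_open[OF open_domain x]) (simp add: partial_radial[OF F_deriv(1)[OF t]] G_def)
  also have "\<dots> = (deriv F (tau x) * (2 / A) + deriv (deriv F) (tau x) * (2 * x $ i / A) * (2 * x $ i / A)) *\<^sub>R P x +
      (deriv F (tau x) * (2 * x $ i / A)) *\<^sub>R P' (axis i 1) +
      (deriv F (tau x) * (2 * x $ i / A)) *\<^sub>R P' (axis i 1)"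
  proof -
    have "((\<lambda>x. x $ i) has_derivative (\<lambda>v. v $ i)) (at x)"
      by (rule bounded_linear_imp_has_derivative[OF bounded_linear_vec_nth])
    from has_derivative_mult_right[OF this, of "2 / A"]
    have c: "((\<lambda>x. 2 * x $ i / A) has_derivative (\<lambda>v. 2 * v $ i / A)) (at x)"
      by simp
    note F_tau = scalar_has_derivative[OF F_deriv(1)[OF t[OF x]]] scalar_has_derivative[OF F_deriv(2)[OF t[OF x]]]
    have "(G has_derivative (\<lambda>v. ((deriv F (tau x) * (2 * x $ i / A)) *\<^sub>R P' v +
        (deriv F (tau x) * (2 * v $ i / A) + deriv (deriv F) (tau x) * (2 * (x \<bullet> v) / A) * (2 * x $ i / A)) *\<^sub>R P x) +
        (deriv F (tau x) * (2 * (x \<bullet> v) / A)) *\<^sub>R P' (axis i 1))) (at x)"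
      unfolding G_def[abs_def]
      by (rule has_derivative_add[OF has_derivative_scaleR[OF has_derivative_mult[OF F_tau(2) c] P]
            has_derivative_scaleR_left[OF F_tau(1)]])
    from partial_eqI[OF this, of i] show ?thesis
      by (simp add: inner_axis algebra_simps)
  qed
  finally show ?thesis
    by (simp add: algebra_simps power2_eq_square flip: scaleR_add_left)
qed

lemma sum_P': "(\<Sum>i\<in>UNIV. x $ i *\<^sub>R P' (axis i 1)) = deg *\<^sub>R P x"
proof -
  interpret bounded_linear P' by (rule P'_linear)
  have "x = (\<Sum>i\<in>UNIV. x $ i *\<^sub>R axis i 1)"
    using basis_expansion[of x] by (simp add: scalar_mult_eq_scaleR)
  from arg_cong[OF this, of P'] have "P' x = (\<Sum>i\<in>UNIV. x $ i *\<^sub>R P' (axis i 1))"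
    by (simp only: sum scale)
  then show ?thesis
    by (simp only: Euler[of x, symmetric])
qed

text \<open>The squared gradient of \<open>tau\<close> is
  \<open>4 |x|\<^sup>2 / A\<^sup>2 = 1 + 2 \<epsilon> tau\<close> and its Laplacian is
  \<open>n \<epsilon>\<close>, where \<open>\<epsilon> = 2 / A\<close>. The mixed term of gradients
  contributes \<open>2 \<epsilon> deg F' P\<close> by Euler's identity, which raises
  \<open>n\<close> to \<open>m\<close>. The radial equation does the rest.\<close>

lemma laplacian_mode:
  assumes "x \<in> domain"
  shows "laplacian mode x = - l *\<^sub>R mode x"
proof -
  let ?F0 = "F (tau x)" and ?F1 = "deriv F (tau x)" and ?F2 = "deriv (deriv F) (tau x)"
  have "laplacian mode x = (\<Sum>i\<in>(UNIV :: 'n set). (2 / A * ?F1) *\<^sub>R P x) + (\<Sum>i\<in>UNIV. ((2 * x $ i / A)\<^sup>2 * ?F2) *\<^sub>R P x) +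
      (\<Sum>i\<in>UNIV. (2 * (2 / A) * ?F1) *\<^sub>R (x $ i *\<^sub>R P' (axis i 1)))"
    unfolding laplacian_def by (simp only: partial2_mode[OF assms] sum.distrib)
  also have "(\<Sum>i\<in>(UNIV :: 'n set). (2 / A * ?F1) *\<^sub>R P x) = (real CARD('n) * (2 / A * ?F1)) *\<^sub>R P x"
    by (simp add: scaleR_left.sum[symmetric] sum_constant_scaleR)
  also have "(\<Sum>i\<in>UNIV. ((2 * x $ i / A)\<^sup>2 * ?F2) *\<^sub>R P x) = (((\<Sum>i\<in>UNIV. (2 * x $ i / A)\<^sup>2)) * ?F2) *\<^sub>R P x"
    by (simp only: scaleR_left.sum sum_distrib_right)
  also have "(\<Sum>i\<in>UNIV. (2 * x $ i / A)\<^sup>2) = 4 / A\<^sup>2 * (x \<bullet> x)"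
    by (simp add: inner_vec_def sum_distrib_left power2_eq_square mult_ac)
  also have "4 / A\<^sup>2 * (x \<bullet> x) = 1 + 2 * (2 / A) * tau x"
    unfolding tau_eq using A by (simp add: field_simps power2_eq_square)
  also have "(\<Sum>i\<in>UNIV. (2 * (2 / A) * ?F1) *\<^sub>R (x $ i *\<^sub>R P' (axis i 1))) = (2 * (2 / A) * ?F1 * deg) *\<^sub>R P x"
    unfolding scaleR_sum_right[symmetric] sum_P' by simp
  also have "(real CARD('n) * (2 / A * ?F1)) *\<^sub>R P x + ((1 + 2 * (2 / A) * tau x) * ?F2) *\<^sub>R P x +
      (2 * (2 / A) * ?F1 * deg) *\<^sub>R P x =
      ((1 + 2 * (2 / A) * tau x) * ?F2 + m * (2 / A) * ?F1) *\<^sub>R P x"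
    unfolding m by (simp add: algebra_simps flip: scaleR_add_left)
  also have "(1 + 2 * (2 / A) * tau x) * ?F2 + m * (2 / A) * ?F1 = - l * ?F0"
    using ODE[of "tau x"] assms by (simp add: domain_def)
  finally show ?thesis
    by (simp add: radial_def[of F x])
qed

lemma partials_mode_L2: "partials is mode \<in> L2 shell"
  by (rule partials_L2[OF open_annulus bounded_annulus open_domain closure_shell(1) Ck_mode])

lemma mode_L2: "mode \<in> L2 shell"
  using partials_mode_L2[of "[]"] by simp

lemma mode_weak_deriv: "has_weak_deriv shell is mode (partials (rev is) mode)"
  by (rule has_weak_deriv_smooth[OF open_annulus Ck_mode_shell])

text \<open>Since \<open>F 0 = 0\<close> and \<open>F' 0 = 1\<close>, the profile is positive just
  outside the inner sphere; there the mode is non-zero on the ray along \<open>v\<close>, and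
  continuity spreads this to a ball.\<close>

lemma mode_nonzero: "\<not> (AE x in lebesgue_on shell. mode x = 0)"
proof -
  obtain d where d: "d > 0" "\<And>h. 0 < h \<Longrightarrow> h < d \<Longrightarrow> F 0 < F (0 + h)"
    using DERIV_pos_inc_right[OF F_deriv(1)[of 0]] F(4) by auto
  define t where "t = min d 1 / 2"
  have t: "0 < t" "t < d" "t < end_pt"
    using d(1) end_pt by (auto simp: t_def)
  then have "F t > 0"
    using d(2)[of t] F(2) by simp
  obtain v where v: "norm v = 1" "\<And>r. r > 0 \<Longrightarrow> P (r *\<^sub>R v) \<noteq> 0"
    using P_nonzero by blast
  define r where "r = sqrt (A * t + (A / 2)\<^sup>2)"
  have "r > 0"
    using A t by (auto simp: r_def intro!: add_pos_pos)
  have "(r *\<^sub>R v) \<bullet> (r *\<^sub>R v) = r\<^sup>2"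
    using v(1) by (simp add: norm_eq_1 power2_eq_square)
  also have "r\<^sup>2 = A * t + (A / 2)\<^sup>2"
    using A t by (simp add: r_def)
  finally have "tau (r *\<^sub>R v) = t"
    unfolding tau_def using A by simp
  then show ?thesis
    using not_AE_eq_0_of_continuous[OF open_annulus Ck_imp_continuous_on[OF Ck_mode_shell], of "r *\<^sub>R v"]
      t v(2)[OF \<open>r > 0\<close>] \<open>F t > 0\<close> by (simp add: mem_shell radial_def)
qed

text \<open>The cut-off acts on the profile, hence the last clause, which in the Stokes case makes
  the approximants divergence-free. Values and first derivatives are uniformly bounded and agree
  with those of the mode from some index on at each point, so dominated convergence applies.\<close>

lemma mode_approximation:
  obtains \<phi> where "\<And>k::nat. \<phi> k \<in> test_functions shell"
    "(\<lambda>k. L2_norm shell (\<lambda>x. \<phi> k x - mode x)) \<longlonglongrightarrow> 0"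
    "\<And>i. (\<lambda>k. L2_norm shell (\<lambda>x. partial i (\<phi> k) x - partial i mode x)) \<longlonglongrightarrow> 0"
    "\<And>k. \<exists>h. (\<forall>j. Ck j UNIV h) \<and> \<phi> k = radial h"
proof -
  obtain h C where h: "\<And>k j. Ck j UNIV (h k)"
    "\<And>k t. t \<notin> {1 / real (k + 1)..end_pt - 1 / real (k + 1)} \<Longrightarrow> h k t = 0"
    "\<And>k t. \<bar>h k t\<bar> \<le> C" "\<And>k t. \<bar>deriv (h k) t\<bar> \<le> C"
    "\<And>t. 0 < t \<Longrightarrow> t < end_pt \<Longrightarrow> \<forall>\<^sub>F k in sequentially. h k t = F t \<and> deriv (h k) t = deriv F t"
    by (rule cutoff_approximation[of "{-2<..<2}" end_pt F]) (use end_pt F in auto)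
  have "C \<ge> 0"
    using h(3)[of 0 0] by linarith
  \<comment> \<open>At each interior point \<open>F\<close> and its derivative coincide with those
    of some \<open>h k\<close> and inherit the bound \<open>C\<close>.\<close>
  have FC: "\<bar>F t\<bar> \<le> C" "\<bar>deriv F t\<bar> \<le> C" if t: "0 < t" "t < end_pt" for t
  proof -
    obtain k where "h k t = F t \<and> deriv (h k) t = deriv F t"
      using eventually_happens'[OF sequentially_bot h(5)[OF t]] by blast
    then show "\<bar>F t\<bar> \<le> C" "\<bar>deriv F t\<bar> \<le> C"
      using h(3)[of k t] h(4)[of k t] by auto
  qed
  define \<phi> where "\<phi> k = radial (h k)" for k
  have dh: "(h k has_real_derivative deriv (h k) t) (at t)" for k t
    using Ck_Suc_real_derivative[OF h(1)] by blast
  have test: "\<phi> k \<in> test_functions shell" for k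
  proof (rule test_functionsI)
    let ?I = "{1 / real (k + 1)..end_pt - 1 / real (k + 1)}"
    show "Ck j UNIV (\<phi> k)" for j
      using Ck_radial[OF open_UNIV h(1)] by (simp add: \<phi>_def)
    have pos: "0 < 1 / real (k + 1)"
      by simp
    show sub: "{x. tau x \<in> ?I} \<subseteq> shell"
    proof
      fix x assume "x \<in> {x. tau x \<in> ?I}"
      then have "1 / real (k + 1) \<le> tau x" "tau x \<le> end_pt - 1 / real (k + 1)"
        by auto
      with pos have "0 < tau x" "tau x < end_pt"
        by linarith+
      then show "x \<in> shell"
        by (simp add: mem_shell)
    qed
    have "closed {x. tau x \<in> ?I}"
      using continuous_on_tau[of UNIV] closed_vimage[of ?I tau] by (simp add: vimage_def)
    moreover have "bounded {x. tau x \<in> ?I}"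
      using bounded_subset[OF bounded_annulus sub] .
    ultimately show "compact {x. tau x \<in> ?I}"
      by (simp add: compact_eq_bounded_closed)
    show "\<phi> k x = 0" if "x \<notin> {x. tau x \<in> ?I}" for x
      using h(2)[of "tau x" k] that by (simp add: \<phi>_def radial_def)
  qed
  have "bounded (P ` closure shell)"
    by (intro compact_imp_bounded compact_continuous_image continuous_on_subset[OF Ck_imp_continuous_on[OF Ck_P]])
      (auto simp: bounded_annulus)
  then obtain CP where CP: "\<And>x. x \<in> shell \<Longrightarrow> norm (P x) \<le> CP"
    using closure_subset unfolding bounded_iff by fastforce
  note t_shell = mem_shell[THEN iffD1]
  have lim0: "(\<lambda>k. L2_norm shell (\<lambda>x. \<phi> k x - mode x)) \<longlonglongrightarrow> 0"
  proof (rule L2_norm_tendsto_0[OF open_annulus bounded_annulus])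
    show "(\<lambda>x. \<phi> k x - mode x) \<in> L2 shell" for k
      by (intro L2_diff test_functions_L2 open_annulus test mode_L2)
    show "norm (\<phi> k x - mode x) \<le> (C + C) * CP" if x: "x \<in> shell" for k x
    proof -
      have "\<phi> k x - mode x = (h k (tau x) - F (tau x)) *\<^sub>R P x"
        by (simp add: \<phi>_def radial_def scaleR_diff_left)
      moreover have "\<bar>h k (tau x) - F (tau x)\<bar> \<le> C + C"
        using h(3)[of k "tau x"] FC(1)[of "tau x"] t_shell[OF x] by linarith
      ultimately show ?thesis
        using CP[OF x] \<open>C \<ge> 0\<close> by (simp add: mult_mono)
    qed
    show "\<forall>\<^sub>F k in sequentially. \<phi> k x - mode x = 0" if x: "x \<in> shell" for x
      using h(5)[of "tau x"] t_shell[OF x] by (auto simp: \<phi>_def radial_def elim: eventually_mono)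
  qed
  have lim1: "(\<lambda>k. L2_norm shell (\<lambda>x. partial i (\<phi> k) x - partial i mode x)) \<longlonglongrightarrow> 0" for i
  proof (rule L2_norm_tendsto_0[OF open_annulus bounded_annulus])
    show "(\<lambda>x. partial i (\<phi> k) x - partial i mode x) \<in> L2 shell" for k
      using L2_diff[OF test_functions_L2[OF open_annulus test_functions_partial[OF test]] partials_mode_L2[of "[i]"]]
      by simp
    have diff: "partial i (\<phi> k) x - partial i mode x =
        ((deriv (h k) (tau x) - deriv F (tau x)) * (2 * x $ i / A)) *\<^sub>R P x +
        (h k (tau x) - F (tau x)) *\<^sub>R P' (axis i 1)" if x: "x \<in> shell" for k x
    proof -
      have "tau x \<in> {-2<..<2}"
        using x closure_shell(2) by (auto simp: domain_def)
      then show ?thesis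
        by (simp add: \<phi>_def partial_radial[OF dh] partial_radial[OF F_deriv(1)] algebra_simps)
    qed
    show "norm (partial i (\<phi> k) x - partial i mode x) \<le>
        (C + C) * (2 * (1 + A / 2) / A) * CP + (C + C) * norm (P' (axis i 1))" if x: "x \<in> shell" for k x
    proof -
      have "\<bar>h k (tau x) - F (tau x)\<bar> \<le> C + C" "\<bar>deriv (h k) (tau x) - deriv F (tau x)\<bar> \<le> C + C"
        using h(3,4)[of k "tau x"] FC[of "tau x"] t_shell[OF x] by linarith+
      moreover have "\<bar>2 * x $ i / A\<bar> \<le> 2 * (1 + A / 2) / A"
        using A component_le_norm_cart[of x i] x by (auto simp: annulus_def intro!: divide_right_mono)
      ultimately have "\<bar>(deriv (h k) (tau x) - deriv F (tau x)) * (2 * x $ i / A)\<bar> * norm (P x) \<le>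
          (C + C) * (2 * (1 + A / 2) / A) * CP"
        "\<bar>h k (tau x) - F (tau x)\<bar> * norm (P' (axis i 1)) \<le> (C + C) * norm (P' (axis i 1))"
        unfolding abs_mult using CP[OF x] A \<open>C \<ge> 0\<close>
        by (intro mult_mono mult_right_mono; simp)+
      then show ?thesis
        unfolding diff[OF x] by (intro order_trans[OF norm_triangle_ineq] add_mono) simp_all
    qed
    show "\<forall>\<^sub>F k in sequentially. partial i (\<phi> k) x - partial i mode x = 0" if x: "x \<in> shell" for x
      using h(5)[of "tau x"] t_shell[OF x] by (auto simp: diff[OF x] elim: eventually_mono)
  qed
  show thesis
    by (rule that[OF test lim0 lim1]) (use h(1) in \<open>auto simp: \<phi>_def\<close>)
qed

end

text \<open>Both halves of the Friedrichs domain are checked on the mode: the adjoint equation by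
  moving two derivatives from the test function to the mode, and the energy space by the cut-off
  profiles.\<close>

lemma laplace_eigenvalue_mode:
  fixes P P' :: "real ^ 'n::finite \<Rightarrow> real"
  assumes "shell_mode A m l F P P' deg"
  shows "is_eigenvalue (annulus A :: (real ^ 'n) set) (laplace_operator (annulus A)) l"
proof -
  interpret shell_mode A m l F P P' deg by fact
  let ?S = "{(\<phi>, \<lambda>x. - laplacian \<phi> x) |\<phi>. \<phi> \<in> test_functions shell} ::
    ((real ^ 'n \<Rightarrow> real) \<times> (real ^ 'n \<Rightarrow> real)) set"
  let ?f = "\<lambda>x. l *\<^sub>R mode x"
  have weak: "L2_inner shell (\<lambda>x. - laplacian \<phi> x) mode = L2_inner shell \<phi> ?f"
    if \<phi>: "\<phi> \<in> test_functions shell" for \<phi>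
  proof -
    have "L2_inner shell (partials [i, i] \<phi>) mode = L2_inner shell \<phi> (partials [i, i] mode)" for i
      using weak_deriv_inner[OF open_annulus mode_L2 partials_mode_L2 mode_weak_deriv[of "[i, i]"] \<phi>] by simp
    then have "L2_inner shell (\<lambda>x. - laplacian \<phi> x) mode = - (\<Sum>i\<in>UNIV. L2_inner shell \<phi> (partials [i, i] mode))"
      unfolding laplacian_def L2_inner_minus_left
      by (subst L2_inner_sum_left) (simp_all add: test_functions_L2[OF open_annulus] test_functions_partial \<phi> mode_L2)
    also have "\<dots> = - L2_inner shell \<phi> (laplacian mode)"
      unfolding laplacian_def
      by (subst L2_inner_sum_right) (simp_all only: partials_mode_L2 test_functions_L2[OF open_annulus \<phi>])
    also have "L2_inner shell \<phi> (laplacian mode) = L2_inner shell \<phi> (\<lambda>x. - l *\<^sub>R mode x)"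
      by (rule L2_inner_cong) (use laplacian_mode closure_shell(2) in auto)
    finally show ?thesis
      by (simp only: L2_inner_scaleR_right)
  qed
  obtain \<phi> where \<phi>: "\<And>k::nat. \<phi> k \<in> test_functions shell"
    "(\<lambda>k. L2_norm shell (\<lambda>x. \<phi> k x - mode x)) \<longlonglongrightarrow> 0"
    "\<And>i. (\<lambda>k. L2_norm shell (\<lambda>x. partial i (\<phi> k) x - partial i mode x)) \<longlonglongrightarrow> 0"
    "\<And>k. \<exists>h. (\<forall>j. Ck j UNIV h) \<and> \<phi> k = radial h"
    by (rule mode_approximation, rule that)
  have approx: "energy_approx shell (test_functions shell) \<phi> mode"
    by (rule energy_approxI[OF open_annulus order_refl \<phi>(1,2) _ \<phi>(3)]) (use partials_mode_L2[of "[_]"] in simp)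
  have "\<exists>N. \<forall>k\<ge>N. \<forall>m\<ge>N. \<bar>L2_inner shell (\<lambda>x. - laplacian (\<phi> k) x - - laplacian (\<phi> m) x)
      (\<lambda>x. \<phi> k x - \<phi> m x)\<bar> < e" if "e > 0" for e
  proof -
    have "L2_inner shell (\<lambda>x. - laplacian (\<phi> k) x - - laplacian (\<phi> m) x) (\<lambda>x. \<phi> k x - \<phi> m x) =
        dirichlet shell (\<lambda>x. \<phi> k x - \<phi> m x) (\<lambda>x. \<phi> k x - \<phi> m x)" for k m
    proof -
      have "(\<lambda>x. - laplacian (\<phi> k) x - - laplacian (\<phi> m) x) = (\<lambda>x. - laplacian (\<lambda>x. \<phi> k x - \<phi> m x) x)"
        using laplacian_diff[OF \<phi>(1) \<phi>(1)] by auto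
      then show ?thesis
        by (simp only: L2_inner_laplacian[OF open_annulus test_functions_diff[OF \<phi>(1) \<phi>(1)]
              test_functions_diff[OF \<phi>(1) \<phi>(1)]])
    qed
    then show ?thesis
      using approx \<open>e > 0\<close> by (simp add: energy_approx_def abs_of_nonneg[OF dirichlet_nonneg])
  qed
  then have "mode \<in> energy_space shell ?S"
    unfolding energy_space_def
    by (intro CollectI conjI mode_L2 exI[of _ \<phi>] exI[of _ "\<lambda>k x. - laplacian (\<phi> k) x"] allI impI)
      (use \<phi>(1,2) in auto)
  moreover have "(mode, ?f) \<in> adjoint_graph shell ?S"
    using weak mode_L2 L2_scaleR[OF mode_L2] by (auto simp: adjoint_graph_def)
  ultimately have "(mode, ?f) \<in> laplace_operator shell"
    by (simp add: laplace_operator_def friedrichs_extension_def)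
  then show ?thesis
    unfolding is_eigenvalue_def using mode_nonzero by (intro bexI[of _ "(mode, ?f)"]) auto
qed

text \<open>In the divergence of \<open>radial h\<close>, \<open>orth\<close> kills the term with
  the derivative of \<open>h\<close> and \<open>trace\<close> the other, for every profile
  \<open>h\<close>. Hence the mode and its cut-offs are solenoidal, and as the Laplacian of the mode
  is a multiple of the mode, the projection leaves it unchanged.\<close>

lemma stokes_eigenvalue_mode:
  fixes P P' :: "real ^ 'n::finite \<Rightarrow> real ^ 'n"
  assumes "shell_mode A m l F P P' deg"
    and orth: "\<And>x. x \<bullet> P x = 0" and trace: "(\<Sum>i\<in>UNIV. P' (axis i 1) $ i) = 0"
  shows "is_eigenvalue (annulus A :: (real ^ 'n) set) (stokes_operator (annulus A)) l"
proof -
  interpret shell_mode A m l F P P' deg by fact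
  let ?f = "\<lambda>x. l *\<^sub>R mode x"
  obtain \<phi> where \<phi>: "\<And>k::nat. \<phi> k \<in> test_functions shell"
    "(\<lambda>k. L2_norm shell (\<lambda>x. \<phi> k x - mode x)) \<longlonglongrightarrow> 0"
    "\<And>i. (\<lambda>k. L2_norm shell (\<lambda>x. partial i (\<phi> k) x - partial i mode x)) \<longlonglongrightarrow> 0"
    "\<And>k. \<exists>h. (\<forall>j. Ck j UNIV h) \<and> \<phi> k = radial h"
    by (rule mode_approximation, rule that)
  have sol: "\<phi> k \<in> solenoidal_test_fields shell" for k
  proof -
    obtain h where h: "\<And>j. Ck j UNIV h" "\<phi> k = radial h"
      using \<phi>(4) by blast
    have "divergence (\<phi> k) x = 0" for x
    proof -
      have "(h has_real_derivative deriv h (tau x)) (at (tau x))"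
        using Ck_Suc_real_derivative[OF h(1)] by blast
      then have "divergence (\<phi> k) x =
          (\<Sum>i\<in>UNIV. 2 * deriv h (tau x) / A * (x $ i * P x $ i) + h (tau x) * P' (axis i 1) $ i)"
        by (simp add: divergence_def h(2) partial_radial mult_ac)
      also have "\<dots> = 2 * deriv h (tau x) / A * (x \<bullet> P x) + h (tau x) * (\<Sum>i\<in>UNIV. P' (axis i 1) $ i)"
        by (simp add: sum.distrib inner_vec_def sum_distrib_left)
      finally show ?thesis
        by (simp add: orth trace)
    qed
    then show ?thesis
      using \<phi>(1) by (simp add: solenoidal_test_fields_def)
  qed
  have sob: "mode \<in> sobolev k shell" for k
    unfolding sobolev_def using mode_L2 partials_mode_L2 mode_weak_deriv by blast
  have norm: "L2_norm shell (weak_deriv shell is (\<lambda>x. \<phi> k x - mode x)) =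
      L2_norm shell (\<lambda>x. partials (rev is) (\<phi> k) x - partials (rev is) mode x)" for k "is"
    by (rule L2_norm_weak_deriv[OF open_annulus bounded_annulus])
      (intro L2_diff has_weak_deriv_diff open_annulus mode_weak_deriv partials_mode_L2 mode_L2
        test_functions_L2 test_functions_partials \<phi>(1) has_weak_deriv_smooth test_functions_Ck[OF \<phi>(1)])+
  have "(\<lambda>k. L2_norm shell (weak_deriv shell is (\<lambda>x. \<phi> k x - mode x))) \<longlonglongrightarrow> 0" if "length is \<le> 1" for "is"
  proof -
    consider "is = []" | i where "is = [i]"
      using \<open>length is \<le> 1\<close> by (cases "is") auto
    then show ?thesis
      unfolding norm using \<phi>(2,3) by cases simp_all
  qed
  then have W12: "mode \<in> solenoidal_W12 shell"
    unfolding solenoidal_W12_def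
    by (intro CollectI conjI sob exI[of _ \<phi>] allI sol) (simp only: sobolev_norm_tendsto_0_iff, blast)
  have fsol: "?f \<in> solenoidal_L2 shell"
  proof -
    have "(\<lambda>x. l *\<^sub>R \<phi> k x) \<in> solenoidal_test_fields shell" for k
    proof -
      have "divergence (\<lambda>x. l *\<^sub>R \<phi> k x) x = l * divergence (\<phi> k) x" for x
        by (simp add: divergence_def partial_scaleR[OF test_functions_differentiable[OF \<phi>(1)]] sum_distrib_left)
      then show ?thesis
        using sol[of k] test_functions_scaleR[OF \<phi>(1)] by (simp add: solenoidal_test_fields_def)
    qed
    moreover have "(\<lambda>k. L2_norm shell (\<lambda>x. l *\<^sub>R \<phi> k x - l *\<^sub>R mode x)) \<longlonglongrightarrow> 0"
      using tendsto_mult_right_zero[OF \<phi>(2), of "\<bar>l\<bar>"]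
      by (simp only: L2_norm_scaleR scaleR_diff_right[symmetric])
    ultimately show ?thesis
      unfolding solenoidal_L2_def
      by (intro CollectI conjI L2_scaleR mode_L2 exI[of _ "\<lambda>k x. l *\<^sub>R \<phi> k x"] allI) auto
  qed
  have wL2: "(\<lambda>x. - weak_laplacian shell mode x) \<in> L2 shell"
    unfolding weak_laplacian_def
    by (intro L2_minus L2_sum weak_deriv_L2_has(1)[OF partials_mode_L2 mode_weak_deriv])
  have "AE x in lebesgue_on shell. \<forall>i\<in>UNIV. weak_deriv shell [i, i] mode x = partials [i, i] mode x"
    using weak_deriv_AE[OF open_annulus bounded_annulus partials_mode_L2 mode_weak_deriv[of "[_, _]"]]
    by (intro AE_finite_allI) (auto simp: open_annulus)
  moreover have "AE x in lebesgue_on shell. x \<in> shell"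
    by (rule AE_I2) simp
  ultimately have AE: "AE x in lebesgue_on shell. - weak_laplacian shell mode x - ?f x = 0"
  proof eventually_elim
    case (elim x)
    then have "weak_laplacian shell mode x = laplacian mode x"
      by (simp add: weak_laplacian_def laplacian_def)
    then show ?case
      using laplacian_mode[of x] elim closure_shell(2) by auto
  qed
  have "L2_inner shell (\<lambda>x. - weak_laplacian shell mode x - ?f x) h = 0" if h: "h \<in> solenoidal_L2 shell" for h
  proof -
    have "h \<in> L2 shell"
      using h by (simp add: solenoidal_L2_def)
    then have "L2_inner shell (\<lambda>x. - weak_laplacian shell mode x - ?f x) h = L2_inner shell (\<lambda>x. 0) h"
      by (intro L2_inner_cong_AE[OF AE AE_I2[OF refl]] L2_diff wL2 L2_scaleR mode_L2 L2_zero)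
    then show ?thesis
      by (simp add: L2_inner_def)
  qed
  then have "((\<lambda>x. - weak_laplacian shell mode x), ?f) \<in> solenoidal_projection shell"
    using wL2 fsol by (simp add: solenoidal_projection_def)
  then have "(mode, ?f) \<in> stokes_operator shell"
    using sob W12 by (simp add: stokes_operator_def)
  then show ?thesis
    unfolding is_eigenvalue_def using mode_nonzero by (intro bexI[of _ "(mode, ?f)"]) auto
qed

text \<open>The parameter \<open>2 / A\<close> tends to 0 from the right, which turns the statement
  on small \<open>\<epsilon>\<close> into one on large \<open>A\<close>.\<close>

lemma shell_mode_exists:
  fixes P P' :: "real ^ 'n::finite \<Rightarrow> 'b::euclidean_space"
  assumes "2 \<le> real CARD('n) + 2 * deg" "0 < \<delta>" "\<delta> \<le> 1"
    and "\<And>x. (P has_derivative P') (at x)" "\<And>x. P' x = deg *\<^sub>R P x"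
    and "\<exists>v. norm v = 1 \<and> (\<forall>r>0. P (r *\<^sub>R v) \<noteq> 0)"
  shows "\<forall>\<^sub>F A in at_top. \<exists>l\<in>{pi\<^sup>2 - \<delta>..pi\<^sup>2 + \<delta>}. \<exists>F. shell_mode A (real CARD('n) + 2 * deg) l F P P' deg"
proof -
  let ?m = "real CARD('n) + 2 * deg"
  have "filterlim (\<lambda>A::real. 2 / A) (at_right 0) at_top"
    by real_asymp
  then have "\<forall>\<^sub>F A in at_top. 0 < 2 / A \<and> 2 / A \<le> 1 / (4 * ?m) \<and>
      (\<exists>l\<in>{pi\<^sup>2 - \<delta>..pi\<^sup>2 + \<delta>}. radial_solution ?m (2 / A) l (1 + (2 / A) / 2) = 0)"
    using radial_eigenvalue_exists[OF assms(1-3)] by (rule eventually_compose_filterlim[rotated])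
  moreover have "\<forall>\<^sub>F A::real in at_top. A > 1"
    by (rule eventually_gt_at_top)
  ultimately show ?thesis
  proof eventually_elim
    case (elim A)
    then obtain l where l: "l \<in> {pi\<^sup>2 - \<delta>..pi\<^sup>2 + \<delta>}" "radial_solution ?m (2 / A) l (1 + (2 / A) / 2) = 0"
      by blast
    have quarter: "x * m \<le> 1 / 4" if "x \<le> 1 / (4 * m)" "0 < m" for x m :: real
      using that by (simp add: field_simps)
    have "0 < ?m"
      using assms(1) by linarith
    then have \<epsilon>: "0 \<le> 2 / A" "2 / A * ?m \<le> 1 / 4"
      using elim by (blast intro: less_imp_le quarter)+
    \<comment> \<open>With \<open>\<delta> \<le> 1\<close> these bounds place \<open>l\<close> in
      the range from 0 to 20 for which the power series is controlled.\<close>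
    have "4 \<le> pi\<^sup>2" "pi\<^sup>2 \<le> 16"
      using power_mono[OF pi_ge_two, of 2] power_mono[OF less_imp_le[OF pi_less_4], of 2] by simp_all
    then have l': "0 \<le> l" "l \<le> 20"
      using l(1) assms(2,3) by auto
    have "shell_mode A ?m l (radial_solution ?m (2 / A) l) P P' deg"
    proof
      show "radial_solution ?m (2 / A) l 0 = 0"
        by (simp add: radial_solution_def powser_zero)
      show "radial_solution ?m (2 / A) l (1 + 1 / A) = 0"
        using l(2) by simp
      show "deriv (radial_solution ?m (2 / A) l) 0 = 1"
        by (rule radial_solution_ODE(2)[OF assms(1) \<epsilon> l', of 0]) simp
      show "(1 + 2 * (2 / A) * t) * deriv (deriv (radial_solution ?m (2 / A) l)) t +
          ?m * (2 / A) * deriv (radial_solution ?m (2 / A) l) t + l * radial_solution ?m (2 / A) l t = 0"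
        if "t \<in> {-2<..<2}" for t
        by (rule radial_solution_ODE(1)[OF assms(1) \<epsilon> l' that])
    qed (use elim assms(4-6) Ck_radial_solution[OF assms(1) \<epsilon> l'] in \<open>simp_all del: Ck.simps\<close>)
    then show ?case
      using l(1) by blast
  qed
qed

section \<open>The limit of the first eigenvalues\<close>

text \<open>\<open>LEAST\<close> is meaningful only if a minimum is attained; finiteness of the set
  below one known eigenvalue \<open>l0\<close> supplies it.\<close>

lemma first_eigenvalue_bounds:
  assumes "finite {l. l \<le> l0 \<and> is_eigenvalue \<Omega> T l}" "is_eigenvalue \<Omega> T l0"
    and "\<And>l. is_eigenvalue \<Omega> T l \<Longrightarrow> c \<le> l"
  shows "c \<le> first_eigenvalue \<Omega> T" "first_eigenvalue \<Omega> T \<le> l0"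
proof -
  let ?S = "{l. l \<le> l0 \<and> is_eigenvalue \<Omega> T l}"
  have "l0 \<in> ?S"
    using assms(2) by simp
  then have Min: "Min ?S \<in> ?S"
    using assms(1) by (intro Min_in) auto
  have "first_eigenvalue \<Omega> T = Min ?S"
    unfolding first_eigenvalue_def
  proof (rule Least_equality)
    show "is_eigenvalue \<Omega> T (Min ?S)"
      using Min by simp
    show "Min ?S \<le> l" if "is_eigenvalue \<Omega> T l" for l
      using Min_le[OF assms(1), of l] Min_le[OF assms(1) \<open>l0 \<in> ?S\<close>] that by (cases "l \<le> l0") auto
  qed
  then show "c \<le> first_eigenvalue \<Omega> T" "first_eigenvalue \<Omega> T \<le> l0"
    using Min assms(3) by auto
qed

text \<open>The common end of both proofs: an eigenvalue within \<open>\<delta>\<close> of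
  \<open>\<pi>\<^sup>2\<close> bounds the smallest one from above and starts the finiteness
  argument, and the energy bound on the shell bounds all eigenvalues from below.\<close>

lemma first_eigenvalue_tendsto:
  fixes T :: "real \<Rightarrow> ((real ^ 'n::finite \<Rightarrow> 'b::euclidean_space) \<times> (real ^ 'n \<Rightarrow> 'b)) set"
    and \<D> :: "real \<Rightarrow> (real ^ 'n \<Rightarrow> 'b) set"
  assumes \<D>: "\<And>A. \<D> A \<subseteq> test_functions (annulus A)"
    and weak: "\<And>A l. is_eigenvalue (annulus A) (T A) l \<Longrightarrow> \<exists>u. weak_eigenpair (annulus A) (\<D> A) l u"
    and ex: "\<And>\<delta>. 0 < \<delta> \<Longrightarrow> \<delta> \<le> 1 \<Longrightarrow>
      \<forall>\<^sub>F A in at_top. \<exists>l\<in>{pi\<^sup>2 - \<delta>..pi\<^sup>2 + \<delta>}. is_eigenvalue (annulus A) (T A) l"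
  shows "((\<lambda>A. first_eigenvalue (annulus A) (T A)) \<longlongrightarrow> pi\<^sup>2) at_top"
proof (rule tendstoI)
  fix e :: real assume "e > 0"
  \<comment> \<open>Half of \<open>e\<close> gives the strict inequality at the end; the cap 1 is
    the range in which \<open>ex\<close> applies.\<close>
  define \<delta> where "\<delta> = min (e / 2) 1"
  have \<delta>: "0 < \<delta>" "\<delta> \<le> 1" "\<delta> < e"
    using \<open>e > 0\<close> by (auto simp: \<delta>_def)
  have "\<forall>\<^sub>F A in at_top. \<forall>\<phi> \<in> test_functions (annulus A :: (real ^ 'n) set).
      (pi\<^sup>2 - \<delta>) * L2_inner (annulus A) \<phi> \<phi> \<le> dirichlet (annulus A) \<phi> (\<phi> :: real ^ 'n \<Rightarrow> 'b)"
    by (rule annulus_dirichlet_ge) (use \<delta> in simp)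
  with ex[OF \<delta>(1,2)] show "\<forall>\<^sub>F A in at_top. dist (first_eigenvalue (annulus A) (T A)) (pi\<^sup>2) < e"
  proof eventually_elim
    case (elim A)
    then obtain l0 where l0: "l0 \<in> {pi\<^sup>2 - \<delta>..pi\<^sup>2 + \<delta>}" "is_eigenvalue (annulus A) (T A) l0"
      by blast
    have "{l. l \<le> l0 \<and> is_eigenvalue (annulus A) (T A) l} \<subseteq> {l. l \<le> l0 \<and> (\<exists>u. weak_eigenpair (annulus A) (\<D> A) l u)}"
      using weak by blast
    then have fin: "finite {l. l \<le> l0 \<and> is_eigenvalue (annulus A) (T A) l}"
      using finite_weak_eigenvalues[OF open_annulus bounded_annulus \<D>] by (rule finite_subset)
    have "pi\<^sup>2 - \<delta> \<le> l" if eig: "is_eigenvalue (annulus A) (T A) l" for l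
    proof -
      obtain u where "weak_eigenpair (annulus A) (\<D> A) l u"
        using weak[OF eig] by blast
      then show ?thesis
        by (rule weak_eigenvalue_ge[OF open_annulus \<D>]) (use elim(2) \<D> in blast)
    qed
    then have "pi\<^sup>2 - \<delta> \<le> first_eigenvalue (annulus A) (T A)" "first_eigenvalue (annulus A) (T A) \<le> l0"
      using first_eigenvalue_bounds[OF fin l0(2)] by blast+
    then show ?case
      using l0(1) \<delta>(3) by (auto simp: dist_real_def)
  qed
qed

theorem proposition28:
  assumes "CARD('n::finite) > 1"
  shows "(first_laplace_eigenvalue TYPE('n) \<longlongrightarrow> pi\<^sup>2) at_top
       \<and> (first_stokes_eigenvalue TYPE('n) \<longlongrightarrow> pi\<^sup>2) at_top"
proof
  have "((\<lambda>A. first_eigenvalue (annulus A :: (real ^ 'n) set) (laplace_operator (annulus A))) \<longlongrightarrow> pi\<^sup>2) at_top"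
  proof (rule first_eigenvalue_tendsto[of "\<lambda>A. test_functions (annulus A)"])
    fix \<delta> :: real assume \<delta>: "0 < \<delta>" "\<delta> \<le> 1"
    have "\<forall>\<^sub>F A in at_top. \<exists>l\<in>{pi\<^sup>2 - \<delta>..pi\<^sup>2 + \<delta>}. \<exists>F. shell_mode A (real CARD('n) + 2 * 0) l F
        (\<lambda>x :: real ^ 'n. 1 :: real) (\<lambda>x. 0) 0"
    proof (rule shell_mode_exists[OF _ \<delta>])
      show "\<exists>v :: real ^ 'n. norm v = 1 \<and> (\<forall>r>0. (1 :: real) \<noteq> 0)"
        \<comment> \<open>For a constant \<open>P\<close> every unit vector serves;
          \<open>undefined\<close> is an arbitrary coordinate.\<close>
        by (intro exI[of _ "axis undefined 1"]) simp
    qed (use assms in auto)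
    then show "\<forall>\<^sub>F A in at_top. \<exists>l\<in>{pi\<^sup>2 - \<delta>..pi\<^sup>2 + \<delta>}.
        is_eigenvalue (annulus A :: (real ^ 'n) set) (laplace_operator (annulus A)) l"
      by eventually_elim (blast intro: laplace_eigenvalue_mode)
  qed (auto intro: laplace_operator_weak_eigenpair open_annulus)
  then show "(first_laplace_eigenvalue TYPE('n) \<longlongrightarrow> pi\<^sup>2) at_top"
    by (simp add: first_laplace_eigenvalue_def[abs_def])
next
  \<comment> \<open>A rotation needs a plane, hence two distinct coordinates.\<close>
  obtain p q :: 'n where pq: "p \<noteq> q"
    using assms by (metis card_2_iff' card_le_Suc0_iff_eq finite_code not_less One_nat_def UNIV_I)
  \<comment> \<open>The generator of rotations in the plane of \<open>p\<close> and
    \<open>q\<close>: skew-symmetric, so \<open>x \<bullet> P x\<close> and the trace vanish, and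
    linear, so of degree 1.\<close>
  define P :: "real ^ 'n \<Rightarrow> real ^ 'n" where "P x = x $ p *\<^sub>R axis q 1 - x $ q *\<^sub>R axis p 1" for x
  have lin: "bounded_linear P"
    unfolding P_def[abs_def]
    by (intro bounded_linear_sub bounded_linear_compose[OF bounded_linear_scaleR_left bounded_linear_vec_nth])
  have orth: "x \<bullet> P x = 0" for x
    by (simp add: P_def inner_diff_right inner_axis)
  have trace: "(\<Sum>i\<in>UNIV. P (axis i 1) $ i) = 0"
    by (rule sum.neutral) (use pq in \<open>auto simp: P_def axis_def\<close>)
  have "((\<lambda>A. first_eigenvalue (annulus A :: (real ^ 'n) set) (stokes_operator (annulus A))) \<longlongrightarrow> pi\<^sup>2) at_top"
  proof (rule first_eigenvalue_tendsto[of "\<lambda>A. solenoidal_test_fields (annulus A)"])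
    fix \<delta> :: real assume \<delta>: "0 < \<delta>" "\<delta> \<le> 1"
    have "\<forall>\<^sub>F A in at_top. \<exists>l\<in>{pi\<^sup>2 - \<delta>..pi\<^sup>2 + \<delta>}. \<exists>F. shell_mode A (real CARD('n) + 2 * 1) l F P P 1"
    proof (rule shell_mode_exists[OF _ \<delta>])
      have "P (r *\<^sub>R axis p 1) $ q = r" for r
        using pq by (simp add: P_def axis_def)
      then have "P (r *\<^sub>R axis p 1) \<noteq> 0" if "r > 0" for r
        using that by (metis less_irrefl zero_index)
      then show "\<exists>v. norm v = 1 \<and> (\<forall>r>0. P (r *\<^sub>R v) \<noteq> 0)"
        by (intro exI[of _ "axis p 1"]) simp
    qed (use assms lin in \<open>auto intro: bounded_linear_imp_has_derivative\<close>)
    then show "\<forall>\<^sub>F A in at_top. \<exists>l\<in>{pi\<^sup>2 - \<delta>..pi\<^sup>2 + \<delta>}.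
        is_eigenvalue (annulus A :: (real ^ 'n) set) (stokes_operator (annulus A)) l"
      by eventually_elim (blast intro: stokes_eigenvalue_mode orth trace)
  qed (auto intro: stokes_operator_weak_eigenpair open_annulus bounded_annulus solenoidal_subset[THEN subsetD])
  then show "(first_stokes_eigenvalue TYPE('n) \<longlongrightarrow> pi\<^sup>2) at_top"
    by (simp add: first_stokes_eigenvalue_def[abs_def])
qed

end
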